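(* Let $(M,\mathcal{T},\Phi)$ be a weighted triangulated closed connected surface (with arbitrary Euler characteristic) with a branch structure with orders $\beta=(\beta_1,\dots,\beta_N)^T$. Let $A_i^{\mathbb{E}}=\pi r_i^\alpha$ in $\mathbb{E}^2$ and $A_i^{\mathbb{H}}=4\pi\sinh^\alpha\frac{r_i}{2}$ in $\mathbb{H}^2$, where $\alpha$ is a non-negative real number. Let $\overline{R}:V\to\mathbb{R}$ satisfy $\overline{R}_i\le0$ for all $i$, with $\{\alpha\overline{R}_i\}_{1\le i\le N}$ not identically zero. If $\overline{R}$ is $A$-admissible in $\mathbb{E}^2$ with $R^{\mathbb{E}}_{H,A,i}(\overline{r}^{\mathbb{E}})=\overline{R}_i$ for all $i$, and similarly $A$-admissible in $\mathbb{H}^2$ with $R^{\mathbb{H}}_{H,A,i}(\overline{r}^{\mathbb{H}})=\overline{R}_i$ for all $i$, then $\overline{r}^{\mathbb{E}}$ and $\overline{r}^{\mathbb{H}}$ are the unique circle packing metrics with branched $A$-curvature $\overline{R}$ in $\mathbb{E}^2$ and $\mathbb{H}^2$, respectively. Furthermore, $\overline{R}$ is the branched $A$-curvature of $\overline{r}^{\mathbb{E}}$ in $\mathbb{E}^2$ (resp. of $\overline{r}^{\mathbb{H}}$ in $\mathbb{H}^2$) if and only if the solutions to the flow $$\frac{\mathrm{d}u_i^{\mathbb{E}}}{\mathrm{d}t}=\overline{R}_i-R^{\mathbb{E}}_{H,A,i}\qquad\Big(\text{resp. }\ \frac{\mathrm{d}u_i^{\mathbb{H}}}{\mathrm{d}t}=\overline{R}_i-R^{\mathbb{H}}_{H,A,i}\Big)$$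 exist for all time and converge exponentially fast to $\overline{r}^{\mathbb{E}}$ (resp. $\overline{r}^{\mathbb{H}}$).
   Context: $M$ is a closed connected surface with a triangulation $\mathcal{T}=\{V,E,F\}$, $V=\{v_1,\dots,v_N\}$, and a weight $\Phi:E\to[0,\pi/2]$, $\Phi_{ij}=\Phi(e_{ij})$. A circle packing metric is a function $r=(r_1,\dots,r_N)^T:V\to(0,+\infty)$. The edge $e_{ij}$ has length $l_{ij}=\sqrt{r_i^2+r_j^2+2r_ir_j\cos\Phi_{ij}}$ in Euclidean background geometry $\mathbb{E}^2$, and $l_{ij}=\cosh^{-1}(\cosh r_i\cosh r_j+\sinh r_i\sinh r_j\cos\Phi_{ij})$ in hyperbolic background geometry $\mathbb{H}^2$; each face $\Delta_{ijk}$ is then a Euclidean (resp. hyperbolic) triangle, $\theta_i^{ijk}$ is its inner angle at $v_i$, and $K_i=2\pi-\sum_{f_{ijk}\in F}\theta_i^{ijk}$ (sum over all triangles having $v_i$ as a vertex). Coordinates: $u_i^{\mathbb{E}}=\ln r_i$ and $u_i^{\mathbb{H}}=\ln\tanh\frac{r_i}{2}$. Branch structure: a (possibly empty) set $\{(b_1,\beta_1),\dots,(b_m,\beta_m)\}$ of distinct vertices with orders $\beta_j\in\mathbb{Z}_{>0}$; write $\beta_i$ for the order at $v_i$, with $\beta_i=0$ if $v_i$ is not one of the $b_j$. It is a branch structure if each simple closed path $\Gamma=\{e_1,\dots,e_n\}$ in $\mathcal{T}$ satisfies $\sum_{j=1}^n[\pi-\Phi(e_j)]>2(l(\Gamma)+1)\pi$,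 where $l(\Gamma)$ is the sum of the orders of the branch points enclosed by $\Gamma$. The branched $A$-curvature is $R^{\mathbb{E}}_{H,A,i}=(K_i+2\pi\beta_i)/A_i^{\mathbb{E}}$ in $\mathbb{E}^2$ (Euclidean $K_i$) and $R^{\mathbb{H}}_{H,A,i}=(K_i+2\pi\beta_i)/A_i^{\mathbb{H}}$ in $\mathbb{H}^2$ (hyperbolic $K_i$). $\overline{R}$ is $A$-admissible in $\mathbb{E}^2$ (resp. $\mathbb{H}^2$) if there is a circle packing metric $\overline{r}^{\mathbb{E}}$ (resp. $\overline{r}^{\mathbb{H}}$) whose branched $A$-curvature in $\mathbb{E}^2$ (resp. $\mathbb{H}^2$) equals $\overline{R}$. The solutions of the flows are considered for arbitrary initial circle packing metrics. *)

theory Defs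
  imports "HOL-Analysis.Analysis"
begin

definition closed_connected_surface :: "'m topology \<Rightarrow> bool" where
  "closed_connected_surface M \<longleftrightarrow>
     topspace M \<noteq> {} \<and> compact_space M \<and> connected_space M \<and>
     Hausdorff_space M \<and> second_countable M \<and>
     (\<forall>x\<in>topspace M. \<exists>U. openin M U \<and> x \<in> U \<and>
        subtopology M U homeomorphic_space (euclidean :: (real ^ 2) topology))"

text \<open>Geometric realization, in barycentric coordinates, of the simplicial complex generated by
  a collection \<open>K\<close> of finite vertex sets (the members of \<open>K\<close> together with all their nonempty
  subsets). The topology is that of pointwise convergence; for a finite complex this is the usual one.\<close>

definition realization :: "'v set set \<Rightarrow> ('v \<Rightarrow> real) set" where
  "realization K =
     {x. \<exists>s\<in>K. (\<forall>v\<in>s. 0 \<le> x v) \<and> (\<forall>v. v \<notin> s \<longrightarrow> x v = 0) \<and> (\<Sum>v\<in>s. x v) = 1}"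

definition vertex_point :: "'v \<Rightarrow> 'v \<Rightarrow> real" where
  "vertex_point v = (\<lambda>w. if w = v then 1 else 0)"

text \<open>Edges and faces are identified with their vertex sets.\<close>

definition surface_triangulation ::
    "'m topology \<Rightarrow> 'v set \<Rightarrow> 'v set set \<Rightarrow> 'v set set \<Rightarrow> bool" where
  "surface_triangulation M V E F \<longleftrightarrow>
     finite V \<and> V = \<Union>F \<and> (\<forall>f\<in>F. card f = 3) \<and>
     E = {e. card e = 2 \<and> (\<exists>f\<in>F. e \<subseteq> f)} \<and>
     M homeomorphic_space (top_of_set (realization F))"


subsection \<open>Branch structures\<close>

text \<open>A simple closed path is given by the cyclic list of its vertices. In a simplicial complex
  it has at least three edges.\<close>

definition simple_closed_path :: "'v set set \<Rightarrow> 'v list \<Rightarrow> bool" where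
  "simple_closed_path E p \<longleftrightarrow>
     distinct p \<and> 3 \<le> length p \<and> (\<forall>j<length p. {p ! j, p ! (Suc j mod length p)} \<in> E)"

definition path_edges :: "'v list \<Rightarrow> 'v set set" where
  "path_edges p = (\<lambda>j. {p ! j, p ! (Suc j mod length p)}) ` {..<length p}"

definition bounds_disc :: "'v set set \<Rightarrow> 'v list \<Rightarrow> ('v \<Rightarrow> real) set \<Rightarrow> bool" where
  "bounds_disc F p D \<longleftrightarrow>
     D \<subseteq> realization F \<and>
     (\<exists>h g. homeomorphism D (cball (0::real ^ 2) 1) h g \<and>
            realization (path_edges p) = g ` sphere 0 1)"

text \<open>The points enclosed by a path are those in the interior of the closed disc that it bounds;
  a path that bounds no disc encloses nothing. The disc is unique unless the surface is a sphere,
  where a path bounds two discs; there the side with the smaller total order counts as the inside.\<close>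

definition enclosed_order ::
    "'v set \<Rightarrow> 'v set set \<Rightarrow> ('v \<Rightarrow> nat) \<Rightarrow> 'v list \<Rightarrow> nat" where
  "enclosed_order V F \<beta> p =
     (if \<exists>D. bounds_disc F p D
      then (INF D\<in>{D. bounds_disc F p D}.
              \<Sum>v\<in>{v\<in>V. vertex_point v \<in> D - realization (path_edges p)}. \<beta> v)
      else 0)"

text \<open>\<open>\<beta> v\<close> is the order at \<open>v\<close>, and is \<open>0\<close> when \<open>v\<close> is not a branch point.\<close>

definition branch_structure ::
    "'v set \<Rightarrow> 'v set set \<Rightarrow> 'v set set \<Rightarrow> ('v set \<Rightarrow> real) \<Rightarrow> ('v \<Rightarrow> nat) \<Rightarrow> bool" where
  "branch_structure V E F \<Phi> \<beta> \<longleftrightarrow>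
     (\<forall>p. simple_closed_path E p \<longrightarrow>
        (\<Sum>j<length p. pi - \<Phi> {p ! j, p ! (Suc j mod length p)})
          > 2 * (real (enclosed_order V F \<beta> p) + 1) * pi)"


subsection \<open>Circle packing metrics and their curvatures\<close>

definition circle_packing_metric :: "'v set \<Rightarrow> ('v \<Rightarrow> real) \<Rightarrow> bool" where
  "circle_packing_metric V r \<longleftrightarrow> (\<forall>v\<in>V. 0 < r v)"

text \<open>The formulas for lengths and angles are symmetric in the unnamed vertices, so they are
  written as sums and products over the vertex set of an edge or face; the lemmas below display
  them for edges \<open>{i, j}\<close> and faces \<open>{i, j, k}\<close>. Inner angles are given by the Euclidean,
  respectively hyperbolic, law of cosines, \<open>f - {v}\<close> being the edge of \<open>f\<close> opposite to \<open>v\<close>.\<close>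

definition euc_length :: "('v set \<Rightarrow> real) \<Rightarrow> ('v \<Rightarrow> real) \<Rightarrow> 'v set \<Rightarrow> real" where
  "euc_length \<Phi> r e = sqrt ((\<Sum>v\<in>e. (r v)\<^sup>2) + 2 * (\<Prod>v\<in>e. r v) * cos (\<Phi> e))"

definition hyp_length :: "('v set \<Rightarrow> real) \<Rightarrow> ('v \<Rightarrow> real) \<Rightarrow> 'v set \<Rightarrow> real" where
  "hyp_length \<Phi> r e = arcosh ((\<Prod>v\<in>e. cosh (r v)) + (\<Prod>v\<in>e. sinh (r v)) * cos (\<Phi> e))"

definition euc_angle :: "('v set \<Rightarrow> real) \<Rightarrow> ('v \<Rightarrow> real) \<Rightarrow> 'v \<Rightarrow> 'v set \<Rightarrow> real" where
  "euc_angle \<Phi> r v f =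
     arccos (((\<Sum>w\<in>f - {v}. (euc_length \<Phi> r {v, w})\<^sup>2) - (euc_length \<Phi> r (f - {v}))\<^sup>2)
             / (2 * (\<Prod>w\<in>f - {v}. euc_length \<Phi> r {v, w})))"

definition hyp_angle :: "('v set \<Rightarrow> real) \<Rightarrow> ('v \<Rightarrow> real) \<Rightarrow> 'v \<Rightarrow> 'v set \<Rightarrow> real" where
  "hyp_angle \<Phi> r v f =
     arccos (((\<Prod>w\<in>f - {v}. cosh (hyp_length \<Phi> r {v, w})) - cosh (hyp_length \<Phi> r (f - {v})))
             / (\<Prod>w\<in>f - {v}. sinh (hyp_length \<Phi> r {v, w})))"

lemma euc_length_edge:
  "i \<noteq> j \<Longrightarrow>
   euc_length \<Phi> r {i, j} = sqrt ((r i)\<^sup>2 + (r j)\<^sup>2 + 2 * r i * r j * cos (\<Phi> {i, j}))"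
  by (simp add: euc_length_def)

lemma hyp_length_edge:
  "i \<noteq> j \<Longrightarrow>
   hyp_length \<Phi> r {i, j} =
     arcosh (cosh (r i) * cosh (r j) + sinh (r i) * sinh (r j) * cos (\<Phi> {i, j}))"
  by (simp add: hyp_length_def)

lemma euc_angle_face:
  assumes "i \<noteq> j" "i \<noteq> k" "j \<noteq> k"
  shows "euc_angle \<Phi> r i {i, j, k} =
    (let a = euc_length \<Phi> r {i, j}; b = euc_length \<Phi> r {i, k}; c = euc_length \<Phi> r {j, k}
     in arccos ((a\<^sup>2 + b\<^sup>2 - c\<^sup>2) / (2 * a * b)))"
proof -
  have "{i, j, k} - {i} = {j, k}" using assms by auto
  then show ?thesis using assms by (simp add: euc_angle_def Let_def mult.assoc)
qed

lemma hyp_angle_face: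
  assumes "i \<noteq> j" "i \<noteq> k" "j \<noteq> k"
  shows "hyp_angle \<Phi> r i {i, j, k} =
    (let a = hyp_length \<Phi> r {i, j}; b = hyp_length \<Phi> r {i, k}; c = hyp_length \<Phi> r {j, k}
     in arccos ((cosh a * cosh b - cosh c) / (sinh a * sinh b)))"
proof -
  have "{i, j, k} - {i} = {j, k}" using assms by auto
  then show ?thesis using assms by (simp add: hyp_angle_def Let_def)
qed

definition euc_curvature ::
    "'v set set \<Rightarrow> ('v set \<Rightarrow> real) \<Rightarrow> ('v \<Rightarrow> real) \<Rightarrow> 'v \<Rightarrow> real" where
  "euc_curvature F \<Phi> r v = 2 * pi - (\<Sum>f\<in>{f\<in>F. v \<in> f}. euc_angle \<Phi> r v f)"

definition hyp_curvature ::
    "'v set set \<Rightarrow> ('v set \<Rightarrow> real) \<Rightarrow> ('v \<Rightarrow> real) \<Rightarrow> 'v \<Rightarrow> real" where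
  "hyp_curvature F \<Phi> r v = 2 * pi - (\<Sum>f\<in>{f\<in>F. v \<in> f}. hyp_angle \<Phi> r v f)"

definition euc_area :: "real \<Rightarrow> ('v \<Rightarrow> real) \<Rightarrow> 'v \<Rightarrow> real" where
  "euc_area \<alpha> r v = pi * r v powr \<alpha>"

definition hyp_area :: "real \<Rightarrow> ('v \<Rightarrow> real) \<Rightarrow> 'v \<Rightarrow> real" where
  "hyp_area \<alpha> r v = 4 * pi * sinh (r v / 2) powr \<alpha>"

definition euc_branched_curvature ::
    "'v set set \<Rightarrow> ('v set \<Rightarrow> real) \<Rightarrow> ('v \<Rightarrow> nat) \<Rightarrow> real \<Rightarrow> ('v \<Rightarrow> real) \<Rightarrow> 'v \<Rightarrow> real" where
  "euc_branched_curvature F \<Phi> \<beta> \<alpha> r v =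
     (euc_curvature F \<Phi> r v + 2 * pi * real (\<beta> v)) / euc_area \<alpha> r v"

definition hyp_branched_curvature ::
    "'v set set \<Rightarrow> ('v set \<Rightarrow> real) \<Rightarrow> ('v \<Rightarrow> nat) \<Rightarrow> real \<Rightarrow> ('v \<Rightarrow> real) \<Rightarrow> 'v \<Rightarrow> real" where
  "hyp_branched_curvature F \<Phi> \<beta> \<alpha> r v =
     (hyp_curvature F \<Phi> r v + 2 * pi * real (\<beta> v)) / hyp_area \<alpha> r v"

definition euc_coord :: "real \<Rightarrow> real" where
  "euc_coord x = ln x"

definition hyp_coord :: "real \<Rightarrow> real" where
  "hyp_coord x = ln (tanh (x / 2))"


subsection \<open>Curvature flows\<close>

text \<open>In the following, \<open>u\<close> is the coordinate function, \<open>R\<close> assigns to a metric its curvature,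
  \<open>Rbar\<close> is the target curvature, and a flow line is recorded by its radii \<open>r t v\<close>.\<close>

definition flow_solution ::
    "'v set \<Rightarrow> (real \<Rightarrow> real) \<Rightarrow> (('v \<Rightarrow> real) \<Rightarrow> 'v \<Rightarrow> real) \<Rightarrow> ('v \<Rightarrow> real) \<Rightarrow>
     real set \<Rightarrow> ('v \<Rightarrow> real) \<Rightarrow> (real \<Rightarrow> 'v \<Rightarrow> real) \<Rightarrow> bool" where
  "flow_solution V u R Rbar J r0 r \<longleftrightarrow>
     (\<forall>v\<in>V. r 0 v = r0 v) \<and>
     (\<forall>t\<in>J. circle_packing_metric V (r t) \<and>
        (\<forall>v\<in>V. ((\<lambda>s. u (r s v)) has_real_derivative (Rbar v - R (r t) v)) (at t within J)))"

definition converges_exponentially ::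
    "'v set \<Rightarrow> (real \<Rightarrow> 'v \<Rightarrow> real) \<Rightarrow> ('v \<Rightarrow> real) \<Rightarrow> bool" where
  "converges_exponentially V r rbar \<longleftrightarrow>
     (\<exists>C c. 0 < c \<and> (\<forall>t\<ge>0. \<forall>v\<in>V. \<bar>r t v - rbar v\<bar> \<le> C * exp (- c * t)))"

text \<open>For every initial metric a solution exists on \<open>[0, \<infinity>)\<close>, no solution ends in finite time
  (one on \<open>[0, T)\<close> always extends to \<open>[0, \<infinity>)\<close>), and every solution on \<open>[0, \<infinity>)\<close>
  converges exponentially fast to \<open>rbar\<close>.\<close>

definition flow_converges_exponentially ::
    "'v set \<Rightarrow> (real \<Rightarrow> real) \<Rightarrow> (('v \<Rightarrow> real) \<Rightarrow> 'v \<Rightarrow> real) \<Rightarrow> ('v \<Rightarrow> real) \<Rightarrow>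
     ('v \<Rightarrow> real) \<Rightarrow> bool" where
  "flow_converges_exponentially V u R Rbar rbar \<longleftrightarrow>
     (\<forall>r0. circle_packing_metric V r0 \<longrightarrow>
        (\<exists>r. flow_solution V u R Rbar {0..} r0 r) \<and>
        (\<forall>T>0. \<forall>r. flow_solution V u R Rbar {0..<T} r0 r \<longrightarrow>
           (\<exists>r'. flow_solution V u R Rbar {0..} r0 r' \<and> (\<forall>t\<in>{0..<T}. \<forall>v\<in>V. r' t v = r t v))) \<and>
        (\<forall>r. flow_solution V u R Rbar {0..} r0 r \<longrightarrow> converges_exponentially V r rbar))"

end

theory Submission
  imports Defs
begin

text \<open>In the coordinates \<open>z = ln r\<close> (Euclidean) and \<open>z = ln (sinh r)\<close> (hyperbolic) the angle at \<open>i\<close> of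
  a face \<open>{i, j, k}\<close> is a function of \<open>z\<^sub>i\<close>, \<open>z\<^sub>i - z\<^sub>j\<close> and \<open>z\<^sub>i - z\<^sub>k\<close>. It is nonincreasing in the
  first argument and strictly decreasing, with bounds uniform on compact sets, in the other two; the
  branch condition on the boundary of a face excludes the only degenerate weight. For
  \<open>\<alpha> > 0\<close> and \<open>Rbar \<le> 0\<close> the term \<open>Rbar * area\<close> is nonincreasing as well, strictly so at a vertex
  \<open>i0\<close> with \<open>Rbar i0 < 0\<close>. As the 1-skeleton is connected, there are weights \<open>q \<ge> 1\<close>, growing with
  the graph distance to \<open>i0\<close>, such that moving \<open>z\<close> in the direction \<open>q\<close> decreases
  \<open>Rbar * area - curvature\<close> at every vertex at a uniform rate. Hence the maximum principle
  applies to \<open>max |z - zbar| / q\<close>, which decays exponentially along the flow. This bounds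
  the flow in a box, so that it exists for all time, and it gives convergence, and uniqueness of
  the equilibrium by applying it to constant solutions.\<close>

text \<open>No variational principle is involved; everything rests on comparison at a vertex where
  \<open>(z - zbar) / q\<close> is extremal. Equal weights would not make this comparison strict: at
  a vertex with \<open>Rbar v = 0\<close> the area term contributes nothing, and Euclidean angles do
  not change when all radii are scaled together. The strictness present at \<open>i0\<close> has to
  be spread over the graph. The initial metric is arbitrary, so the comparison is needed for finite
  displacements, not infinitesimal ones; hence all estimates bound difference quotients, with one
  constant per box. The coordinate \<open>ln (sinh r)\<close> is chosen because
  \<open>sinh r\<^sub>i * coth r\<^sub>j\<close> equals
  \<open>sqrt (exp (2 * x) + exp (2 * y))\<close> with \<open>x = z\<^sub>i\<close> and
  \<open>y = z\<^sub>i - z\<^sub>j\<close>, which increases in both arguments. The flow is written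
  in another coordinate \<open>u\<close>, but \<open>dz / du\<close> is at least 1, so passing from
  \<open>u\<close> to \<open>z\<close> keeps signs and rates. The degenerate weight is 0 on
  \<open>{i, j}\<close> and a right angle on the two other edges: then the angle at \<open>i\<close>
  does not depend on \<open>r\<^sub>j\<close>, and strictness would be lost along that edge.\<close>

subsection \<open>Ordinary differential equations\<close>

text \<open>At the earliest time when some member of the family is not positive, it vanishes while
  all others are still nonnegative, by left limits. A positive derivative there would make it
  negative shortly before. The premise \<open>touch\<close> may use the sign of the whole family,
  which is what a maximum principle over all vertices requires.\<close>

lemma first_touch:
  fixes h :: "'i \<Rightarrow> real \<Rightarrow> real"
  assumes "finite I" "0 \<le> s"
    and cont: "\<And>k. k \<in> I \<Longrightarrow> continuous_on {0..s} (h k)"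
    and init: "\<And>k. k \<in> I \<Longrightarrow> 0 < h k 0"
    and touch: "\<And>k t. k \<in> I \<Longrightarrow> 0 < t \<Longrightarrow> t \<le> s \<Longrightarrow> (\<forall>j\<in>I. 0 \<le> h j t) \<Longrightarrow> h k t = 0
      \<Longrightarrow> \<exists>d>0. (h k has_real_derivative d) (at t within {0..s})"
  shows "\<forall>t\<in>{0..s}. \<forall>k\<in>I. 0 < h k t"
proof (rule ccontr)
  define S where "S = (\<Union>k\<in>I. {t\<in>{0..s}. h k t \<le> 0})"
  assume "\<not> ?thesis"
  then have ne: "S \<noteq> {}" unfolding S_def by force
  have "closed {t\<in>{0..s}. h k t \<le> 0}" if "k \<in> I" for k
    using continuous_closed_preimage[OF cont[OF that], of "{..0}"]
    by (simp add: vimage_def Int_def conj_commute)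
  then have "closed S" unfolding S_def using \<open>finite I\<close> by blast
  moreover have bdd: "bdd_below S" unfolding S_def by (auto intro!: bdd_belowI[of _ 0])
  ultimately have inf: "Inf S \<in> S" using closed_contains_Inf ne by blast
  define t where "t = Inf S"
  obtain k where k: "k \<in> I" "h k t \<le> 0" and t: "t \<in> {0..s}"
    using inf unfolding t_def S_def by auto
  have before: "0 < h j x" if "j \<in> I" "0 \<le> x" "x < t" for j x
  proof (rule ccontr)
    assume "\<not> 0 < h j x"
    then have "x \<in> S" using that t unfolding S_def by (auto intro!: bexI[of _ j])
    then show False using cInf_lower[OF _ bdd] that(3) unfolding t_def by fastforce
  qed
  have "t \<noteq> 0" using init[OF k(1)] k(2) by auto
  then have t0: "0 < t" using t by auto
  have ge: "0 \<le> h j t" if "j \<in> I" for j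
  proof (rule tendsto_lowerbound)
    have "continuous_on {0..t} (h j)"
      using cont[OF that] by (rule continuous_on_subset) (use t in auto)
    then show "(h j \<longlongrightarrow> h j t) (at_left t)"
      using t0 continuous_on_Icc_at_leftD by blast
    show "\<forall>\<^sub>F x in at_left t. 0 \<le> h j x"
      using eventually_at_left_real[OF t0] by eventually_elim (simp add: before[OF that] less_imp_le)
  qed simp
  have "h k t = 0" using k ge by (simp add: order_antisym)
  then obtain d where d: "0 < d" "(h k has_real_derivative d) (at t within {0..s})"
    using touch[OF k(1) t0] t ge by auto
  obtain e where e: "0 < e" "\<And>x. 0 < x \<Longrightarrow> t - x \<in> {0..s} \<Longrightarrow> x < e \<Longrightarrow> h k (t - x) < h k t"
    using has_real_derivative_pos_inc_left[OF d(2,1)] by blast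
  define x where "x = min (t/2) (e/2)"
  have "0 < x" "x < e" "x < t" using t0 e(1) by (auto simp: x_def)
  then have "h k (t - x) < 0" using e(2)[of x] t \<open>h k t = 0\<close> by auto
  moreover have "0 < h k (t - x)" using before[OF k(1), of "t - x"] \<open>0 < x\<close> \<open>x < t\<close> by auto
  ultimately show False by simp
qed

section \<open>Existence and uniqueness for globally Lipschitz fields\<close>

definition ode_solution ::
    "'v set \<Rightarrow> (('v \<Rightarrow> real) \<Rightarrow> 'v \<Rightarrow> real) \<Rightarrow> real set \<Rightarrow> ('v \<Rightarrow> real) \<Rightarrow> (real \<Rightarrow> 'v \<Rightarrow> real) \<Rightarrow> bool" where
  "ode_solution V G J z0 z \<longleftrightarrow>
     (\<forall>v\<in>V. z 0 v = z0 v) \<and>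
     (\<forall>t\<in>J. \<forall>v\<in>V. ((\<lambda>s. z s v) has_real_derivative G (z t) v) (at t within J))"

primrec picard ::
    "(('v \<Rightarrow> real) \<Rightarrow> 'v \<Rightarrow> real) \<Rightarrow> ('v \<Rightarrow> real) \<Rightarrow> nat \<Rightarrow> real \<Rightarrow> 'v \<Rightarrow> real" where
  "picard g z0 0 = (\<lambda>t. z0)"
| "picard g z0 (Suc n) = (\<lambda>t v. z0 v + integral {0..t} (\<lambda>s. g (picard g z0 n s) v))"

context
  fixes V :: "'v set" and g :: "('v \<Rightarrow> real) \<Rightarrow> 'v \<Rightarrow> real" and L :: real
  assumes finite_V: "finite V"
    and lip: "\<And>x y v. v \<in> V \<Longrightarrow> \<bar>g x v - g y v\<bar> \<le> L * (\<Sum>w\<in>V. \<bar>x w - y w\<bar>)"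
begin

lemma lipschitz_field_continuous:
  assumes "\<And>w. w \<in> V \<Longrightarrow> continuous_on S (\<lambda>s. x s w)" "v \<in> V"
  shows "continuous_on S (\<lambda>s. g (x s) v)"
  unfolding continuous_on_def
proof
  fix s assume s: "s \<in> S"
  have "((\<lambda>a. L * (\<Sum>w\<in>V. \<bar>x a w - x s w\<bar>)) \<longlongrightarrow> L * (\<Sum>w\<in>V. \<bar>x s w - x s w\<bar>)) (at s within S)"
    by (intro tendsto_intros) (use assms(1) s in \<open>auto simp: continuous_on_def\<close>)
  then have "((\<lambda>a. L * (\<Sum>w\<in>V. \<bar>x a w - x s w\<bar>)) \<longlongrightarrow> 0) (at s within S)" by simp
  then have "((\<lambda>a. g (x a) v - g (x s) v) \<longlongrightarrow> 0) (at s within S)"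
    by (rule Lim_null_comparison[rotated]) (use lip[OF assms(2)] in auto)
  then show "((\<lambda>a. g (x a) v) \<longlongrightarrow> g (x s) v) (at s within S)"
    by (simp add: LIM_zero_iff)
qed

lemma picard_continuous:
  assumes "v \<in> V"
  shows "continuous_on {0..T} (\<lambda>t. picard g z0 n t v)"
  using assms
proof (induction n arbitrary: v)
  case (Suc n)
  have "continuous_on {0..T} (\<lambda>s. g (picard g z0 n s) v)"
    by (rule lipschitz_field_continuous[OF Suc.IH Suc.prems])
  then show ?case
    by (auto intro!: continuous_intros indefinite_integral_continuous_1 integrable_continuous_real)
qed auto

lemma lip_nonneg: "V \<noteq> {} \<Longrightarrow> 0 \<le> L"
proof -
  assume "V \<noteq> {}"
  then obtain v where v: "v \<in> V" by blast
  have "0 \<le> L * (\<Sum>w\<in>V. \<bar>1 - 0\<bar>)" using lip[OF v, of "\<lambda>_. 1" "\<lambda>_. 0"] by linarith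
  moreover have "(\<Sum>w\<in>V. \<bar>1 - 0 :: real\<bar>) > 0" using v finite_V by (intro sum_pos) auto
  ultimately show ?thesis by (simp add: zero_le_mult_iff)
qed

lemma integral_exp_le:
  fixes K t :: real
  assumes "0 < K" "0 \<le> t"
  shows "(\<lambda>s. exp (K * s)) integrable_on {0..t}" "integral {0..t} (\<lambda>s. exp (K * s)) \<le> exp (K * t) / K"
proof -
  have "((\<lambda>s. exp (K * s)) has_integral exp (K * t) / K - exp (K * 0) / K) {0..t}"
    using assms by (intro fundamental_theorem_of_calculus[where f = "\<lambda>s. exp (K * s) / K"])
      (auto intro!: derivative_eq_intros simp flip: has_real_derivative_iff_has_vector_derivative)
  then show "(\<lambda>s. exp (K * s)) integrable_on {0..t}" "integral {0..t} (\<lambda>s. exp (K * s)) \<le> exp (K * t) / K"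
    using assms by (auto simp: has_integral_iff)
qed

text \<open>In the norm weighted by \<open>exp (- K * s)\<close> the Picard operator has Lipschitz
  constant \<open>L * card V / K\<close>. A large \<open>K\<close> makes it a contraction on every
  interval at once, so no solutions on short intervals have to be glued.\<close>

lemma integral_field_diff_le:
  assumes "v \<in> V" "0 \<le> t" "0 < K" "0 \<le> c"
    and cont: "\<And>w. w \<in> V \<Longrightarrow> continuous_on {0..t} (\<lambda>s. x s w)"
      "\<And>w. w \<in> V \<Longrightarrow> continuous_on {0..t} (\<lambda>s. y s w)"
    and le: "\<And>w s. w \<in> V \<Longrightarrow> 0 \<le> s \<Longrightarrow> s \<le> t \<Longrightarrow> \<bar>x s w - y s w\<bar> \<le> c * exp (K * s)"
  shows "\<bar>integral {0..t} (\<lambda>s. g (x s) v) - integral {0..t} (\<lambda>s. g (y s) v)\<bar>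
    \<le> L * card V / K * c * exp (K * t)"
proof -
  have L: "0 \<le> L" using lip_nonneg assms(1) by auto
  have int: "(\<lambda>s. g (x s) v) integrable_on {0..t}" "(\<lambda>s. g (y s) v) integrable_on {0..t}"
    by (rule integrable_continuous_real lipschitz_field_continuous cont assms(1) | assumption)+
  have "\<bar>integral {0..t} (\<lambda>s. g (x s) v) - integral {0..t} (\<lambda>s. g (y s) v)\<bar>
      = norm (integral {0..t} (\<lambda>s. g (x s) v - g (y s) v))"
    using integral_diff[OF int] by simp
  also have "\<dots> \<le> integral {0..t} (\<lambda>s. L * card V * c * exp (K * s))"
  proof (rule integral_norm_bound_integral)
    fix s assume s: "s \<in> {0..t}"
    have "\<bar>g (x s) v - g (y s) v\<bar> \<le> L * (\<Sum>w\<in>V. \<bar>x s w - y s w\<bar>)" by (rule lip[OF assms(1)])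
    also have "\<dots> \<le> L * (\<Sum>w\<in>V. c * exp (K * s))"
      using s le by (intro mult_left_mono sum_mono L) auto
    finally show "norm (g (x s) v - g (y s) v) \<le> L * card V * c * exp (K * s)" by (simp add: mult_ac)
  qed (use integral_exp_le(1)[OF \<open>0 < K\<close> \<open>0 \<le> t\<close>] int in \<open>auto intro!: integrable_diff integrable_on_mult_right\<close>)
  also have "\<dots> = L * card V * c * integral {0..t} (\<lambda>s. exp (K * s))" by simp
  also have "\<dots> \<le> L * card V * c * (exp (K * t) / K)"
    using integral_exp_le(2)[OF \<open>0 < K\<close> \<open>0 \<le> t\<close>] L assms(4) by (intro mult_left_mono) auto
  finally show ?thesis by (simp add: field_simps)
qed

lemma ode_solution_exists: "\<exists>z. ode_solution V g {0..} z0 z"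
proof (cases "V = {}")
  case True
  then show ?thesis by (auto simp: ode_solution_def)
next
  case False
  have L: "0 \<le> L" using lip_nonneg False .
  \<comment> \<open>The contraction factor becomes at most 1/2. Moreover \<open>K\<close> is at
    least 1, which gives \<open>t \<le> exp (K * t)\<close> for the first Picard step.\<close>
  define K where "K = 2 * (L * card V + 1)"
  have K: "0 < K" "L * card V / K \<le> 1/2" using L by (auto simp: K_def field_simps add_pos_nonneg add_nonneg_pos)
  define c where "c = (\<Sum>v\<in>V. \<bar>g z0 v\<bar>)"
  have c: "0 \<le> c" "\<And>v. v \<in> V \<Longrightarrow> \<bar>g z0 v\<bar> \<le> c"
    unfolding c_def using finite_V by (auto intro!: sum_nonneg member_le_sum)
  let ?P = "picard g z0"
  have step: "\<bar>?P (Suc n) t v - ?P n t v\<bar> \<le> c * (1/2)^n * exp (K * t)" if "0 \<le> t" "v \<in> V" for n t v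
    using that
  proof (induction n arbitrary: t v)
    case 0
    have "t \<le> exp (K * t)"
    proof -
      have "t \<le> K * t" using 0 L by (auto simp: K_def mult_le_cancel_right1 add_increasing)
      also have "\<dots> \<le> exp (K * t)" using exp_ge_add_one_self[of "K * t"] by linarith
      finally show ?thesis .
    qed
    then have "t * \<bar>g z0 v\<bar> \<le> exp (K * t) * c" using 0 c by (intro mult_mono) auto
    then show ?case using 0 by (simp add: abs_mult mult_ac)
  next
    case (Suc n)
    have "\<bar>?P (Suc (Suc n)) t v - ?P (Suc n) t v\<bar> \<le> L * card V / K * (c * (1/2)^n) * exp (K * t)"
    proof -
      have "?P (Suc (Suc n)) t v - ?P (Suc n) t v =
          integral {0..t} (\<lambda>s. g (?P (Suc n) s) v) - integral {0..t} (\<lambda>s. g (?P n s) v)"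
        by (subst (1 2) picard.simps(2)) simp
      moreover have "\<bar>\<dots>\<bar> \<le> L * card V / K * (c * (1/2)^n) * exp (K * t)"
        by (rule integral_field_diff_le) (use Suc K c in \<open>auto simp del: picard.simps intro: picard_continuous\<close>)
      ultimately show ?thesis by simp
    qed
    also have "\<dots> \<le> 1/2 * (c * (1/2)^n) * exp (K * t)"
      using K c by (intro mult_right_mono) auto
    finally show ?case by simp
  qed
  have summ: "summable (\<lambda>n. c * (1/2)^n * exp (K * t))" for t
    by (intro summable_mult2 summable_mult summable_geometric) auto
  \<comment> \<open>The limit of the iterates, written as a telescoping series that
    \<open>step\<close> dominates by a geometric one; \<open>tail\<close> is the remainder
    estimate.\<close>
  define z where "z t v = z0 v + (\<Sum>n. ?P (Suc n) t v - ?P n t v)" for t v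
  have partial: "?P n t v = z0 v + (\<Sum>i<n. ?P (Suc i) t v - ?P i t v)" for n t v
    by (subst sum_lessThan_telescope) simp
  have tail: "\<bar>z t v - ?P n t v\<bar> \<le> 2 * c * (1/2)^n * exp (K * t)" if "0 \<le> t" "v \<in> V" for n t v
  proof -
    let ?d = "\<lambda>n. ?P (Suc n) t v - ?P n t v"
    have s: "summable (\<lambda>n. norm (?d n))"
      by (rule summable_comparison_test'[OF summ[of t], of 0]) (use step[OF that] in auto)
    have "z t v - ?P n t v = (\<Sum>i. ?d (i + n))"
      unfolding z_def partial[of n] using suminf_minus_initial_segment[OF summable_norm_cancel[OF s], of n] by simp
    also have "\<bar>\<dots>\<bar> \<le> (\<Sum>i. norm (?d (i + n)))"
      using summable_norm[of "\<lambda>i. ?d (i + n)"] summable_ignore_initial_segment[OF s, of n] by simp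
    also have "\<dots> \<le> (\<Sum>i. c * (1/2)^(i + n) * exp (K * t))"
      by (intro suminf_le summable_ignore_initial_segment[OF s] summable_ignore_initial_segment[OF summ])
        (use step[OF that] in auto)
    also have "\<dots> = (\<Sum>i. (c * (1/2)^n * exp (K * t)) * (1/2)^i)" by (simp add: power_add mult_ac)
    also have "\<dots> = 2 * c * (1/2)^n * exp (K * t)"
      by (subst suminf_mult) (auto simp: suminf_geometric summable_geometric)
    finally show ?thesis .
  qed
  have contz: "continuous_on {0..T} (\<lambda>t. z t v)" if v: "v \<in> V" for v T
  proof (rule uniform_limit_theorem)
    show "\<forall>\<^sub>F n in sequentially. continuous_on {0..T} (\<lambda>t. ?P n t v)"
      using picard_continuous[OF v] by auto
    show "uniform_limit {0..T} (\<lambda>n t. ?P n t v) (\<lambda>t. z t v) sequentially"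
    proof (rule uniform_limitI)
      fix e :: real assume "0 < e"
      have "(\<lambda>n. 2 * c * (1/2)^n * exp (K * T)) \<longlonglongrightarrow> 2 * c * 0 * exp (K * T)"
        by (intro tendsto_intros LIMSEQ_realpow_zero) auto
      then have "\<forall>\<^sub>F n in sequentially. 2 * c * (1/2)^n * exp (K * T) < e"
        using \<open>0 < e\<close> order_tendstoD(2) by fastforce
      then show "\<forall>\<^sub>F n in sequentially. \<forall>t\<in>{0..T}. dist (?P n t v) (z t v) < e"
      proof eventually_elim
        case (elim n)
        show ?case
        proof
          fix t assume t: "t \<in> {0..T}"
          have "\<bar>z t v - ?P n t v\<bar> \<le> 2 * c * (1/2)^n * exp (K * t)" using tail v t by auto
          also have "\<dots> \<le> 2 * c * (1/2)^n * exp (K * T)" using t K c by (intro mult_left_mono) auto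
          finally show "dist (?P n t v) (z t v) < e" using elim by (simp add: dist_real_def abs_minus_commute)
        qed
      qed
    qed
  qed simp
  have integral_eq: "z t v = z0 v + integral {0..t} (\<lambda>s. g (z s) v)" if "0 \<le> t" "v \<in> V" for t v
  proof -
    have lim1: "(\<lambda>n. ?P n t v) \<longlonglongrightarrow> z t v" if "v \<in> V" for v
    proof (rule LIM_zero_cancel, rule Lim_null_comparison)
      show "\<forall>\<^sub>F n in sequentially. norm (?P n t v - z t v) \<le> 2 * c * (1/2)^n * exp (K * t)"
        using tail[OF \<open>0 \<le> t\<close> that] by (simp add: abs_minus_commute)
      have "(\<lambda>n. 2 * c * (1/2)^n * exp (K * t)) \<longlonglongrightarrow> 2 * c * 0 * exp (K * t)"
        by (intro tendsto_intros LIMSEQ_realpow_zero) auto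
      then show "(\<lambda>n. 2 * c * (1/2)^n * exp (K * t)) \<longlonglongrightarrow> 0" by simp
    qed
    have "(\<lambda>n. ?P (Suc n) t v) \<longlonglongrightarrow> z0 v + integral {0..t} (\<lambda>s. g (z s) v)"
    proof (rule LIM_zero_cancel, rule Lim_null_comparison)
      have "norm (?P (Suc n) t v - (z0 v + integral {0..t} (\<lambda>s. g (z s) v)))
          \<le> L * card V / K * (2 * c * (1/2)^n) * exp (K * t)" for n
        using integral_field_diff_le[of v t K "2 * c * (1/2)^n" "?P n" z] that K c picard_continuous contz tail
        by (auto simp: abs_minus_commute)
      then show "\<forall>\<^sub>F n in sequentially. norm (?P (Suc n) t v - (z0 v + integral {0..t} (\<lambda>s. g (z s) v)))
          \<le> L * card V / K * (2 * c * (1/2)^n) * exp (K * t)" by simp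
      have "(\<lambda>n. L * card V / K * (2 * c * (1/2)^n) * exp (K * t)) \<longlonglongrightarrow> L * card V / K * (2 * c * 0) * exp (K * t)"
        by (intro tendsto_intros LIMSEQ_realpow_zero) auto
      then show "(\<lambda>n. L * card V / K * (2 * c * (1/2)^n) * exp (K * t)) \<longlonglongrightarrow> 0" by simp
    qed
    then show ?thesis using LIMSEQ_unique LIMSEQ_Suc[OF lim1[OF that(2)]] by blast
  qed
  have "((\<lambda>s. z s v) has_real_derivative g (z t) v) (at t within {0..})" if "0 \<le> t" "v \<in> V" for t v
  proof -
    \<comment> \<open>The interval reaches beyond \<open>t\<close>, so that \<open>t\<close> is not
      its right end and the derivative within it agrees with the one within
      \<open>{0..}\<close>.\<close>
    have "continuous_on {0..t+1} (\<lambda>s. g (z s) v)"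
      by (rule lipschitz_field_continuous[OF contz that(2)])
    then have "((\<lambda>s. integral {0..s} (\<lambda>s. g (z s) v)) has_real_derivative g (z t) v) (at t within {0..t+1})"
      using that by (intro integral_has_real_derivative) auto
    then have "((\<lambda>s. z0 v + integral {0..s} (\<lambda>s. g (z s) v)) has_real_derivative g (z t) v) (at t within {0..t+1})"
      by (auto intro!: derivative_eq_intros)
    then have "((\<lambda>s. z s v) has_real_derivative g (z t) v) (at t within {0..t+1})"
      by (rule has_field_derivative_transform_within[OF _ zero_less_one]) (use that integral_eq in auto)
    moreover have "at t within {0..t+1} = at t within {0..}"
      by (rule at_within_nhd[of _ "{..<t+1}"]) auto
    ultimately show ?thesis by simp
  qed
  moreover have "z 0 v = z0 v" if "v \<in> V" for v using integral_eq[of 0 v] that by simp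
  ultimately show ?thesis unfolding ode_solution_def by (intro exI[of _ z]) auto
qed

text \<open>Gronwall in differential form: the squared distance of two solutions times
  \<open>exp (- A * t)\<close> is nonincreasing and starts at 0. Squares are used because they are
  differentiable; the factor \<open>card V\<close> in \<open>A\<close> comes from the Cauchy-Schwarz
  bound of the squared sum of distances by the sum of their squares.\<close>

lemma ode_solution_unique:
  assumes "ode_solution V g J z0 x" "ode_solution V g J z0 y" and J: "{0..T} \<subseteq> J" "0 \<le> T" and v: "v \<in> V"
  shows "x T v = y T v"
proof -
  have L: "0 \<le> L" using lip_nonneg v by auto
  define A where "A = 2 * L * card V"
  define D where "D t = exp (- A * t) * (\<Sum>w\<in>V. (x t w - y t w)\<^sup>2)" for t
  define D' where "D' t = exp (- A * t) * ((\<Sum>w\<in>V. 2 * (x t w - y t w) * (g (x t) w - g (y t) w))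
      - A * (\<Sum>w\<in>V. (x t w - y t w)\<^sup>2))" for t
  have der: "(D has_real_derivative D' t) (at t within {0..T})" if "t \<in> {0..T}" for t
  proof -
    have "((\<lambda>s. x s w) has_real_derivative g (x t) w) (at t within {0..T})"
      "((\<lambda>s. y s w) has_real_derivative g (y t) w) (at t within {0..T})" if "w \<in> V" for w
      using assms(1,2) that \<open>t \<in> {0..T}\<close> J unfolding ode_solution_def
      by (meson DERIV_subset subsetD)+
    then have "((\<lambda>t. \<Sum>w\<in>V. (x t w - y t w)\<^sup>2) has_real_derivative
        (\<Sum>w\<in>V. 2 * (x t w - y t w) * (g (x t) w - g (y t) w))) (at t within {0..T})"
      by (intro derivative_eq_intros refl DERIV_sum) auto
    moreover have "((\<lambda>t. exp (- A * t)) has_real_derivative - A * exp (- A * t)) (at t within {0..T})"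
      by (auto intro!: derivative_eq_intros)
    ultimately show ?thesis unfolding D_def D'_def
      using DERIV_mult by (fastforce simp: algebra_simps)
  qed
  have le: "D' t \<le> 0" for t
  proof -
    let ?S = "\<Sum>w\<in>V. \<bar>x t w - y t w\<bar>"
    have "(\<Sum>w\<in>V. 2 * (x t w - y t w) * (g (x t) w - g (y t) w)) \<le> (\<Sum>w\<in>V. 2 * \<bar>x t w - y t w\<bar> * (L * ?S))"
    proof (rule sum_mono)
      fix w assume "w \<in> V"
      have "2 * (x t w - y t w) * (g (x t) w - g (y t) w) \<le> \<bar>2 * (x t w - y t w) * (g (x t) w - g (y t) w)\<bar>" by simp
      also have "\<dots> = 2 * \<bar>x t w - y t w\<bar> * \<bar>g (x t) w - g (y t) w\<bar>"
        by (simp only: abs_mult)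
      also have "\<dots> \<le> 2 * \<bar>x t w - y t w\<bar> * (L * ?S)" using lip[OF \<open>w \<in> V\<close>] by (intro mult_left_mono) auto
      finally show "2 * (x t w - y t w) * (g (x t) w - g (y t) w) \<le> 2 * \<bar>x t w - y t w\<bar> * (L * ?S)" .
    qed
    also have "\<dots> = 2 * L * ?S\<^sup>2" by (simp add: sum_distrib_left sum_distrib_right power2_eq_square mult_ac flip: sum_distrib_left)
    also have "\<dots> \<le> 2 * L * (card V * (\<Sum>w\<in>V. \<bar>x t w - y t w\<bar>\<^sup>2))"
      using L sum_squared_le_sum_of_squares[of "\<lambda>w. \<bar>x t w - y t w\<bar>" V] finite_V
      by (intro mult_left_mono) (auto simp: mult_ac)
    finally have "(\<Sum>w\<in>V. 2 * (x t w - y t w) * (g (x t) w - g (y t) w)) \<le> A * (\<Sum>w\<in>V. (x t w - y t w)\<^sup>2)"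
      by (simp add: A_def)
    then show ?thesis unfolding D'_def by (intro mult_nonneg_nonpos) auto
  qed
  have "continuous_on {0..T} D"
    using der by (meson DERIV_continuous continuous_on_eq_continuous_within)
  then have "D T \<le> D 0"
    by (rule DERIV_nonpos_imp_decreasing_open[OF J(2), rotated])
      (metis der le at_within_Icc_at atLeastAtMost_iff less_imp_le)
  also have "D 0 = 0" using assms(1,2) by (simp add: D_def ode_solution_def)
  finally have "(\<Sum>w\<in>V. (x T w - y T w)\<^sup>2) \<le> 0" by (simp add: D_def mult_le_0_iff)
  then have "(\<Sum>w\<in>V. (x T w - y T w)\<^sup>2) = 0" by (intro order_antisym sum_nonneg) auto
  then show ?thesis using v finite_V by (simp add: sum_nonneg_eq_0_iff)
qed

end


section \<open>Invariant boxes that shrink exponentially\<close>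

text \<open>The walls of the box move inwards at relative rate \<open>\<delta>\<close>, while
  \<open>decay\<close> pushes a solution that touches a wall inwards at rate
  \<open>2 * \<delta>\<close>. The surplus makes the derivative of the gap strictly positive, as
  \<open>first_touch\<close> demands. The sign \<open>\<sigma>\<close> selects the upper or the
  lower wall at a vertex.\<close>

lemma ode_solution_barrier:
  assumes "finite V" and sol: "ode_solution V G J z0 z" and J: "{0..s} \<subseteq> J" "0 \<le> s"
    and q: "\<And>v. v \<in> V \<Longrightarrow> 0 < q v" and "0 < M" "0 < \<delta>"
    and init: "\<And>v. v \<in> V \<Longrightarrow> \<bar>z0 v - zbar v\<bar> < M * q v"
    and decay: "\<And>x v m \<sigma>. v \<in> V \<Longrightarrow> 0 < m \<Longrightarrow> m \<le> M \<Longrightarrow> \<sigma> \<in> {1, -1} \<Longrightarrow>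
      (\<forall>w\<in>V. \<bar>x w - zbar w\<bar> \<le> m * q w) \<Longrightarrow> \<sigma> * (x v - zbar v) = m * q v \<Longrightarrow>
      \<sigma> * G x v \<le> - (2 * \<delta> * m * q v)"
    and "v \<in> V"
  shows "\<bar>z s v - zbar v\<bar> < M * exp (- \<delta> * s) * q v"
proof -
  define h where "h = (\<lambda>(v, \<sigma>) t. M * exp (- \<delta> * t) * q v - \<sigma> * (z t v - zbar v))"
  have der: "(h (v, \<sigma>) has_real_derivative - \<delta> * M * exp (- \<delta> * t) * q v - \<sigma> * G (z t) v) (at t within {0..s})"
    if "v \<in> V" "t \<in> {0..s}" for v \<sigma> t
  proof -
    have "((\<lambda>s. z s v) has_real_derivative G (z t) v) (at t within {0..s})"
      using sol that J unfolding ode_solution_def by (meson DERIV_subset subsetD)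
    then show ?thesis unfolding h_def
      by (auto intro!: derivative_eq_intros)
  qed
  have "\<forall>t\<in>{0..s}. \<forall>k\<in>V \<times> {1, -1}. 0 < h k t"
  proof (rule first_touch)
    show "finite (V \<times> {1, -1 :: real})" "0 \<le> s" using assms by auto
    show "continuous_on {0..s} (h k)" if "k \<in> V \<times> {1, -1}" for k
    proof -
      obtain v \<sigma> where "k = (v, \<sigma>)" "v \<in> V" using \<open>k \<in> _\<close> by blast
      then show ?thesis
        using DERIV_continuous[OF der] by (auto simp: continuous_on_eq_continuous_within)
    qed
    show "0 < h k 0" if "k \<in> V \<times> {1, -1}" for k
      using that init sol by (fastforce simp: h_def ode_solution_def abs_less_iff)
    fix k t assume k: "k \<in> V \<times> {1, -1 :: real}" and t: "0 < t" "t \<le> s"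
      and ge: "\<forall>j\<in>V \<times> {1, -1}. 0 \<le> h j t" and 0: "h k t = 0"
    obtain v \<sigma> where v: "k = (v, \<sigma>)" "v \<in> V" "\<sigma> \<in> {1, -1}" using k by blast
    define m where "m = M * exp (- \<delta> * t)"
    have m: "0 < m" "m \<le> M" using \<open>0 < M\<close> \<open>0 < \<delta>\<close> t by (auto simp: m_def)
    have "\<bar>z t w - zbar w\<bar> \<le> m * q w" if "w \<in> V" for w
      using bspec[OF ge, of "(w, 1)"] bspec[OF ge, of "(w, -1)"] that
      by (auto simp: h_def m_def abs_le_iff)
    moreover have "\<sigma> * (z t v - zbar v) = m * q v" using 0 v by (auto simp: h_def m_def)
    ultimately have "\<sigma> * G (z t) v \<le> - (2 * \<delta> * m * q v)" using decay v m by blast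
    moreover have "0 < \<delta> * m * q v" using m q v \<open>0 < \<delta>\<close> by auto
    ultimately have "0 < - \<delta> * M * exp (- \<delta> * t) * q v - \<sigma> * G (z t) v" by (simp add: m_def mult_ac)
    then show "\<exists>d>0. (h k has_real_derivative d) (at t within {0..s})"
      using der[OF v(2), of t \<sigma>] t v(1) by (intro exI[of _ "- \<delta> * M * exp (- \<delta> * t) * q v - \<sigma> * G (z t) v"]) simp
  qed
  then have "0 < h (v, 1) s" "0 < h (v, -1) s" using J assms by auto
  then show ?thesis by (auto simp: h_def abs_less_iff)
qed

text \<open>The field is Lipschitz only on a box, so global theory does not apply to it directly.
  The second conclusion compares every solution on a bounded interval with the one global solution
  \<open>Z\<close>; it yields continuation and uniqueness together.\<close>

lemma cooperative_flow:
  assumes "finite V"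
    and lip: "\<And>x y v. (\<forall>w\<in>V. \<bar>x w\<bar> \<le> B) \<Longrightarrow> (\<forall>w\<in>V. \<bar>y w\<bar> \<le> B) \<Longrightarrow> v \<in> V \<Longrightarrow>
      \<bar>G x v - G y v\<bar> \<le> L * (\<Sum>w\<in>V. \<bar>x w - y w\<bar>)"
    and box: "\<And>v. v \<in> V \<Longrightarrow> \<bar>zbar v\<bar> + M * q v \<le> B"
    and q: "\<And>v. v \<in> V \<Longrightarrow> 0 < q v" and "0 < M" "0 < \<delta>"
    and init: "\<And>v. v \<in> V \<Longrightarrow> \<bar>z0 v - zbar v\<bar> < M * q v"
    and decay: "\<And>x v m \<sigma>. v \<in> V \<Longrightarrow> 0 < m \<Longrightarrow> m \<le> M \<Longrightarrow> \<sigma> \<in> {1, -1} \<Longrightarrow>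
      (\<forall>w\<in>V. \<bar>x w - zbar w\<bar> \<le> m * q w) \<Longrightarrow> \<sigma> * (x v - zbar v) = m * q v \<Longrightarrow>
      \<sigma> * G x v \<le> - (2 * \<delta> * m * q v)"
  shows "\<exists>Z. ode_solution V G {0..} z0 Z \<and>
    (\<forall>T z. ode_solution V G {0..<T} z0 z \<longrightarrow> (\<forall>t\<in>{0..<T}. \<forall>v\<in>V. Z t v = z t v)) \<and>
    (\<forall>z. ode_solution V G {0..} z0 z \<longrightarrow>
      (\<forall>t\<ge>0. \<forall>v\<in>V. \<bar>z t v - zbar v\<bar> \<le> M * exp (- \<delta> * t) * q v))"
proof -
  \<comment> \<open>The clamped field is globally Lipschitz, and its solutions never leave the box.\<close>
  define clamp where "clamp = (\<lambda>x (v::'a). max (- B) (min B (x v :: real)))"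
  have small: "\<bar>x v\<bar> \<le> B" if "v \<in> V" "m \<le> M" "\<bar>x v - zbar v\<bar> \<le> m * q v" for x m v
  proof -
    have "m * q v \<le> M * q v" using that q by (intro mult_right_mono) (auto simp: less_imp_le)
    then show ?thesis using that box[of v] by linarith
  qed
  have field_cong: "G x v = G y v" if "\<forall>w\<in>V. \<bar>x w\<bar> \<le> B" "\<forall>w\<in>V. x w = y w" "v \<in> V" for x y v
    using lip[of x y v] that by auto
  have clamp_id: "G (clamp x) v = G x v" if "\<forall>w\<in>V. \<bar>x w\<bar> \<le> B" "v \<in> V" for x v
    by (rule field_cong[symmetric]) (use that in \<open>auto simp: clamp_def abs_le_iff\<close>)
  have decay': "\<sigma> * G (clamp x) v \<le> - (2 * \<delta> * m * q v)"
    if "v \<in> V" "0 < m" "m \<le> M" "\<sigma> \<in> {1, -1}" "\<forall>w\<in>V. \<bar>x w - zbar w\<bar> \<le> m * q w"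
      "\<sigma> * (x v - zbar v) = m * q v" for x v m \<sigma>
    using decay[OF that] clamp_id[of x v] small that by metis
  have lip': "\<bar>G (clamp x) v - G (clamp y) v\<bar> \<le> \<bar>L\<bar> * (\<Sum>w\<in>V. \<bar>x w - y w\<bar>)" if "v \<in> V" for x y v
  proof -
    have B: "0 \<le> B" using box[OF that] q[OF that] \<open>0 < M\<close> by (smt (verit) mult_pos_pos)
    have "\<bar>G (clamp x) v - G (clamp y) v\<bar> \<le> L * (\<Sum>w\<in>V. \<bar>clamp x w - clamp y w\<bar>)"
      by (rule lip) (use that B in \<open>auto simp: clamp_def\<close>)
    also have "\<dots> \<le> \<bar>L\<bar> * (\<Sum>w\<in>V. \<bar>x w - y w\<bar>)"
      by (intro mult_mono sum_mono sum_nonneg) (auto simp: clamp_def)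
    finally show ?thesis .
  qed
  have real_bound: "\<bar>z t v - zbar v\<bar> < M * exp (- \<delta> * t) * q v"
    if "ode_solution V G J z0 z" "{0..t} \<subseteq> J" "0 \<le> t" "v \<in> V" for z J t v
    using ode_solution_barrier[OF \<open>finite V\<close> that(1-3) q \<open>0 < M\<close> \<open>0 < \<delta>\<close> init decay that(4)] by blast
  have clamp_bound: "\<bar>z t v - zbar v\<bar> < M * exp (- \<delta> * t) * q v"
    if "ode_solution V (\<lambda>x. G (clamp x)) J z0 z" "{0..t} \<subseteq> J" "0 \<le> t" "v \<in> V" for z J t v
    using ode_solution_barrier[OF \<open>finite V\<close> that(1-3) q \<open>0 < M\<close> \<open>0 < \<delta>\<close> init decay' that(4)] by blast
  have shrink: "M * exp (- \<delta> * t) \<le> M" if "0 \<le> t" for t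
    using that \<open>0 < M\<close> \<open>0 < \<delta>\<close> by auto
  \<comment> \<open>The barrier holds for the original field as well. Its solutions therefore stay
    where clamping changes nothing, and uniqueness for the clamped field carries over to
    them.\<close>
  have to_clamp: "ode_solution V (\<lambda>x. G (clamp x)) J z0 z"
    if "ode_solution V G J z0 z" "\<And>t. t \<in> J \<Longrightarrow> 0 \<le> t \<and> {0..t} \<subseteq> J" for z J
  proof -
    have "\<bar>z t w\<bar> \<le> B" if "t \<in> J" "w \<in> V" for t w
      using small[of w "M * exp (- \<delta> * t)" "z t"] shrink[of t] that \<open>\<And>t. t \<in> J \<Longrightarrow> 0 \<le> t \<and> {0..t} \<subseteq> J\<close>
        real_bound[OF \<open>ode_solution V G J z0 z\<close>, of t w] by auto
    then have "G (clamp (z t)) v = G (z t) v" if "t \<in> J" "v \<in> V" for t v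
      using that by (intro clamp_id) auto
    then show ?thesis using that(1) unfolding ode_solution_def by auto
  qed
  obtain Z where Z: "ode_solution V (\<lambda>x. G (clamp x)) {0..} z0 Z"
    using ode_solution_exists[of V "\<lambda>x. G (clamp x)" "\<bar>L\<bar>" z0] \<open>finite V\<close> lip' by blast
  have ZG: "ode_solution V G {0..} z0 Z"
  proof -
    have "\<bar>Z t w\<bar> \<le> B" if "0 \<le> t" "w \<in> V" for t w
      using small[of w "M * exp (- \<delta> * t)" "Z t"] shrink[of t] that clamp_bound[OF Z, of t w] by auto
    then have "G (clamp (Z t)) v = G (Z t) v" if "0 \<le> t" "v \<in> V" for t v
      using that by (intro clamp_id) auto
    then show ?thesis using Z unfolding ode_solution_def by auto
  qed
  show ?thesis
  proof (intro exI[of _ Z] conjI allI impI ballI)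
    show "ode_solution V G {0..} z0 Z" by (rule ZG)
    show "Z t v = z t v" if "ode_solution V G {0..<T} z0 z" "t \<in> {0..<T}" "v \<in> V" for T z t v
    proof -
      have "ode_solution V (\<lambda>x. G (clamp x)) {0..<T} z0 z" by (rule to_clamp[OF that(1)]) auto
      moreover have "ode_solution V (\<lambda>x. G (clamp x)) {0..<T} z0 Z"
        using Z unfolding ode_solution_def by (force intro: DERIV_subset)
      moreover have "{0..t} \<subseteq> {0..<T}" "0 \<le> t" using that by auto
      ultimately show ?thesis
        using ode_solution_unique[of V "\<lambda>x. G (clamp x)" "\<bar>L\<bar>" "{0..<T}" z0 Z z t v] \<open>finite V\<close> lip' that(3)
        by blast
    qed
    show "\<bar>z t v - zbar v\<bar> \<le> M * exp (- \<delta> * t) * q v"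
      if "ode_solution V G {0..} z0 z" "0 \<le> t" "v \<in> V" for z t v
      using real_bound[OF that(1), of t v] that by auto
  qed
qed

subsection \<open>Angles of a face\<close>

text \<open>On a compact rectangle the positive continuous derivative is bounded, and bounded away
  from 0. Stating the result for all large \<open>K\<close> instead of for some \<open>K\<close>
  lets \<open>eventually_conj\<close> give finitely many such estimates a common constant.\<close>

lemma deriv_bilipschitz:
  fixes f f' :: "real \<Rightarrow> real \<Rightarrow> real"
  assumes cont: "continuous_on ({a..b} \<times> {c..d}) (\<lambda>(x, y). f' x y)"
    and der: "\<And>x y. x \<in> {a..b} \<Longrightarrow> y \<in> {c..d} \<Longrightarrow> (f x has_real_derivative f' x y) (at y)"
    and pos: "\<And>x y. x \<in> {a..b} \<Longrightarrow> y \<in> {c..d} \<Longrightarrow> 0 < f' x y"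
  shows "\<forall>\<^sub>F K in at_top. \<forall>x\<in>{a..b}. \<forall>y0\<in>{c..d}. \<forall>y1\<in>{c..d}. y0 \<le> y1 \<longrightarrow>
    (y1 - y0) / K \<le> f x y1 - f x y0 \<and> f x y1 - f x y0 \<le> K * (y1 - y0)"
proof (cases "{a..b} \<times> {c..d} = {}")
  case True
  then show ?thesis by (auto simp: eventually_at_top_linorder)
next
  case False
  have cpt: "compact ({a..b} \<times> {c..d})" by (intro compact_Times compact_Icc)
  obtain P where P: "P \<in> {a..b} \<times> {c..d}" "\<And>x y. x \<in> {a..b} \<Longrightarrow> y \<in> {c..d} \<Longrightarrow> f' x y \<le> case_prod f' P"
    using continuous_attains_sup[OF cpt False cont] by fastforce
  obtain Q where Q: "Q \<in> {a..b} \<times> {c..d}" "\<And>x y. x \<in> {a..b} \<Longrightarrow> y \<in> {c..d} \<Longrightarrow> case_prod f' Q \<le> f' x y"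
    using continuous_attains_inf[OF cpt False cont] by fastforce
  have Q0: "0 < case_prod f' Q" using Q pos by auto
  have "\<forall>\<^sub>F K in at_top. 1 \<le> K \<and> case_prod f' P \<le> K \<and> 1 / case_prod f' Q \<le> K"
    by (intro eventually_conj eventually_ge_at_top)
  then show ?thesis
  proof eventually_elim
    case (elim K)
    have K: "0 < K" "1 / K \<le> case_prod f' Q" using elim Q0 by (auto simp: field_simps)
    show ?case
    proof (intro ballI impI)
      fix x y0 y1 assume xy: "x \<in> {a..b}" "y0 \<in> {c..d}" "y1 \<in> {c..d}" "y0 \<le> y1"
      show "(y1 - y0) / K \<le> f x y1 - f x y0 \<and> f x y1 - f x y0 \<le> K * (y1 - y0)"
      proof (cases "y0 = y1")
        case False
        then obtain t where t: "y0 < t" "t < y1" "f x y1 - f x y0 = (y1 - y0) * f' x t"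
          using MVT2[of y0 y1 "f x" "f' x"] der xy by fastforce
        have "1 / K \<le> f' x t" "f' x t \<le> K" using K elim P(2)[of x t] Q(2)[of x t] xy t by auto
        then have "(y1 - y0) * (1 / K) \<le> (y1 - y0) * f' x t" "(y1 - y0) * f' x t \<le> (y1 - y0) * K"
          using xy(4) by (intro mult_left_mono; simp)+
        then show ?thesis using t by (simp add: mult_ac)
      qed simp
    qed
  qed
qed

lemma deriv_bilipschitz1:
  fixes f f' :: "real \<Rightarrow> real"
  assumes "continuous_on {c..d} f'"
    and "\<And>y. y \<in> {c..d} \<Longrightarrow> (f has_real_derivative f' y) (at y)"
    and "\<And>y. y \<in> {c..d} \<Longrightarrow> 0 < f' y"
  shows "\<forall>\<^sub>F K in at_top. \<forall>y0\<in>{c..d}. \<forall>y1\<in>{c..d}. y0 \<le> y1 \<longrightarrow>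
    (y1 - y0) / K \<le> f y1 - f y0 \<and> f y1 - f y0 \<le> K * (y1 - y0)"
proof -
  have "continuous_on ({0..0::real} \<times> {c..d}) (\<lambda>p. f' (snd p))"
    by (rule continuous_on_compose2[OF assms(1)]) (auto intro: continuous_intros)
  then have "\<forall>\<^sub>F K in at_top. \<forall>x\<in>{0..0::real}. \<forall>y0\<in>{c..d}. \<forall>y1\<in>{c..d}. y0 \<le> y1 \<longrightarrow>
      (y1 - y0) / K \<le> f y1 - f y0 \<and> f y1 - f y0 \<le> K * (y1 - y0)"
    using deriv_bilipschitz[where f = "\<lambda>_. f" and f' = "\<lambda>_. f'" and a = 0 and b = 0] assms(2,3)
    by (simp add: case_prod_unfold)
  then show ?thesis by simp
qed

text \<open>The angle at \<open>i\<close> of a face \<open>{i, j, k}\<close> in either geometry, where \<open>p\<close>, \<open>q\<close>, \<open>s\<close> are the cosines of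
  the weights of \<open>{i, j}\<close>, \<open>{i, k}\<close>, \<open>{j, k}\<close>. The variable \<open>T\<close> depends on the edge \<open>{i, j}\<close> only: it is
  \<open>r\<^sub>i / r\<^sub>j + p\<close> in the Euclidean case and \<open>sinh r\<^sub>i * coth r\<^sub>j + p * cosh r\<^sub>i\<close> in the hyperbolic case;
  \<open>T'\<close> is its analogue for \<open>{i, k}\<close>.\<close>

definition cone_angle :: "real \<Rightarrow> real \<Rightarrow> real \<Rightarrow> real \<Rightarrow> real \<Rightarrow> real" where
  "cone_angle p q s T T' =
     arccos ((T * T' - (s + p * q)) / (sqrt (T\<^sup>2 + (1 - p\<^sup>2)) * sqrt (T'\<^sup>2 + (1 - q\<^sup>2))))"

lemma cone_angle_commute: "cone_angle p q s T T' = cone_angle q p s T' T"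
  by (simp add: cone_angle_def mult_ac)

text \<open>This is the squared denominator of the cosine times the squared sine of the angle, so
  positivity says that the triangle is nondegenerate. It splits into terms that are nonnegative
  because \<open>T\<close> exceeds \<open>p\<close> and \<open>T'\<close> exceeds \<open>q\<close>.
  The strict contribution is \<open>1 - s\<^sup>2\<close> for \<open>s < 1\<close> and the product
  with \<open>s + p * q\<close> for \<open>s = 1\<close>.\<close>

lemma cone_discriminant_pos:
  fixes p q s T T' :: real
  assumes "p \<in> {0..1}" "q \<in> {0..1}" "s \<in> {0..1}" "p < T" "q < T'"
  shows "0 < (T\<^sup>2 + (1 - p\<^sup>2)) * (T'\<^sup>2 + (1 - q\<^sup>2)) - (T * T' - (s + p * q))\<^sup>2"
proof -
  have sq: "p\<^sup>2 \<le> 1" "q\<^sup>2 \<le> 1" "s\<^sup>2 \<le> 1" using assms by (auto simp: power_le_one)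
  have TT: "p\<^sup>2 < T\<^sup>2" "q\<^sup>2 < T'\<^sup>2" using assms by (auto intro: power_strict_mono)
  have pq: "p * q < T * T'" using assms by (auto intro: mult_strict_mono')
  have "0 \<le> (1 - p\<^sup>2) * (T'\<^sup>2 - q\<^sup>2)" "0 \<le> (1 - q\<^sup>2) * (T\<^sup>2 - p\<^sup>2)" using sq TT by auto
  moreover have "0 < (1 - s\<^sup>2) + 2 * (s + p * q) * (T * T' - p * q)"
  proof (cases "s = 1")
    case True
    then have "0 < s + p * q" using assms by (auto intro: add_pos_nonneg)
    then show ?thesis using sq pq by (intro add_nonneg_pos) auto
  next
    case False
    then have "s\<^sup>2 < 1" using assms by (simp add: power_less_one_iff)
    then show ?thesis using assms pq by (intro add_pos_nonneg) auto
  qed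
  moreover have "(T\<^sup>2 + (1 - p\<^sup>2)) * (T'\<^sup>2 + (1 - q\<^sup>2)) - (T * T' - (s + p * q))\<^sup>2 =
      (1 - s\<^sup>2) + 2 * (s + p * q) * (T * T' - p * q) + (1 - p\<^sup>2) * (T'\<^sup>2 - q\<^sup>2) + (1 - q\<^sup>2) * (T\<^sup>2 - p\<^sup>2)"
    by algebra
  ultimately show ?thesis by linarith
qed

text \<open>By the quotient rule the numerator is \<open>T' * U - N * T\<close>, in which the terms
  of third order cancel. What remains has nonnegative coefficients in \<open>T\<close> and
  \<open>T'\<close>; this is the source of the monotonicity of the angles.\<close>

lemma cone_angle_has_derivative:
  fixes p q s T T' :: real
  assumes "p \<in> {0..1}" "q \<in> {0..1}" "s \<in> {0..1}" "p < T" "q < T'"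
  shows "((\<lambda>T. - cone_angle p q s T T') has_real_derivative
    ((1 - p\<^sup>2) * T' + (s + p * q) * T) / ((T\<^sup>2 + (1 - p\<^sup>2)) *
      sqrt ((T\<^sup>2 + (1 - p\<^sup>2)) * (T'\<^sup>2 + (1 - q\<^sup>2)) - (T * T' - (s + p * q))\<^sup>2))) (at T)"
proof -
  define \<mu> \<kappa> where "\<mu> = 1 - p\<^sup>2" and "\<kappa> = s + p * q"
  define W U N D where "W = sqrt (T'\<^sup>2 + (1 - q\<^sup>2))" and "U = T\<^sup>2 + \<mu>" and "N = T * T' - \<kappa>"
    and "D = U * W\<^sup>2 - N\<^sup>2"
  have "p\<^sup>2 \<le> 1" "q\<^sup>2 \<le> 1" "0 < T\<^sup>2" "0 < T'\<^sup>2" using assms by (auto simp: power_le_one)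
  then have U: "0 < U" and W: "0 < W" and W2: "W\<^sup>2 = T'\<^sup>2 + (1 - q\<^sup>2)"
    by (auto simp: U_def W_def \<mu>_def add_pos_nonneg)
  have D: "0 < D" using cone_discriminant_pos[OF assms] by (simp add: D_def U_def W2 N_def \<mu>_def \<kappa>_def)
  define c where "c = N / (sqrt U * W)"
  have c2: "1 - c\<^sup>2 = D / (U * W\<^sup>2)"
    using U W by (simp add: c_def D_def power_divide power_mult_distrib field_simps)
  have "0 < 1 - c\<^sup>2" unfolding c2 using D U W by simp
  then have c1: "-1 < c" "c < 1" by (auto simp: abs_square_less_1 simp flip: abs_less_iff)
  have dc: "((\<lambda>T. (T * T' - \<kappa>) / (sqrt (T\<^sup>2 + \<mu>) * W)) has_real_derivative
      (\<mu> * T' + \<kappa> * T) / (U * sqrt U * W)) (at T)"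
  proof -
    have "((\<lambda>T. (T * T' - \<kappa>) / (sqrt (T\<^sup>2 + \<mu>) * W)) has_real_derivative
      (T' * (sqrt U * W) - N * (T / sqrt U * W)) / (sqrt U * W)\<^sup>2) (at T)"
      using U W by (auto intro!: derivative_eq_intros simp: U_def N_def power2_eq_square field_simps)
    moreover have "(T' * (sqrt U * W) - N * (T / sqrt U * W)) / (sqrt U * W)\<^sup>2 =
        (T' * U - N * T) / (U * sqrt U * W)"
      using U W by (simp add: field_simps power2_eq_square)
    moreover have "T' * U - N * T = \<mu> * T' + \<kappa> * T" by (simp add: U_def N_def power2_eq_square algebra_simps)
    ultimately show ?thesis by simp
  qed
  have "((\<lambda>T. - arccos ((T * T' - \<kappa>) / (sqrt (T\<^sup>2 + \<mu>) * W))) has_real_derivative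
      inverse (sqrt (1 - c\<^sup>2)) * ((\<mu> * T' + \<kappa> * T) / (U * sqrt U * W))) (at T)"
    using DERIV_minus[OF DERIV_chain2[OF DERIV_arccos[OF c1, unfolded c_def N_def U_def] dc]]
    by (simp add: c_def N_def U_def)
  moreover have "inverse (sqrt (1 - c\<^sup>2)) * ((\<mu> * T' + \<kappa> * T) / (U * sqrt U * W)) =
      (\<mu> * T' + \<kappa> * T) / (U * sqrt D)"
    unfolding c2 using U W D by (simp add: real_sqrt_divide real_sqrt_mult field_simps)
  ultimately show ?thesis
    unfolding cone_angle_def \<mu>_def \<kappa>_def by (simp add: W_def[symmetric] D_def U_def \<mu>_def \<kappa>_def N_def W2)
qed

text \<open>For positive \<open>T\<close> and \<open>T'\<close> the numerator of the derivative
  vanishes only if \<open>p = 1\<close> and \<open>s + p * q = 0\<close>, that is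
  \<open>q = s = 0\<close>. In that case the cosine is \<open>T' / sqrt (T'\<^sup>2 + 1)\<close> and
  does not depend on \<open>T\<close>, so \<open>nondeg\<close> cannot be weakened.\<close>

lemma cone_angle_bilipschitz:
  fixes p q s l l' h h' :: real
  assumes pqs: "p \<in> {0..1}" "q \<in> {0..1}" "s \<in> {0..1}" and l: "p < l" "q < l'"
    and nondeg: "p < 1 \<or> 0 < s + p * q"
  shows "\<forall>\<^sub>F K in at_top. \<forall>T'\<in>{l'..h'}. \<forall>T0\<in>{l..h}. \<forall>T1\<in>{l..h}. T0 \<le> T1 \<longrightarrow>
    (T1 - T0) / K \<le> cone_angle p q s T0 T' - cone_angle p q s T1 T' \<and>
    cone_angle p q s T0 T' - cone_angle p q s T1 T' \<le> K * (T1 - T0)"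
proof -
  have sq: "p\<^sup>2 \<le> 1" using pqs by (auto simp: power_le_one)
  have U: "0 < T\<^sup>2 + (1 - p\<^sup>2)" if "T \<in> {l..h}" for T
  proof -
    have "0 < T" using that l pqs by auto
    then show ?thesis using sq by (intro add_pos_nonneg) auto
  qed
  note D = cone_discriminant_pos[OF pqs]
  have "\<forall>\<^sub>F K in at_top. \<forall>T'\<in>{l'..h'}. \<forall>T0\<in>{l..h}. \<forall>T1\<in>{l..h}. T0 \<le> T1 \<longrightarrow>
    (T1 - T0) / K \<le> - cone_angle p q s T1 T' - - cone_angle p q s T0 T' \<and>
    - cone_angle p q s T1 T' - - cone_angle p q s T0 T' \<le> K * (T1 - T0)"
  proof (rule deriv_bilipschitz)
    show "continuous_on ({l'..h'} \<times> {l..h}) (\<lambda>(T', T).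
        ((1 - p\<^sup>2) * T' + (s + p * q) * T) / ((T\<^sup>2 + (1 - p\<^sup>2)) *
      sqrt ((T\<^sup>2 + (1 - p\<^sup>2)) * (T'\<^sup>2 + (1 - q\<^sup>2)) - (T * T' - (s + p * q))\<^sup>2)))"
      unfolding case_prod_unfold
    proof (intro continuous_intros ballI)
      fix x assume x: "x \<in> {l'..h'} \<times> {l..h}"
      show "((snd x)\<^sup>2 + (1 - p\<^sup>2)) * sqrt (((snd x)\<^sup>2 + (1 - p\<^sup>2)) * ((fst x)\<^sup>2 + (1 - q\<^sup>2))
          - (snd x * fst x - (s + p * q))\<^sup>2) \<noteq> 0"
        using U[of "snd x"] D[of "snd x" "fst x"] l x by auto
    qed
    fix T' T assume T: "T' \<in> {l'..h'}" "T \<in> {l..h}"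
    show "((\<lambda>T. - cone_angle p q s T T') has_real_derivative
        ((1 - p\<^sup>2) * T' + (s + p * q) * T) / ((T\<^sup>2 + (1 - p\<^sup>2)) *
      sqrt ((T\<^sup>2 + (1 - p\<^sup>2)) * (T'\<^sup>2 + (1 - q\<^sup>2)) - (T * T' - (s + p * q))\<^sup>2))) (at T)"
      using cone_angle_has_derivative[OF pqs, of T T'] l T by auto
    have TT: "0 < T" "0 < T'" using l T pqs by auto
    have "0 < (1 - p\<^sup>2) * T' + (s + p * q) * T"
    proof (cases "p < 1")
      case True
      then have "p\<^sup>2 < 1" using pqs by (simp add: power_less_one_iff)
      then show ?thesis using pqs TT by (intro add_pos_nonneg) auto
    next
      case False
      then show ?thesis using nondeg sq TT by (intro add_nonneg_pos) auto
    qed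
    then show "0 < ((1 - p\<^sup>2) * T' + (s + p * q) * T) / ((T\<^sup>2 + (1 - p\<^sup>2)) *
      sqrt ((T\<^sup>2 + (1 - p\<^sup>2)) * (T'\<^sup>2 + (1 - q\<^sup>2)) - (T * T' - (s + p * q))\<^sup>2))"
      using U[OF T(2)] D[of T T'] l T by auto
  qed
  then show ?thesis by simp
qed

subsection \<open>Monotonicity of the curvature\<close>

text \<open>For estimates whose constants multiply when they are composed: one \<open>K\<close> is
  fixed for the ingredients, and the result is claimed for all constants beyond
  \<open>f K\<close>.\<close>

lemma eventually_at_topI_mono:
  fixes P Q :: "real \<Rightarrow> bool"
  assumes "eventually P at_top" and "\<And>K K'. P K \<Longrightarrow> 1 \<le> K \<Longrightarrow> f K \<le> K' \<Longrightarrow> 1 \<le> K' \<Longrightarrow> Q K'"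
  shows "eventually Q at_top"
proof -
  obtain K where "P K" "1 \<le> K"
    using eventually_happens'[OF _ eventually_conj[OF assms(1) eventually_ge_at_top[of 1]]] by auto
  then show ?thesis
    using assms(2) by (auto simp: eventually_at_top_linorder intro!: exI[of _ "max 1 (f K)"])
qed

text \<open>The largest possible change of a decreasing function with slopes between
  \<open>- K\<close> and \<open>- 1 / K\<close> when its argument moves by \<open>d\<close>: the
  slow slope counts for increments, the fast one for decrements. Being antitone and positively
  homogeneous in \<open>d\<close>, it serves as a nonlinear substitute for a derivative.\<close>

definition step_bound :: "real \<Rightarrow> real \<Rightarrow> real" where
  "step_bound K d = (if 0 \<le> d then - d / K else - K * d)"

lemma step_bound_antimono:
  assumes "0 < K" "d \<le> d'"
  shows "step_bound K d' \<le> step_bound K d"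
proof (cases "0 \<le> d'")
  case True
  have "K * d \<le> 0" if "d < 0" using assms that by (simp add: mult_nonneg_nonpos)
  moreover have "0 \<le> d' / K" "d / K \<le> d' / K" using True assms by (auto intro: divide_right_mono)
  ultimately show ?thesis using True by (auto simp: step_bound_def)
next
  case False
  then show ?thesis using assms by (auto simp: step_bound_def)
qed

lemma step_bound_mono:
  assumes "0 < K" "K \<le> K'"
  shows "step_bound K d \<le> step_bound K' d"
  using assms by (auto simp: step_bound_def intro!: divide_left_mono mult_right_mono_neg)

lemma step_bound_scale: "0 \<le> m \<Longrightarrow> step_bound K (m * d) = m * step_bound K d"
  by (auto simp: step_bound_def mult_less_0_iff zero_le_mult_iff)

text \<open>\<open>tau p x y\<close> is the variable \<open>T\<close> of an edge \<open>{i, j}\<close> with \<open>x = z\<^sub>i\<close> and \<open>y = z\<^sub>i - z\<^sub>j\<close>; \<open>speed\<close> is the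
  derivative of the coordinate \<open>z\<close> with respect to the flow coordinate \<open>u\<close>.\<close>

locale packing_geometry =
  fixes tau :: "real \<Rightarrow> real \<Rightarrow> real \<Rightarrow> real" and area speed :: "real \<Rightarrow> real"
  assumes tau_gt: "0 \<le> p \<Longrightarrow> p < tau p x y"
    and tau_fst: "0 \<le> p \<Longrightarrow> \<forall>\<^sub>F K in at_top. \<forall>y\<in>{-B..B}. \<forall>x0\<in>{-B..B}. \<forall>x1\<in>{-B..B}. x0 \<le> x1 \<longrightarrow>
      0 \<le> tau p x1 y - tau p x0 y \<and> tau p x1 y - tau p x0 y \<le> K * (x1 - x0)"
    and tau_snd: "0 \<le> p \<Longrightarrow> \<forall>\<^sub>F K in at_top. \<forall>x\<in>{-B..B}. \<forall>y0\<in>{-B..B}. \<forall>y1\<in>{-B..B}. y0 \<le> y1 \<longrightarrow>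
      (y1 - y0) / K \<le> tau p x y1 - tau p x y0 \<and> tau p x y1 - tau p x y0 \<le> K * (y1 - y0)"
    and area_pos: "0 < area x"
    and area_bilipschitz: "\<forall>\<^sub>F K in at_top. \<forall>x0\<in>{-B..B}. \<forall>x1\<in>{-B..B}. x0 \<le> x1 \<longrightarrow>
      (x1 - x0) / K \<le> area x1 - area x0 \<and> area x1 - area x0 \<le> K * (x1 - x0)"
    and speed_ge: "1 \<le> speed x"
    and speed_lipschitz: "\<forall>\<^sub>F K in at_top. \<forall>x0\<in>{-B..B}. \<forall>x1\<in>{-B..B}. x0 \<le> x1 \<longrightarrow>
      \<bar>speed x1 - speed x0\<bar> \<le> K * (x1 - x0)"
begin

lemma tau_range:
  assumes "0 \<le> p" "x \<in> {-B..B}" "y \<in> {-B..B}"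
  shows "tau p x y \<in> {tau p (- B) (- B)..tau p B B}"
proof -
  obtain K :: real where "1 \<le> K"
    and X: "\<forall>y\<in>{-B..B}. \<forall>x0\<in>{-B..B}. \<forall>x1\<in>{-B..B}. x0 \<le> x1 \<longrightarrow>
      0 \<le> tau p x1 y - tau p x0 y \<and> tau p x1 y - tau p x0 y \<le> K * (x1 - x0)"
    and Y: "\<forall>x\<in>{-B..B}. \<forall>y0\<in>{-B..B}. \<forall>y1\<in>{-B..B}. y0 \<le> y1 \<longrightarrow>
      (y1 - y0) / K \<le> tau p x y1 - tau p x y0 \<and> tau p x y1 - tau p x y0 \<le> K * (y1 - y0)"
    using eventually_happens'[OF _ eventually_conj[OF eventually_conj[OF tau_fst tau_snd] eventually_ge_at_top[of 1]], of p p B B]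
      assms(1) by auto
  have "(y - - B) / K \<ge> 0" "(B - y) / K \<ge> 0" using assms \<open>1 \<le> K\<close> by auto
  moreover have "tau p (- B) (- B) \<le> tau p x (- B)" "tau p x B \<le> tau p B B"
    using X[rule_format, of "- B" "- B" x] X[rule_format, of B x B] assms by auto
  moreover have "(y - - B) / K \<le> tau p x y - tau p x (- B)" "(B - y) / K \<le> tau p x B - tau p x y"
    using Y[rule_format, of x "- B" y] Y[rule_format, of x y B] assms by auto
  ultimately show ?thesis by auto
qed

text \<open>The path from \<open>T0\<close> to \<open>T1\<close> goes through \<open>Tm\<close>,
  where \<open>y\<close> has moved and \<open>x\<close> has not. A larger \<open>x\<close> can only
  raise \<open>T\<close> and so lower the angle; thus the one-sided bound involves the change of
  \<open>y\<close> alone. The constants of \<open>tau\<close> and of the angle multiply, hence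
  \<open>K * K\<close>.\<close>

lemma half_angle_step:
  assumes pqs: "p \<in> {0..1}" "q \<in> {0..1}" "s \<in> {0..1}" and nondeg: "p < 1 \<or> 0 < s + p * q"
    and l': "q < l'"
  shows "\<forall>\<^sub>F K in at_top. \<forall>T'\<in>{l'..h'}. \<forall>x0\<in>{-B..B}. \<forall>x1\<in>{-B..B}. \<forall>y0\<in>{-B..B}. \<forall>y1\<in>{-B..B}.
    (x0 \<le> x1 \<longrightarrow> cone_angle p q s (tau p x1 y1) T' - cone_angle p q s (tau p x0 y0) T' \<le> step_bound K (y1 - y0)) \<and>
    \<bar>cone_angle p q s (tau p x1 y1) T' - cone_angle p q s (tau p x0 y0) T'\<bar> \<le> K * (\<bar>x1 - x0\<bar> + \<bar>y1 - y0\<bar>)"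
proof -
  have p: "0 \<le> p" using pqs by auto
  note bil = cone_angle_bilipschitz[OF pqs tau_gt[OF p, of "- B" "- B"] l' nondeg, where h = "tau p B B" and h' = h']
  show ?thesis
  proof (rule eventually_at_topI_mono[OF eventually_conj[OF bil eventually_conj[OF tau_fst[OF p, of B] tau_snd[OF p, of B]]],
        where f = "\<lambda>K. K * K"], elim conjE, intro ballI)
    fix K K' T' x0 x1 y0 y1
    assume C: "\<forall>T'\<in>{l'..h'}. \<forall>T0\<in>{tau p (- B) (- B)..tau p B B}. \<forall>T1\<in>{tau p (- B) (- B)..tau p B B}. T0 \<le> T1 \<longrightarrow>
        (T1 - T0) / K \<le> cone_angle p q s T0 T' - cone_angle p q s T1 T' \<and>
        cone_angle p q s T0 T' - cone_angle p q s T1 T' \<le> K * (T1 - T0)"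
      and X: "\<forall>y\<in>{-B..B}. \<forall>x0\<in>{-B..B}. \<forall>x1\<in>{-B..B}. x0 \<le> x1 \<longrightarrow>
        0 \<le> tau p x1 y - tau p x0 y \<and> tau p x1 y - tau p x0 y \<le> K * (x1 - x0)"
      and Y: "\<forall>x\<in>{-B..B}. \<forall>y0\<in>{-B..B}. \<forall>y1\<in>{-B..B}. y0 \<le> y1 \<longrightarrow>
        (y1 - y0) / K \<le> tau p x y1 - tau p x y0 \<and> tau p x y1 - tau p x y0 \<le> K * (y1 - y0)"
      and K: "1 \<le> K" "K * K \<le> K'" "1 \<le> K'"
      and T': "T' \<in> {l'..h'}" and x: "x0 \<in> {-B..B}" "x1 \<in> {-B..B}" and y: "y0 \<in> {-B..B}" "y1 \<in> {-B..B}"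
    let ?c = "\<lambda>T. cone_angle p q s T T'"
    define T0 T1 Tm where "T0 = tau p x0 y0" and "T1 = tau p x1 y1" and "Tm = tau p x0 y1"
    have range: "T0 \<in> {tau p (- B) (- B)..tau p B B}" "T1 \<in> {tau p (- B) (- B)..tau p B B}"
      unfolding T0_def T1_def using tau_range p x y by auto
    have c_up: "(T1 - T0) / K \<le> ?c T0 - ?c T1 \<and> ?c T0 - ?c T1 \<le> K * (T1 - T0)" if "T0 \<le> T1"
      using C T' range that by blast
    have c_down: "(T0 - T1) / K \<le> ?c T1 - ?c T0 \<and> ?c T1 - ?c T0 \<le> K * (T0 - T1)" if "T1 \<le> T0"
      using C T' range that by blast
    have y_up: "(y1 - y0) / K \<le> Tm - T0 \<and> Tm - T0 \<le> K * (y1 - y0)" if "y0 \<le> y1"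
      using Y x y that unfolding Tm_def T0_def by blast
    have y_down: "(y0 - y1) / K \<le> T0 - Tm \<and> T0 - Tm \<le> K * (y0 - y1)" if "y1 \<le> y0"
      using Y x y that unfolding Tm_def T0_def by blast
    have x_up: "0 \<le> T1 - Tm \<and> T1 - Tm \<le> K * (x1 - x0)" if "x0 \<le> x1"
      using X x y that unfolding Tm_def T1_def by blast
    have x_down: "0 \<le> Tm - T1 \<and> Tm - T1 \<le> K * (x0 - x1)" if "x1 \<le> x0"
      using X x y that unfolding Tm_def T1_def by blast
    have div: "0 \<le> a / K" if "0 \<le> a" for a using that K by auto
    have "?c T1 - ?c T0 \<le> step_bound K' (y1 - y0)" if le: "x0 \<le> x1"
    proof -
      have "?c T1 - ?c T0 \<le> step_bound (K * K) (y1 - y0)"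
      proof (cases "y0 \<le> y1")
        case True
        then have T: "(y1 - y0) / K \<le> T1 - T0" using y_up x_up[OF le] by linarith
        have "(y1 - y0) / K / K \<le> (T1 - T0) / K" using divide_right_mono[OF T, of K] K by simp
        moreover have "T0 \<le> T1" using T div[of "y1 - y0"] True by linarith
        ultimately show ?thesis using c_up True by (simp add: step_bound_def diff_divide_distrib)
      next
        case False
        have nn: "0 \<le> K * K * (y0 - y1)" using False K by (intro mult_nonneg_nonneg) auto
        show ?thesis
        proof (cases "T0 \<le> T1")
          case True
          then show ?thesis using c_up div[of "T1 - T0"] nn False by (simp add: step_bound_def algebra_simps)
        next
          case F: False
          have "T0 - T1 \<le> K * (y0 - y1)" using False y_down x_up[OF le] by linarith
          then have "K * (T0 - T1) \<le> K * (K * (y0 - y1))" using K by (intro mult_left_mono) auto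
          then show ?thesis using c_down F False by (simp add: step_bound_def algebra_simps)
        qed
      qed
      also have "\<dots> \<le> step_bound K' (y1 - y0)" using K by (intro step_bound_mono) auto
      finally show ?thesis .
    qed
    moreover have "\<bar>?c T1 - ?c T0\<bar> \<le> K' * (\<bar>x1 - x0\<bar> + \<bar>y1 - y0\<bar>)"
    proof -
      have "\<bar>?c T1 - ?c T0\<bar> \<le> K * \<bar>T1 - T0\<bar>"
      proof (cases "T0 \<le> T1")
        case True
        then show ?thesis using c_up div[of "T1 - T0"] by auto
      next
        case False
        then show ?thesis using c_down div[of "T0 - T1"] by auto
      qed
      also have "\<bar>T1 - T0\<bar> \<le> K * (\<bar>x1 - x0\<bar> + \<bar>y1 - y0\<bar>)"
      proof -
        have "\<bar>T1 - Tm\<bar> \<le> K * \<bar>x1 - x0\<bar>" using x_up x_down by (cases "x0 \<le> x1") auto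
        moreover have "\<bar>Tm - T0\<bar> \<le> K * \<bar>y1 - y0\<bar>"
          using y_up y_down div[of "y1 - y0"] div[of "y0 - y1"] by (cases "y0 \<le> y1") auto
        ultimately show ?thesis by (simp add: algebra_simps)
      qed
      also have "K * (K * (\<bar>x1 - x0\<bar> + \<bar>y1 - y0\<bar>)) \<le> K' * (\<bar>x1 - x0\<bar> + \<bar>y1 - y0\<bar>)"
        using K by (simp add: mult_right_mono flip: mult.assoc)
      finally show ?thesis using K by (simp add: mult_left_mono)
    qed
    ultimately show "(x0 \<le> x1 \<longrightarrow> cone_angle p q s (tau p x1 y1) T' - cone_angle p q s (tau p x0 y0) T' \<le> step_bound K' (y1 - y0)) \<and>
      \<bar>cone_angle p q s (tau p x1 y1) T' - cone_angle p q s (tau p x0 y0) T'\<bar> \<le> K' * (\<bar>x1 - x0\<bar> + \<bar>y1 - y0\<bar>)"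
      unfolding T0_def T1_def by blast
  qed
qed

text \<open>The two edges at the vertex are changed one after the other. The intermediate angle has
  the new variable on the second edge and the old one on the first, and the symmetry of
  \<open>cone_angle\<close> turns the second change into an instance of the first.\<close>

lemma angle_step:
  assumes pqs: "p \<in> {0..1}" "q \<in> {0..1}" "s \<in> {0..1}"
    and nondeg: "p < 1 \<or> 0 < s + p * q" "q < 1 \<or> 0 < s + p * q"
  shows "\<forall>\<^sub>F K in at_top. \<forall>x0\<in>{-B..B}. \<forall>x1\<in>{-B..B}.
    \<forall>y0\<in>{-B..B}. \<forall>y1\<in>{-B..B}. \<forall>y0'\<in>{-B..B}. \<forall>y1'\<in>{-B..B}.
    (x0 \<le> x1 \<longrightarrow>
      cone_angle p q s (tau p x1 y1) (tau q x1 y1') - cone_angle p q s (tau p x0 y0) (tau q x0 y0')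
        \<le> step_bound K (y1 - y0) + step_bound K (y1' - y0')) \<and>
    \<bar>cone_angle p q s (tau p x1 y1) (tau q x1 y1') - cone_angle p q s (tau p x0 y0) (tau q x0 y0')\<bar>
      \<le> K * (2 * \<bar>x1 - x0\<bar> + \<bar>y1 - y0\<bar> + \<bar>y1' - y0'\<bar>)"
proof -
  have p: "0 \<le> p" and q: "0 \<le> q" using pqs by auto
  have nd: "q < 1 \<or> 0 < s + q * p" using nondeg(2) by (simp add: mult.commute)
  show ?thesis
    using half_angle_step[OF pqs nondeg(1) tau_gt[OF q, of "- B" "- B"], where B = B and h' = "tau q B B"]
      half_angle_step[OF pqs(2,1,3) nd tau_gt[OF p, of "- B" "- B"], where B = B and h' = "tau p B B"]
  proof eventually_elim
    case (elim K)
    show ?case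
    proof (intro ballI)
      fix x0 x1 y0 y1 y0' y1'
      assume x: "x0 \<in> {-B..B}" "x1 \<in> {-B..B}" and y: "y0 \<in> {-B..B}" "y1 \<in> {-B..B}" "y0' \<in> {-B..B}" "y1' \<in> {-B..B}"
      have "tau q x1 y1' \<in> {tau q (- B) (- B)..tau q B B}" "tau p x0 y0 \<in> {tau p (- B) (- B)..tau p B B}"
        using tau_range p q x y by auto
      with elim x y
      have 1: "x0 \<le> x1 \<longrightarrow> cone_angle p q s (tau p x1 y1) (tau q x1 y1') - cone_angle p q s (tau p x0 y0) (tau q x1 y1')
            \<le> step_bound K (y1 - y0)"
        "\<bar>cone_angle p q s (tau p x1 y1) (tau q x1 y1') - cone_angle p q s (tau p x0 y0) (tau q x1 y1')\<bar>
            \<le> K * (\<bar>x1 - x0\<bar> + \<bar>y1 - y0\<bar>)"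
        and 2: "x0 \<le> x1 \<longrightarrow> cone_angle q p s (tau q x1 y1') (tau p x0 y0) - cone_angle q p s (tau q x0 y0') (tau p x0 y0)
            \<le> step_bound K (y1' - y0')"
        "\<bar>cone_angle q p s (tau q x1 y1') (tau p x0 y0) - cone_angle q p s (tau q x0 y0') (tau p x0 y0)\<bar>
            \<le> K * (\<bar>x1 - x0\<bar> + \<bar>y1' - y0'\<bar>)"
        by blast+
      have split: "K * (2 * \<bar>x1 - x0\<bar> + \<bar>y1 - y0\<bar> + \<bar>y1' - y0'\<bar>) =
          K * (\<bar>x1 - x0\<bar> + \<bar>y1 - y0\<bar>) + K * (\<bar>x1 - x0\<bar> + \<bar>y1' - y0'\<bar>)" by (simp add: algebra_simps)
      show "(x0 \<le> x1 \<longrightarrow>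
        cone_angle p q s (tau p x1 y1) (tau q x1 y1') - cone_angle p q s (tau p x0 y0) (tau q x0 y0')
          \<le> step_bound K (y1 - y0) + step_bound K (y1' - y0')) \<and>
        \<bar>cone_angle p q s (tau p x1 y1) (tau q x1 y1') - cone_angle p q s (tau p x0 y0) (tau q x0 y0')\<bar>
          \<le> K * (2 * \<bar>x1 - x0\<bar> + \<bar>y1 - y0\<bar> + \<bar>y1' - y0'\<bar>)"
        unfolding split using 1 2[unfolded cone_angle_commute[of q p]] by linarith
    qed
  qed
qed

end

section \<open>Weights that spread strictness from one vertex over the graph\<close>

text \<open>For constant \<open>q\<close> all sums vanish and the inequality is strict at
  \<open>i0\<close> alone. When \<open>q\<close> grows with the distance from \<open>i0\<close>,
  every other vertex has a neighbour of smaller weight and thus a strictly negative term; the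
  positive terms that appear at \<open>i0\<close> are paid for by \<open>g0\<close>. In this sense
  \<open>q\<close> is a strict supersolution of a nonlinear graph operator.\<close>

lemma boundary_weights:
  fixes V :: "'v set" and F :: "'v set set" and K g0 :: real
  assumes "finite V" and F: "\<And>f. f \<in> F \<Longrightarrow> f \<subseteq> V"
    and conn: "\<And>v. v \<in> V \<Longrightarrow> (i0, v) \<in> {(v, w). \<exists>f\<in>F. v \<in> f \<and> w \<in> f}\<^sup>*"
    and "1 \<le> K" "0 < g0"
  shows "\<exists>(q :: 'v \<Rightarrow> real) \<eta>. 0 < \<eta> \<and> (\<forall>v. 1 \<le> q v \<and> q v \<le> 2) \<and>
    (\<forall>v\<in>V. (\<Sum>f\<in>{f\<in>F. v \<in> f}. \<Sum>w\<in>f - {v}. step_bound K (q v - q w))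
      - (if v = i0 then g0 else 0) \<le> - \<eta>)"
proof -
  define adj where "adj = {(v, w). \<exists>f\<in>F. v \<in> f \<and> w \<in> f}"
  define d where "d v = (LEAST n. (i0, v) \<in> adj ^^ n)" for v
  have "finite F" using \<open>finite V\<close> F by (meson PowI finite_Pow_iff finite_subset subsetI)
  have fin: "finite f" if "f \<in> F" for f using that F \<open>finite V\<close> finite_subset by blast
  have d: "(i0, v) \<in> adj ^^ d v" if "v \<in> V" for v
    unfolding d_def using conn[OF that] LeastI_ex[of "\<lambda>n. (i0, v) \<in> adj ^^ n"]
    by (auto simp: adj_def dest: rtrancl_imp_relpow)
  have pred: "\<exists>w. d w < d v \<and> (\<exists>f\<in>F. v \<in> f \<and> w \<in> f)" if v: "v \<in> V" "v \<noteq> i0" for v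
  proof (cases "d v")
    case 0
    then show ?thesis using d[OF v(1)] v by auto
  next
    case (Suc n)
    then obtain w where w: "(i0, w) \<in> adj ^^ n" "(w, v) \<in> adj" using d[OF v(1)] by auto
    have "d w \<le> n" unfolding d_def using w(1) by (rule Least_le)
    then show ?thesis using w(2) Suc by (auto simp: adj_def intro!: exI[of _ w])
  qed
  define N where "N = real (\<Sum>f\<in>F. card f)"
  define C where "C = K * N"
  have C: "0 \<le> C" unfolding C_def N_def using \<open>1 \<le> K\<close> by (intro mult_nonneg_nonneg) (auto intro: sum_nonneg)
  \<comment> \<open>The bound 1 keeps \<open>q\<close> between 1 and 2. The other bound limits the
    total of the positive terms at \<open>i0\<close>, which is at most \<open>C * \<mu>\<close>, to
    half of \<open>g0\<close>.\<close>
  define \<mu> where "\<mu> = min 1 (g0 / (2 * (C + 1)))"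
  have \<mu>: "0 < \<mu>" "\<mu> \<le> 1" using C \<open>0 < g0\<close> by (auto simp: \<mu>_def)
  have \<mu>C: "\<mu> * C \<le> g0 / 2"
  proof -
    have "\<mu> * (C + 1) \<le> g0 / (2 * (C + 1)) * (C + 1)" using C by (intro mult_right_mono) (auto simp: \<mu>_def)
    also have "\<dots> = g0 / 2"
    proof -
      have "g0 / (2 * k) * k = g0 / 2" if "0 < k" for k :: real using that by simp
      from this[of "C + 1"] show ?thesis using C by linarith
    qed
    finally show ?thesis using \<mu> by (simp add: algebra_simps)
  qed
  \<comment> \<open>For a neighbour \<open>w\<close> closer to \<open>i0\<close> this gives
    \<open>q v - q w \<ge> \<mu> * r ^ d v * (1 + C * K)\<close>. Its \<open>step_bound\<close> is
    at most \<open>- \<mu> * r ^ d v / K - C * \<mu> * r ^ d v\<close>: the second part absorbs all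
    remaining terms at \<open>v\<close>, the first is the surplus.\<close>
  define r where "r = 1 / (2 + C * K)"
  have CK: "0 \<le> C * K" using C \<open>1 \<le> K\<close> by auto
  have r: "0 < r" "r \<le> 1" using CK by (auto simp: r_def)
  \<comment> \<open>The increments of \<open>q\<close> decay so fast with the distance \<open>d\<close> that the contribution of one neighbour
    closer to \<open>i0\<close> outweighs those of all others; at \<open>i0\<close> itself \<open>g0\<close> does, as \<open>\<mu>\<close> is small.\<close>
  define q where "q v = 1 + \<mu> * (1 - r ^ d v)" for v
  have rd: "0 < r ^ n" "r ^ n \<le> 1" for n using r by (auto simp: power_le_one)
  have q1: "1 \<le> q v" "q v \<le> 2" for v
    using \<mu> rd[of "d v"] mult_mono[of \<mu> 1 "1 - r ^ d v" 1] by (auto simp: q_def)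
  have diff: "- (\<mu> * r ^ d v) \<le> q v - q w" for v w
    using \<mu> mult_left_mono[of 0 "r ^ d w" \<mu>] rd[of "d w"] by (auto simp: q_def algebra_simps)
  have single: "step_bound K (q v - q w) \<le> K * (\<mu> * r ^ d v)" for v w
  proof -
    have "step_bound K (q v - q w) \<le> step_bound K (- (\<mu> * r ^ d v))"
      using step_bound_antimono[OF _ diff] \<open>1 \<le> K\<close> by auto
    also have "\<dots> = K * (\<mu> * r ^ d v)"
    proof -
      have "0 < \<mu> * r ^ d v" using \<mu> rd[of "d v"] by simp
      then have "\<not> 0 \<le> - (\<mu> * r ^ d v)" by linarith
      then show ?thesis by (simp add: step_bound_def)
    qed
    finally show ?thesis .
  qed
  \<comment> \<open>Flattening the double sum allows the one favourable pair to be separated from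
    the others, each of which is estimated by \<open>single\<close>.\<close>
  define P where "P v = (SIGMA f:{f\<in>F. v \<in> f}. f - {v})" for v
  have finP: "finite (P v)" for v unfolding P_def using \<open>finite F\<close> fin by auto
  have sumP: "(\<Sum>f\<in>{f\<in>F. v \<in> f}. \<Sum>w\<in>f - {v}. step_bound K (q v - q w)) = (\<Sum>(f, w)\<in>P v. step_bound K (q v - q w))" for v
    unfolding P_def using \<open>finite F\<close> fin by (subst sum.Sigma) auto
  have cardP: "real (card (P v)) \<le> N" for v
  proof -
    have "card (P v) \<le> card (SIGMA f:F. f)"
      using \<open>finite F\<close> fin by (intro card_mono) (auto simp: P_def)
    also have "\<dots> = (\<Sum>f\<in>F. card f)" using \<open>finite F\<close> fin by (intro card_SigmaI) auto
    finally show ?thesis unfolding N_def by linarith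
  qed
  have bound: "(\<Sum>(f, w)\<in>A. step_bound K (q v - q w)) \<le> C * (\<mu> * r ^ d v)" if "A \<subseteq> P v" for A v
  proof -
    have "(\<Sum>(f, w)\<in>A. step_bound K (q v - q w)) \<le> (\<Sum>(f, w)\<in>A. K * (\<mu> * r ^ d v))"
      by (intro sum_mono) (use single in auto)
    also have "\<dots> = real (card A) * (K * (\<mu> * r ^ d v))" by (simp add: case_prod_unfold)
    also have "\<dots> \<le> N * (K * (\<mu> * r ^ d v))"
    proof (rule mult_right_mono)
      show "real (card A) \<le> N" using cardP[of v] card_mono[OF finP that] by linarith
      show "0 \<le> K * (\<mu> * r ^ d v)" using \<mu> rd[of "d v"] \<open>1 \<le> K\<close> by (intro mult_nonneg_nonneg) auto
    qed
    finally show ?thesis by (simp add: C_def mult_ac)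
  qed
  have "\<exists>\<eta>>0. (\<Sum>f\<in>{f\<in>F. v \<in> f}. \<Sum>w\<in>f - {v}. step_bound K (q v - q w)) - (if v = i0 then g0 else 0) \<le> - \<eta>"
    if v: "v \<in> V" for v
  proof (cases "v = i0")
    case True
    have "(\<Sum>(f, w)\<in>P v. step_bound K (q v - q w)) \<le> C * (\<mu> * r ^ d v)" by (rule bound) simp
    also have "\<dots> \<le> C * (\<mu> * 1)" using C \<mu> rd[of "d v"] by (intro mult_left_mono) auto
    also have "\<dots> \<le> g0 / 2" using \<mu>C by (simp add: mult_ac)
    finally show ?thesis unfolding sumP using True \<open>0 < g0\<close> by (intro exI[of _ "g0 / 2"]) auto
  next
    case False
    then obtain w f where w: "d w < d v" "f \<in> F" "v \<in> f" "w \<in> f" using pred[OF v] by blast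
    then have in_P: "(f, w) \<in> P v" by (auto simp: P_def)
    have "r ^ d v \<le> r ^ Suc (d w)" using w(1) r by (intro power_decreasing) auto
    then have "r ^ d v * (1 / r) \<le> r ^ Suc (d w) * (1 / r)" using r by (intro mult_right_mono) auto
    then have "r ^ d v * (2 + C * K) \<le> r ^ d w" using r by (simp add: r_def)
    then have "\<mu> * (r ^ d v * (2 + C * K)) \<le> \<mu> * r ^ d w" using \<mu> by (intro mult_left_mono) auto
    then have qq: "\<mu> * r ^ d v * (1 + C * K) \<le> q v - q w" by (simp add: q_def algebra_simps)
    have pos: "0 < \<mu> * r ^ d v" using \<mu> rd by auto
    have "step_bound K (q v - q w) \<le> step_bound K (\<mu> * r ^ d v * (1 + C * K))"
      using qq \<open>1 \<le> K\<close> by (intro step_bound_antimono) auto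
    also have "\<dots> = - (\<mu> * r ^ d v / K) - C * (\<mu> * r ^ d v)"
    proof -
      have "0 \<le> \<mu> * r ^ d v * (1 + C * K)" by (rule mult_nonneg_nonneg[OF less_imp_le[OF pos]]) (use CK in simp)
      then show ?thesis using \<open>1 \<le> K\<close> by (simp add: step_bound_def field_simps)
    qed
    finally have "step_bound K (q v - q w) \<le> - (\<mu> * r ^ d v / K) - C * (\<mu> * r ^ d v)" .
    moreover have "(\<Sum>(f, w)\<in>P v. step_bound K (q v - q w)) =
        step_bound K (q v - q w) + (\<Sum>(f, w)\<in>P v - {(f, w)}. step_bound K (q v - q w))"
      using sum.remove[OF finP in_P, of "\<lambda>(f, w). step_bound K (q v - q w)"] by simp
    moreover have "(\<Sum>(f, w)\<in>P v - {(f, w)}. step_bound K (q v - q w)) \<le> C * (\<mu> * r ^ d v)"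
      by (rule bound) auto
    ultimately have "(\<Sum>(f, w)\<in>P v. step_bound K (q v - q w)) \<le> - (\<mu> * r ^ d v / K)" by linarith
    then show ?thesis unfolding sumP using False pos \<open>1 \<le> K\<close> by (intro exI[of _ "\<mu> * r ^ d v / K"]) auto
  qed
  then have "\<forall>v\<in>V. \<exists>\<eta>. 0 < \<eta> \<and> (\<Sum>f\<in>{f\<in>F. v \<in> f}. \<Sum>w\<in>f - {v}. step_bound K (q v - q w))
      - (if v = i0 then g0 else 0) \<le> - \<eta>" by blast
  from bchoice[OF this] obtain e where e: "\<forall>v\<in>V. 0 < e v \<and>
      (\<Sum>f\<in>{f\<in>F. v \<in> f}. \<Sum>w\<in>f - {v}. step_bound K (q v - q w)) - (if v = i0 then g0 else 0) \<le> - e v" ..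
  define \<eta> where "\<eta> = Min (insert 1 (e ` V))"
  have "0 < \<eta>" using \<open>finite V\<close> e by (auto simp: \<eta>_def)
  moreover have "\<eta> \<le> e v" if "v \<in> V" for v
    unfolding \<eta>_def using \<open>finite V\<close> that by (intro Min_le) auto
  then have "(\<Sum>f\<in>{f\<in>F. v \<in> f}. \<Sum>w\<in>f - {v}. step_bound K (q v - q w)) - (if v = i0 then g0 else 0) \<le> - \<eta>"
    if "v \<in> V" for v
    using e that by (meson order_trans neg_le_iff_le)
  ultimately show ?thesis using q1 by (intro exI[of _ q] exI[of _ \<eta>]) blast
qed

section \<open>Maximum principle for the curvature defect on a triangulation\<close>

locale packing_flow = packing_geometry tau area speed
  for tau :: "real \<Rightarrow> real \<Rightarrow> real \<Rightarrow> real" and area speed :: "real \<Rightarrow> real" +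
  fixes V :: "'v set" and F :: "'v set set" and c :: "'v set \<Rightarrow> real"
    and angle :: "('v \<Rightarrow> real) \<Rightarrow> 'v \<Rightarrow> 'v set \<Rightarrow> real" and \<kappa> Rbar :: "'v \<Rightarrow> real" and i0 :: 'v
  assumes finite_V: "finite V"
    and face: "\<And>f. f \<in> F \<Longrightarrow> f \<subseteq> V \<and> card f = 3"
    and c_range: "\<And>f e. f \<in> F \<Longrightarrow> e \<subseteq> f \<Longrightarrow> card e = 2 \<Longrightarrow> c e \<in> {0..1}"
    and nondeg: "\<And>i j k. {i, j, k} \<in> F \<Longrightarrow> distinct [i, j, k] \<Longrightarrow> c {i, j} < 1 \<or> 0 < c {j, k} + c {i, j} * c {i, k}"
    and angle_face: "\<And>z i j k. {i, j, k} \<in> F \<Longrightarrow> distinct [i, j, k] \<Longrightarrow>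
      angle z i {i, j, k} = cone_angle (c {i, j}) (c {i, k}) (c {j, k})
        (tau (c {i, j}) (z i) (z i - z j)) (tau (c {i, k}) (z i) (z i - z k))"
    and conn: "\<And>v. v \<in> V \<Longrightarrow> (i0, v) \<in> {(v, w). \<exists>f\<in>F. v \<in> f \<and> w \<in> f}\<^sup>*"
    and Rbar_nonpos: "\<And>v. v \<in> V \<Longrightarrow> Rbar v \<le> 0"
    and i0: "i0 \<in> V" "Rbar i0 < 0"
begin

definition box :: "real \<Rightarrow> ('v \<Rightarrow> real) \<Rightarrow> bool" where
  "box B z \<longleftrightarrow> (\<forall>w\<in>V. \<bar>z w\<bar> \<le> B)"

text \<open>With \<open>\<kappa> v = 2 * pi + 2 * pi * \<beta> v\<close> this is
  \<open>Rbar v\<close> minus the branched curvature, multiplied by the area. Clearing the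
  denominator leaves a sum in which the area term and the angles can be compared separately; the
  zeros are unchanged.\<close>

definition defect :: "('v \<Rightarrow> real) \<Rightarrow> 'v \<Rightarrow> real" where
  "defect z v = Rbar v * area (z v) - \<kappa> v + (\<Sum>f\<in>{f\<in>F. v \<in> f}. angle z v f)"

text \<open>The right side of the flow after the change from \<open>u\<close> to \<open>z\<close>,
  with \<open>speed\<close> as the chain rule factor.\<close>

definition field :: "('v \<Rightarrow> real) \<Rightarrow> 'v \<Rightarrow> real" where
  "field z v = speed (z v) / area (z v) * defect z v"

lemma finite_F: "finite F"
  using finite_V face by (meson PowI finite_Pow_iff finite_subset subsetI)

lemma finite_face: "f \<in> F \<Longrightarrow> finite f"
  using face finite_V finite_subset by blast

lemma face_angle_step:
  assumes f: "f \<in> F" and v: "v \<in> f"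
  shows "\<forall>\<^sub>F K in at_top. \<forall>z0 z1. box B z0 \<longrightarrow> box B z1 \<longrightarrow>
    (z0 v \<le> z1 v \<longrightarrow> angle z1 v f - angle z0 v f
      \<le> (\<Sum>w\<in>f - {v}. step_bound K ((z1 v - z1 w) - (z0 v - z0 w)))) \<and>
    \<bar>angle z1 v f - angle z0 v f\<bar> \<le> K * (\<Sum>w\<in>V. \<bar>z1 w - z0 w\<bar>)"
proof -
  obtain j k where "f - {v} = {j, k}" "j \<noteq> k"
    using face[OF f] v card_2_iff[of "f - {v}"] by auto
  then have jk: "f = {v, j, k}" "f - {v} = {j, k}" "distinct [v, j, k]" using v by auto
  have jV: "v \<in> V" "j \<in> V" "k \<in> V" using face[OF f] jk by auto
  have cs: "c {v, j} \<in> {0..1}" "c {v, k} \<in> {0..1}" "c {j, k} \<in> {0..1}"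
    using c_range[OF f] jk by auto
  have "c {v, j} < 1 \<or> 0 < c {j, k} + c {v, j} * c {v, k}" "c {v, k} < 1 \<or> 0 < c {j, k} + c {v, j} * c {v, k}"
    using nondeg[of v j k] nondeg[of v k j] f jk by (auto simp: insert_commute mult.commute)
  \<comment> \<open>Differences of two entries of a vector in the box of size \<open>B\<close> range
    up to \<open>2 * B\<close>.\<close>
  note step = angle_step[OF cs this, of "2 * B"]
  have ang: "angle z v f = cone_angle (c {v, j}) (c {v, k}) (c {j, k})
      (tau (c {v, j}) (z v) (z v - z j)) (tau (c {v, k}) (z v) (z v - z k))" for z
    using angle_face[of v j k z] f jk by auto
  show ?thesis
  proof (rule eventually_at_topI_mono[OF step, where f = "\<lambda>K. 4 * K"], intro allI impI)
    fix K K' :: real and z0 z1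
    assume st: "\<forall>x0\<in>{- (2 * B)..2 * B}. \<forall>x1\<in>{- (2 * B)..2 * B}.
      \<forall>y0\<in>{- (2 * B)..2 * B}. \<forall>y1\<in>{- (2 * B)..2 * B}. \<forall>y0'\<in>{- (2 * B)..2 * B}. \<forall>y1'\<in>{- (2 * B)..2 * B}.
      (x0 \<le> x1 \<longrightarrow>
        cone_angle (c {v, j}) (c {v, k}) (c {j, k}) (tau (c {v, j}) x1 y1) (tau (c {v, k}) x1 y1')
          - cone_angle (c {v, j}) (c {v, k}) (c {j, k}) (tau (c {v, j}) x0 y0) (tau (c {v, k}) x0 y0')
          \<le> step_bound K (y1 - y0) + step_bound K (y1' - y0')) \<and>
      \<bar>cone_angle (c {v, j}) (c {v, k}) (c {j, k}) (tau (c {v, j}) x1 y1) (tau (c {v, k}) x1 y1')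
          - cone_angle (c {v, j}) (c {v, k}) (c {j, k}) (tau (c {v, j}) x0 y0) (tau (c {v, k}) x0 y0')\<bar>
        \<le> K * (2 * \<bar>x1 - x0\<bar> + \<bar>y1 - y0\<bar> + \<bar>y1' - y0'\<bar>)"
      and K: "1 \<le> K" "4 * K \<le> K'" "1 \<le> K'" and z: "box B z0" "box B z1"
    have zV: "\<bar>z0 w\<bar> \<le> B" "\<bar>z1 w\<bar> \<le> B" if "w \<in> {v, j, k}" for w
      using z jV that by (auto simp: box_def)
    have "z0 v \<in> {- (2 * B)..2 * B}" "z1 v \<in> {- (2 * B)..2 * B}"
      "z0 v - z0 j \<in> {- (2 * B)..2 * B}" "z1 v - z1 j \<in> {- (2 * B)..2 * B}"
      "z0 v - z0 k \<in> {- (2 * B)..2 * B}" "z1 v - z1 k \<in> {- (2 * B)..2 * B}"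
      using zV[of v] zV[of j] zV[of k] by (auto simp: abs_le_iff)
    note st' = st[rule_format, OF this, folded ang]
    have "angle z1 v f - angle z0 v f \<le> (\<Sum>w\<in>f - {v}. step_bound K' ((z1 v - z1 w) - (z0 v - z0 w)))" if "z0 v \<le> z1 v"
    proof -
      have "angle z1 v f - angle z0 v f \<le> (\<Sum>w\<in>f - {v}. step_bound K ((z1 v - z1 w) - (z0 v - z0 w)))"
        using st' that jk by auto
      also have "\<dots> \<le> (\<Sum>w\<in>f - {v}. step_bound K' ((z1 v - z1 w) - (z0 v - z0 w)))"
        using K by (intro sum_mono step_bound_mono) auto
      finally show ?thesis .
    qed
    moreover have "\<bar>angle z1 v f - angle z0 v f\<bar> \<le> K' * (\<Sum>w\<in>V. \<bar>z1 w - z0 w\<bar>)"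
    proof -
      have "(\<Sum>w\<in>f. \<bar>z1 w - z0 w\<bar>) \<le> (\<Sum>w\<in>V. \<bar>z1 w - z0 w\<bar>)"
        using finite_V face[OF f] by (intro sum_mono2) auto
      then have S: "\<bar>z1 v - z0 v\<bar> + \<bar>z1 j - z0 j\<bar> + \<bar>z1 k - z0 k\<bar> \<le> (\<Sum>w\<in>V. \<bar>z1 w - z0 w\<bar>)"
        using jk by auto
      have "\<bar>angle z1 v f - angle z0 v f\<bar> \<le> K * (2 * \<bar>z1 v - z0 v\<bar> + \<bar>(z1 v - z1 j) - (z0 v - z0 j)\<bar> + \<bar>(z1 v - z1 k) - (z0 v - z0 k)\<bar>)"
        using st' by blast
      also have "\<dots> \<le> K * (4 * (\<Sum>w\<in>V. \<bar>z1 w - z0 w\<bar>))"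
      proof (rule mult_left_mono)
        have "\<bar>(z1 v - z1 j) - (z0 v - z0 j)\<bar> \<le> \<bar>z1 v - z0 v\<bar> + \<bar>z1 j - z0 j\<bar>"
          "\<bar>(z1 v - z1 k) - (z0 v - z0 k)\<bar> \<le> \<bar>z1 v - z0 v\<bar> + \<bar>z1 k - z0 k\<bar>" by linarith+
        then show "2 * \<bar>z1 v - z0 v\<bar> + \<bar>(z1 v - z1 j) - (z0 v - z0 j)\<bar> + \<bar>(z1 v - z1 k) - (z0 v - z0 k)\<bar>
            \<le> 4 * (\<Sum>w\<in>V. \<bar>z1 w - z0 w\<bar>)"
          using S abs_ge_zero[of "z1 v - z0 v"] abs_ge_zero[of "z1 j - z0 j"] abs_ge_zero[of "z1 k - z0 k"] by linarith
      qed (use K in auto)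
      also have "\<dots> \<le> K' * (\<Sum>w\<in>V. \<bar>z1 w - z0 w\<bar>)"
        using mult_right_mono[OF K(2), of "\<Sum>w\<in>V. \<bar>z1 w - z0 w\<bar>"] by (simp add: mult_ac sum_nonneg)
      finally show ?thesis .
    qed
    ultimately show "(z0 v \<le> z1 v \<longrightarrow> angle z1 v f - angle z0 v f
      \<le> (\<Sum>w\<in>f - {v}. step_bound K' ((z1 v - z1 w) - (z0 v - z0 w)))) \<and>
      \<bar>angle z1 v f - angle z0 v f\<bar> \<le> K' * (\<Sum>w\<in>V. \<bar>z1 w - z0 w\<bar>)" by blast
  qed
qed

text \<open>One constant per box for all faces, all their vertices and the two scalar functions;
  finiteness of the complex makes it available.\<close>

definition uniform_const :: "real \<Rightarrow> real \<Rightarrow> bool" where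
  "uniform_const B K \<longleftrightarrow> 1 \<le> K \<and>
    (\<forall>f\<in>F. \<forall>v\<in>f. \<forall>z0 z1. box B z0 \<longrightarrow> box B z1 \<longrightarrow>
      (z0 v \<le> z1 v \<longrightarrow> angle z1 v f - angle z0 v f
        \<le> (\<Sum>w\<in>f - {v}. step_bound K ((z1 v - z1 w) - (z0 v - z0 w)))) \<and>
      \<bar>angle z1 v f - angle z0 v f\<bar> \<le> K * (\<Sum>w\<in>V. \<bar>z1 w - z0 w\<bar>)) \<and>
    (\<forall>x0\<in>{-B..B}. \<forall>x1\<in>{-B..B}. x0 \<le> x1 \<longrightarrow>
      (x1 - x0) / K \<le> area x1 - area x0 \<and> area x1 - area x0 \<le> K * (x1 - x0)) \<and>
    (\<forall>x0\<in>{-B..B}. \<forall>x1\<in>{-B..B}. x0 \<le> x1 \<longrightarrow> \<bar>speed x1 - speed x0\<bar> \<le> K * (x1 - x0))"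

lemma uniform_const_exists: "\<exists>K. uniform_const B K"
proof -
  have "\<forall>\<^sub>F K in at_top. uniform_const B K"
    unfolding uniform_const_def
    by (intro eventually_conj eventually_ball_finite ballI finite_F finite_face face_angle_step
        area_bilipschitz speed_lipschitz eventually_ge_at_top)
  then show ?thesis by (rule eventually_happens'[rotated]) simp
qed

lemma uniform_constD:
  assumes "uniform_const B K"
  shows "1 \<le> K"
    and "f \<in> F \<Longrightarrow> v \<in> f \<Longrightarrow> box B z0 \<Longrightarrow> box B z1 \<Longrightarrow> z0 v \<le> z1 v \<Longrightarrow>
      angle z1 v f - angle z0 v f \<le> (\<Sum>w\<in>f - {v}. step_bound K ((z1 v - z1 w) - (z0 v - z0 w)))"
    and "f \<in> F \<Longrightarrow> v \<in> f \<Longrightarrow> box B z0 \<Longrightarrow> box B z1 \<Longrightarrow>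
      \<bar>angle z1 v f - angle z0 v f\<bar> \<le> K * (\<Sum>w\<in>V. \<bar>z1 w - z0 w\<bar>)"
    and "\<bar>x0\<bar> \<le> B \<Longrightarrow> \<bar>x1\<bar> \<le> B \<Longrightarrow> x0 \<le> x1 \<Longrightarrow>
      (x1 - x0) / K \<le> area x1 - area x0 \<and> area x1 - area x0 \<le> K * (x1 - x0)"
    and "\<bar>x0\<bar> \<le> B \<Longrightarrow> \<bar>x1\<bar> \<le> B \<Longrightarrow> \<bar>speed x1 - speed x0\<bar> \<le> K * \<bar>x1 - x0\<bar>"
proof -
  have A: "\<forall>x0\<in>{-B..B}. \<forall>x1\<in>{-B..B}. x0 \<le> x1 \<longrightarrow>
      (x1 - x0) / K \<le> area x1 - area x0 \<and> area x1 - area x0 \<le> K * (x1 - x0)"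
    and S: "\<forall>x0\<in>{-B..B}. \<forall>x1\<in>{-B..B}. x0 \<le> x1 \<longrightarrow> \<bar>speed x1 - speed x0\<bar> \<le> K * (x1 - x0)"
    using assms unfolding uniform_const_def by blast+
  show "1 \<le> K" using assms unfolding uniform_const_def by blast
  show "f \<in> F \<Longrightarrow> v \<in> f \<Longrightarrow> box B z0 \<Longrightarrow> box B z1 \<Longrightarrow> z0 v \<le> z1 v \<Longrightarrow>
      angle z1 v f - angle z0 v f \<le> (\<Sum>w\<in>f - {v}. step_bound K ((z1 v - z1 w) - (z0 v - z0 w)))"
    "f \<in> F \<Longrightarrow> v \<in> f \<Longrightarrow> box B z0 \<Longrightarrow> box B z1 \<Longrightarrow>
      \<bar>angle z1 v f - angle z0 v f\<bar> \<le> K * (\<Sum>w\<in>V. \<bar>z1 w - z0 w\<bar>)"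
    using assms unfolding uniform_const_def by blast+
  assume "\<bar>x0\<bar> \<le> B" "\<bar>x1\<bar> \<le> B"
  then have m: "x0 \<in> {-B..B}" "x1 \<in> {-B..B}" by auto
  show "x0 \<le> x1 \<Longrightarrow> (x1 - x0) / K \<le> area x1 - area x0 \<and> area x1 - area x0 \<le> K * (x1 - x0)"
    using A m by blast
  show "\<bar>speed x1 - speed x0\<bar> \<le> K * \<bar>x1 - x0\<bar>"
    using S[rule_format, OF m] S[rule_format, OF m(2,1)] by (cases "x0 \<le> x1") auto
qed

text \<open>At a vertex \<open>v\<close> where \<open>z1 - z0\<close> attains its bound
  \<open>m * q\<close>, the entry at \<open>v\<close> rises by at least \<open>m\<close>, and the
  difference to a neighbour \<open>w\<close> rises by at least \<open>m * (q v - q w)\<close>. Since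
  \<open>step_bound\<close> is antitone and homogeneous, the change of the defect is at most
  \<open>m\<close> times the quantity controlled by \<open>boundary_weights\<close>. The same
  \<open>q\<close> serves all pairs of points in the box.\<close>

lemma defect_decay:
  "\<exists>(q :: 'v \<Rightarrow> real) \<eta>. 0 < \<eta> \<and> (\<forall>v. 1 \<le> q v \<and> q v \<le> 2) \<and>
    (\<forall>z0 z1 m v. box B z0 \<longrightarrow> box B z1 \<longrightarrow> 0 \<le> m \<longrightarrow> v \<in> V \<longrightarrow> z1 v - z0 v = m * q v \<longrightarrow>
      (\<forall>w\<in>V. z1 w - z0 w \<le> m * q w) \<longrightarrow> defect z1 v - defect z0 v \<le> - (\<eta> * m))"
proof -
  obtain K where "uniform_const B K" using uniform_const_exists by blast
  note K = uniform_constD(1)[OF this] and step = uniform_constD(2)[OF this] and ar = uniform_constD(4)[OF this]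
  \<comment> \<open>The gain at \<open>i0\<close>: the area grows there with slope at least
    \<open>1 / K\<close> and is multiplied by the negative \<open>Rbar i0\<close>.\<close>
  have "0 < - Rbar i0 / K" using i0 K by (simp add: divide_neg_pos)
  then obtain q \<eta> where \<eta>: "0 < \<eta>" and q: "\<forall>v. 1 \<le> q v \<and> q v \<le> 2"
    and sum: "\<forall>v\<in>V. (\<Sum>f\<in>{f\<in>F. v \<in> f}. \<Sum>w\<in>f - {v}. step_bound K (q v - q w))
      - (if v = i0 then - Rbar i0 / K else 0) \<le> - \<eta>"
    using boundary_weights[OF finite_V _ conn K, of "- Rbar i0 / K"] face by blast
  show ?thesis
  proof (rule exI[of _ q], rule exI[of _ \<eta>], intro conjI \<eta> q allI impI)
    fix z0 z1 m v
    assume z: "box B z0" "box B z1" and m: "0 \<le> m" and v: "v \<in> V" and eq: "z1 v - z0 v = m * q v"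
      and le: "\<forall>w\<in>V. z1 w - z0 w \<le> m * q w"
    have "m * 1 \<le> m * q v" using m q by (intro mult_left_mono) auto
    then have mq: "m \<le> z1 v - z0 v" "z0 v \<le> z1 v" using m eq by auto
    have bz: "\<bar>z0 v\<bar> \<le> B" "\<bar>z1 v\<bar> \<le> B" using z v by (auto simp: box_def)
    have "Rbar v * (area (z1 v) - area (z0 v)) \<le> - m * (if v = i0 then - Rbar i0 / K else 0)"
    proof -
      have "m / K \<le> (z1 v - z0 v) / K" using mq K by (intro divide_right_mono) auto
      then have "m / K \<le> area (z1 v) - area (z0 v)" using ar[OF bz mq(2)] by linarith
      then have "Rbar v * (area (z1 v) - area (z0 v)) \<le> Rbar v * (m / K)"
        using Rbar_nonpos[OF v] by (intro mult_left_mono_neg)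
      moreover have "Rbar v * (m / K) \<le> 0" using Rbar_nonpos[OF v] m K by (intro mult_nonpos_nonneg) auto
      ultimately show ?thesis by (auto simp: mult.commute)
    qed
    moreover have "(\<Sum>f\<in>{f\<in>F. v \<in> f}. angle z1 v f - angle z0 v f) \<le>
        (\<Sum>f\<in>{f\<in>F. v \<in> f}. m * (\<Sum>w\<in>f - {v}. step_bound K (q v - q w)))"
    proof (rule sum_mono)
      fix f assume f: "f \<in> {f\<in>F. v \<in> f}"
      have "angle z1 v f - angle z0 v f \<le> (\<Sum>w\<in>f - {v}. step_bound K ((z1 v - z1 w) - (z0 v - z0 w)))"
        using step f z mq by auto
      also have "\<dots> \<le> (\<Sum>w\<in>f - {v}. step_bound K (m * (q v - q w)))"
      proof (intro sum_mono step_bound_antimono)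
        fix w assume "w \<in> f - {v}"
        then have "z1 w - z0 w \<le> m * q w" using le face f by blast
        then show "m * (q v - q w) \<le> (z1 v - z1 w) - (z0 v - z0 w)" using eq by (simp add: algebra_simps)
      qed (use K in auto)
      also have "\<dots> = m * (\<Sum>w\<in>f - {v}. step_bound K (q v - q w))"
        by (simp add: step_bound_scale[OF m] sum_distrib_left)
      finally show "angle z1 v f - angle z0 v f \<le> m * (\<Sum>w\<in>f - {v}. step_bound K (q v - q w))" .
    qed
    ultimately have "defect z1 v - defect z0 v \<le> m * ((\<Sum>f\<in>{f\<in>F. v \<in> f}. \<Sum>w\<in>f - {v}. step_bound K (q v - q w))
        - (if v = i0 then - Rbar i0 / K else 0))"
      by (simp add: defect_def sum_subtractf sum_distrib_left algebra_simps)
    also have "\<dots> \<le> m * - \<eta>" using sum v m by (intro mult_left_mono) auto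
    finally show "defect z1 v - defect z0 v \<le> - (\<eta> * m)" by (simp add: mult.commute)
  qed
qed

text \<open>Products and quotients of bounded Lipschitz functions: on the box \<open>a\<close>
  bounds the area from below, while \<open>S\<close> and \<open>H\<close> bound speed and defect.
  The bound \<open>H\<close> compares with the zero vector, which lies in the box since
  \<open>0 \<le> B\<close>.\<close>

lemma field_lipschitz:
  assumes "0 \<le> B"
  shows "\<exists>L. \<forall>z0 z1. \<forall>v\<in>V. box B z0 \<longrightarrow> box B z1 \<longrightarrow>
    \<bar>field z1 v - field z0 v\<bar> \<le> L * (\<Sum>w\<in>V. \<bar>z1 w - z0 w\<bar>)"
proof -
  obtain K where "uniform_const B K" using uniform_const_exists by blast
  note K = uniform_constD(1)[OF this] and ang = uniform_constD(3)[OF this] and ar = uniform_constD(4)[OF this] and sp = uniform_constD(5)[OF this]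
  have div: "0 \<le> a / K" if "0 \<le> a" for a using that K by auto
  have ar_abs: "\<bar>area x1 - area x0\<bar> \<le> K * \<bar>x1 - x0\<bar>" if "\<bar>x0\<bar> \<le> B" "\<bar>x1\<bar> \<le> B" for x0 x1
    using ar[OF that] ar[OF that(2,1)] div[of "x1 - x0"] div[of "x0 - x1"] by (cases "x0 \<le> x1") auto
  define a where "a = area (- B)"
  have a: "0 < a" unfolding a_def by (rule area_pos)
  have ar_ge: "a \<le> area x" if "\<bar>x\<bar> \<le> B" for x
    using ar[of "- B" x] that div[of "x - - B"] unfolding a_def by (auto simp: abs_le_iff)
  define S where "S = \<bar>speed 0\<bar> + K * B"
  have S: "0 \<le> S" using K assms by (simp add: S_def)
  have sp_le: "\<bar>speed x\<bar> \<le> S" if "\<bar>x\<bar> \<le> B" for x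
  proof -
    have "K * \<bar>x\<bar> \<le> K * B" using K that by (intro mult_left_mono) auto
    then show ?thesis using sp[of 0 x] that assms unfolding S_def by auto
  qed
  define N where "N = K / a + S * K / (a * a)"
  have ratio: "\<bar>speed x1 / area x1 - speed x0 / area x0\<bar> \<le> N * \<bar>x1 - x0\<bar>" if x: "\<bar>x0\<bar> \<le> B" "\<bar>x1\<bar> \<le> B" for x0 x1
  proof -
    have split: "speed x1 / area x1 - speed x0 / area x0 =
        (speed x1 - speed x0) / area x1 + speed x0 * (area x0 - area x1) / (area x0 * area x1)"
      using area_pos[of x0] area_pos[of x1] by (simp add: field_simps)
    have "\<bar>speed x1 / area x1 - speed x0 / area x0\<bar> \<le> \<bar>(speed x1 - speed x0) / area x1\<bar> + \<bar>speed x0 * (area x0 - area x1) / (area x0 * area x1)\<bar>"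
      unfolding split by (rule abs_triangle_ineq)
    moreover have "\<bar>(speed x1 - speed x0) / area x1\<bar> \<le> K * \<bar>x1 - x0\<bar> / a"
      using sp[OF x] ar_ge[OF x(2)] a K by (simp add: abs_divide frac_le)
    moreover have "\<bar>speed x0 * (area x0 - area x1) / (area x0 * area x1)\<bar> \<le> S * (K * \<bar>x1 - x0\<bar>) / (a * a)"
    proof -
      have "\<bar>speed x0 * (area x0 - area x1)\<bar> \<le> S * (K * \<bar>x1 - x0\<bar>)"
        unfolding abs_mult using sp_le[OF x(1)] ar_abs[OF x] S by (intro mult_mono) (auto simp: abs_minus_commute)
      moreover have "a * a \<le> area x0 * area x1" using ar_ge[OF x(1)] ar_ge[OF x(2)] a by (intro mult_mono) auto
      ultimately show ?thesis using a area_pos[of x0] area_pos[of x1] S K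
        by (simp only: abs_divide) (intro frac_le; simp add: abs_mult)
    qed
    moreover have "N * \<bar>x1 - x0\<bar> = K * \<bar>x1 - x0\<bar> / a + S * (K * \<bar>x1 - x0\<bar>) / (a * a)"
      by (simp add: N_def distrib_right)
    ultimately show ?thesis by linarith
  qed
  have N: "0 \<le> N" using K a S by (auto simp: N_def intro!: add_nonneg_nonneg)
  define R where "R = (\<Sum>v\<in>V. \<bar>Rbar v\<bar>)"
  have R: "\<bar>Rbar v\<bar> \<le> R" if "v \<in> V" for v unfolding R_def using finite_V that by (intro member_le_sum) auto
  have R0: "0 \<le> R" unfolding R_def by (intro sum_nonneg) auto
  define L where "L = R * K + card F * K"
  have L: "0 \<le> L" using R0 K by (auto simp: L_def)
  have def_lip: "\<bar>defect z1 v - defect z0 v\<bar> \<le> L * (\<Sum>w\<in>V. \<bar>z1 w - z0 w\<bar>)"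
    if z: "box B z0" "box B z1" and v: "v \<in> V" for z0 z1 v
  proof -
    let ?D = "\<Sum>w\<in>V. \<bar>z1 w - z0 w\<bar>"
    have D: "\<bar>z1 v - z0 v\<bar> \<le> ?D" using finite_V v by (intro member_le_sum) auto
    have split: "defect z1 v - defect z0 v = Rbar v * (area (z1 v) - area (z0 v))
        + (\<Sum>f\<in>{f\<in>F. v \<in> f}. angle z1 v f - angle z0 v f)"
      by (simp add: defect_def sum_subtractf algebra_simps)
    have "\<bar>defect z1 v - defect z0 v\<bar> \<le> \<bar>Rbar v * (area (z1 v) - area (z0 v))\<bar>
        + \<bar>\<Sum>f\<in>{f\<in>F. v \<in> f}. angle z1 v f - angle z0 v f\<bar>"
      unfolding split by (rule abs_triangle_ineq)
    moreover have "\<bar>Rbar v * (area (z1 v) - area (z0 v))\<bar> \<le> R * (K * ?D)"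
    proof -
      have "\<bar>area (z1 v) - area (z0 v)\<bar> \<le> K * \<bar>z1 v - z0 v\<bar>" using ar_abs z v by (auto simp: box_def)
      also have "\<dots> \<le> K * ?D" using D K by (intro mult_left_mono) auto
      finally show ?thesis unfolding abs_mult using R[OF v] R0 by (intro mult_mono) auto
    qed
    moreover have "\<bar>\<Sum>f\<in>{f\<in>F. v \<in> f}. angle z1 v f - angle z0 v f\<bar> \<le> card F * (K * ?D)"
    proof -
      have "\<bar>\<Sum>f\<in>{f\<in>F. v \<in> f}. angle z1 v f - angle z0 v f\<bar> \<le> (\<Sum>f\<in>{f\<in>F. v \<in> f}. \<bar>angle z1 v f - angle z0 v f\<bar>)"
        by (rule sum_abs)
      also have "\<dots> \<le> (\<Sum>f\<in>{f\<in>F. v \<in> f}. K * ?D)" by (intro sum_mono ang z) auto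
      also have "\<dots> \<le> (\<Sum>f\<in>F. K * ?D)"
        using K finite_F by (intro sum_mono2) (auto intro!: mult_nonneg_nonneg sum_nonneg)
      finally show ?thesis by simp
    qed
    moreover have "L * ?D = R * (K * ?D) + card F * (K * ?D)" by (simp add: L_def distrib_right)
    ultimately show ?thesis by linarith
  qed
  define H where "H = (\<Sum>v\<in>V. \<bar>defect (\<lambda>_. 0) v\<bar>) + L * (card V * B)"
  have H0: "0 \<le> H" unfolding H_def using L assms by (intro add_nonneg_nonneg sum_nonneg mult_nonneg_nonneg) auto
  have def_le: "\<bar>defect z v\<bar> \<le> H" if z: "box B z" and v: "v \<in> V" for z v
  proof -
    have "\<bar>defect z v - defect (\<lambda>_. 0) v\<bar> \<le> L * (\<Sum>w\<in>V. \<bar>z w - 0\<bar>)"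
      using z v assms by (intro def_lip) (auto simp: box_def)
    also have "\<dots> \<le> L * (\<Sum>w\<in>V. B)" using L z by (intro mult_left_mono sum_mono) (auto simp: box_def)
    finally have "\<bar>defect z v - defect (\<lambda>_. 0) v\<bar> \<le> L * (card V * B)" by simp
    moreover have "\<bar>defect (\<lambda>_. 0) v\<bar> \<le> (\<Sum>v\<in>V. \<bar>defect (\<lambda>_. 0) v\<bar>)"
      using finite_V v by (intro member_le_sum) auto
    ultimately show ?thesis unfolding H_def by linarith
  qed
  show ?thesis
  proof (rule exI[of _ "N * H + S / a * L"], intro allI ballI impI)
    fix z0 z1 v assume z: "box B z0" "box B z1" and v: "v \<in> V"
    let ?D = "\<Sum>w\<in>V. \<bar>z1 w - z0 w\<bar>"
    have bz: "\<bar>z0 v\<bar> \<le> B" "\<bar>z1 v\<bar> \<le> B" using z v by (auto simp: box_def)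
    have D: "\<bar>z1 v - z0 v\<bar> \<le> ?D" using finite_V v by (intro member_le_sum) auto
    have split: "field z1 v - field z0 v = (speed (z1 v) / area (z1 v) - speed (z0 v) / area (z0 v)) * defect z1 v
        + speed (z0 v) / area (z0 v) * (defect z1 v - defect z0 v)"
      unfolding field_def left_diff_distrib right_diff_distrib by simp
    have "\<bar>field z1 v - field z0 v\<bar> \<le> \<bar>(speed (z1 v) / area (z1 v) - speed (z0 v) / area (z0 v)) * defect z1 v\<bar>
        + \<bar>speed (z0 v) / area (z0 v) * (defect z1 v - defect z0 v)\<bar>"
      unfolding split by (rule abs_triangle_ineq)
    moreover have "\<bar>(speed (z1 v) / area (z1 v) - speed (z0 v) / area (z0 v)) * defect z1 v\<bar> \<le> (N * ?D) * H"
    proof -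
      have "\<bar>speed (z1 v) / area (z1 v) - speed (z0 v) / area (z0 v)\<bar> \<le> N * \<bar>z1 v - z0 v\<bar>" by (rule ratio[OF bz])
      also have "\<dots> \<le> N * ?D" using D N by (intro mult_left_mono) auto
      finally show ?thesis unfolding abs_mult using def_le[OF z(2) v] by (intro mult_mono) auto
    qed
    moreover have "\<bar>speed (z0 v) / area (z0 v) * (defect z1 v - defect z0 v)\<bar> \<le> S / a * (L * ?D)"
    proof -
      have "\<bar>speed (z0 v) / area (z0 v)\<bar> \<le> S / a"
        using sp_le[OF bz(1)] ar_ge[OF bz(1)] a S by (simp add: abs_divide frac_le)
      then show ?thesis unfolding abs_mult using def_lip[OF z v] S a by (intro mult_mono) auto
    qed
    moreover have "(N * H + S / a * L) * ?D = (N * ?D) * H + S / a * (L * ?D)"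
      by (simp add: distrib_right)
    ultimately show "\<bar>field z1 v - field z0 v\<bar> \<le> (N * H + S / a * L) * ?D" by linarith
  qed
qed

theorem flow_to_equilibrium:
  assumes eq: "\<And>v. v \<in> V \<Longrightarrow> defect zbar v = 0"
  shows "\<exists>Z M \<delta>. 0 < \<delta> \<and> ode_solution V field {0..} z0 Z \<and>
    (\<forall>T z. ode_solution V field {0..<T} z0 z \<longrightarrow> (\<forall>t\<in>{0..<T}. \<forall>v\<in>V. Z t v = z t v)) \<and>
    (\<forall>z. ode_solution V field {0..} z0 z \<longrightarrow> (\<forall>t\<ge>0. \<forall>v\<in>V. \<bar>z t v - zbar v\<bar> \<le> M * exp (- \<delta> * t)))"
proof -
  define M where "M = 1 + (\<Sum>v\<in>V. \<bar>z0 v - zbar v\<bar>)"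
  have M: "0 < M" unfolding M_def by (intro add_pos_nonneg sum_nonneg) auto
  \<comment> \<open>Large enough to contain every point within \<open>M * q\<close> of
    \<open>zbar\<close>, as \<open>q\<close> is at most 2.\<close>
  define B where "B = M * 2 + (\<Sum>v\<in>V. \<bar>zbar v\<bar>)"
  have zbar_le: "\<bar>zbar v\<bar> + M * 2 \<le> B" if "v \<in> V" for v
    unfolding B_def using finite_V that member_le_sum[of v V "\<lambda>v. \<bar>zbar v\<bar>"] by auto
  have B: "0 \<le> B" using zbar_le[OF i0(1)] M by linarith
  obtain q :: "'v \<Rightarrow> real" and \<eta> where \<eta>: "0 < \<eta>" and q12: "\<forall>v. 1 \<le> q v \<and> q v \<le> 2"
    and dec: "\<forall>z0 z1 m v. box B z0 \<longrightarrow> box B z1 \<longrightarrow> 0 \<le> m \<longrightarrow> v \<in> V \<longrightarrow> z1 v - z0 v = m * q v \<longrightarrow>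
      (\<forall>w\<in>V. z1 w - z0 w \<le> m * q w) \<longrightarrow> defect z1 v - defect z0 v \<le> - (\<eta> * m)"
    using defect_decay[of B] by blast
  have q: "1 \<le> q v" "q v \<le> 2" for v using q12 by auto
  obtain L where lip: "\<forall>z0 z1. \<forall>v\<in>V. box B z0 \<longrightarrow> box B z1 \<longrightarrow>
      \<bar>field z1 v - field z0 v\<bar> \<le> L * (\<Sum>w\<in>V. \<bar>z1 w - z0 w\<bar>)"
    using field_lipschitz[OF B] by blast
  obtain K where "uniform_const B K" using uniform_const_exists by blast
  note K = uniform_constD(1)[OF this] and ar = uniform_constD(4)[OF this]
  have ratio: "1 / area B \<le> speed x / area x" if "\<bar>x\<bar> \<le> B" for x
  proof -
    have "0 \<le> (B - x) / K" using that K by auto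
    moreover have "x \<le> B" "\<bar>B\<bar> \<le> B" using that by auto
    ultimately have "area x \<le> area B" using ar[OF that, of B] by linarith
    then show ?thesis using speed_ge[of x] area_pos[of x] by (intro frac_le) auto
  qed
  \<comment> \<open>On the box \<open>speed / area\<close> is at least \<open>1 / area B\<close>, so
    the field pushes inwards by at least \<open>\<eta> * m / area B = 4 * \<delta> * m\<close>. As
    \<open>q \<le> 2\<close>, this is at least \<open>2 * \<delta> * m * q v\<close>.\<close>
  define \<delta> where "\<delta> = \<eta> / (4 * area B)"
  have \<delta>: "0 < \<delta>" using \<eta> area_pos[of B] by (simp add: \<delta>_def)
  have zbar_box: "box B zbar" using zbar_le M by (force simp: box_def)
  have mq: "m * q w \<le> M * 2" "0 \<le> m * q w" if "0 < m" "m \<le> M" for m w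
    using mult_mono[of m M "q w" 2] q[of w] that M by auto
  have decay: "\<sigma> * field x v \<le> - (2 * \<delta> * m * q v)"
    if v: "v \<in> V" and m: "0 < m" "m \<le> M" and \<sigma>: "\<sigma> \<in> {1, -1}"
      and le: "\<forall>w\<in>V. \<bar>x w - zbar w\<bar> \<le> m * q w" and at: "\<sigma> * (x v - zbar v) = m * q v" for x v m \<sigma>
  proof -
    have x_box: "box B x"
      unfolding box_def
    proof
      fix w assume w: "w \<in> V"
      then have "\<bar>x w - zbar w\<bar> \<le> M * 2" using le mq[OF m, of w] by force
      then show "\<bar>x w\<bar> \<le> B" using zbar_le[OF w] by linarith
    qed
    \<comment> \<open>At the lower wall the roles of \<open>x\<close> and \<open>zbar\<close> are
      exchanged in \<open>dec\<close>.\<close>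
    have "\<sigma> * defect x v \<le> - (\<eta> * m)"
    proof (cases "\<sigma> = 1")
      case True
      have "defect x v - defect zbar v \<le> - (\<eta> * m)"
        by (rule dec[rule_format, OF zbar_box x_box _ v]) (use m at True le in \<open>auto simp: abs_le_iff\<close>)
      then show ?thesis using eq[OF v] True by simp
    next
      case False
      then have "\<sigma> = -1" using \<sigma> by simp
      have "defect zbar v - defect x v \<le> - (\<eta> * m)"
        by (rule dec[rule_format, OF x_box zbar_box _ v]) (use m at \<open>\<sigma> = -1\<close> le in \<open>auto simp: abs_le_iff\<close>)
      then show ?thesis using eq[OF v] \<open>\<sigma> = -1\<close> by simp
    qed
    then have "\<sigma> * field x v \<le> speed (x v) / area (x v) * - (\<eta> * m)"
      using speed_ge[of "x v"] area_pos[of "x v"]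
        mult_left_mono[of "\<sigma> * defect x v" "- (\<eta> * m)" "speed (x v) / area (x v)"]
      by (simp add: field_def mult_ac)
    also have "\<dots> \<le> 1 / area B * - (\<eta> * m)"
      using ratio[of "x v"] x_box v \<eta> m by (intro mult_right_mono_neg) (auto simp: box_def)
    also have "\<dots> = - (2 * \<delta> * m * 2)" using area_pos[of B] by (simp add: \<delta>_def field_simps)
    also have "\<dots> \<le> - (2 * \<delta> * m * q v)" using q(2)[of v] \<delta> m by simp
    finally show ?thesis .
  qed
  have init: "\<bar>z0 v - zbar v\<bar> < M * q v" if "v \<in> V" for v
  proof -
    have "\<bar>z0 v - zbar v\<bar> < M" unfolding M_def
      using finite_V that member_le_sum[of v V "\<lambda>v. \<bar>z0 v - zbar v\<bar>"] by auto
    also have "M \<le> M * q v" using M q(1)[of v] by simp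
    finally show ?thesis .
  qed
  have "\<exists>Z. ode_solution V field {0..} z0 Z \<and>
    (\<forall>T z. ode_solution V field {0..<T} z0 z \<longrightarrow> (\<forall>t\<in>{0..<T}. \<forall>v\<in>V. Z t v = z t v)) \<and>
    (\<forall>z. ode_solution V field {0..} z0 z \<longrightarrow>
      (\<forall>t\<ge>0. \<forall>v\<in>V. \<bar>z t v - zbar v\<bar> \<le> M * exp (- \<delta> * t) * q v))"
  proof (rule cooperative_flow)
    show "\<bar>field x v - field y v\<bar> \<le> L * (\<Sum>w\<in>V. \<bar>x w - y w\<bar>)"
      if "\<forall>w\<in>V. \<bar>x w\<bar> \<le> B" "\<forall>w\<in>V. \<bar>y w\<bar> \<le> B" "v \<in> V" for x y v
      using lip that by (simp add: box_def)
    show "\<bar>zbar v\<bar> + M * q v \<le> B" if "v \<in> V" for v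
      using zbar_le[OF that] mq(1)[OF M order_refl, of v] by linarith
    show "0 < q v" if "v \<in> V" for v using q(1)[of v] by linarith
    show "\<bar>z0 v - zbar v\<bar> < M * q v" if "v \<in> V" for v by (rule init[OF that])
    show "\<sigma> * field x v \<le> - (2 * \<delta> * m * q v)"
      if "v \<in> V" "0 < m" "m \<le> M" "\<sigma> \<in> {1, -1}" "\<forall>w\<in>V. \<bar>x w - zbar w\<bar> \<le> m * q w"
        "\<sigma> * (x v - zbar v) = m * q v" for x v m \<sigma>
      by (rule decay[OF that])
  qed (rule finite_V M \<delta>)+
  then obtain Z where "ode_solution V field {0..} z0 Z"
    "\<forall>T z. ode_solution V field {0..<T} z0 z \<longrightarrow> (\<forall>t\<in>{0..<T}. \<forall>v\<in>V. Z t v = z t v)"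
    and Z: "\<forall>z. ode_solution V field {0..} z0 z \<longrightarrow>
      (\<forall>t\<ge>0. \<forall>v\<in>V. \<bar>z t v - zbar v\<bar> \<le> M * exp (- \<delta> * t) * q v)" by blast
  moreover have "M * exp (- \<delta> * t) * q v \<le> 2 * M * exp (- \<delta> * t)" for t v
    using mult_left_mono[OF q(2)[of v], of "M * exp (- \<delta> * t)"] M by simp
  then have "\<forall>z. ode_solution V field {0..} z0 z \<longrightarrow>
      (\<forall>t\<ge>0. \<forall>v\<in>V. \<bar>z t v - zbar v\<bar> \<le> 2 * M * exp (- \<delta> * t))"
    using Z order_trans by blast
  ultimately show ?thesis using \<delta> by blast
qed

lemma field_eq_0_iff: "field z v = 0 \<longleftrightarrow> defect z v = 0"
  using speed_ge[of "z v"] area_pos[of "z v"] by (auto simp: field_def)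

lemma field_continuous:
  assumes "\<And>w. w \<in> V \<Longrightarrow> ((\<lambda>t. z t w) \<longlongrightarrow> zbar w) at_top" "v \<in> V"
  shows "((\<lambda>t. field (z t) v) \<longlongrightarrow> field zbar v) at_top"
proof -
  define B where "B = 1 + (\<Sum>v\<in>V. \<bar>zbar v\<bar>)"
  have zbar_le: "\<bar>zbar w\<bar> + 1 \<le> B" if "w \<in> V" for w
    unfolding B_def using finite_V that member_le_sum[of w V "\<lambda>v. \<bar>zbar v\<bar>"] by auto
  have "0 \<le> B" using zbar_le[OF assms(2)] by linarith
  then obtain L where lip: "\<forall>z0 z1. \<forall>v\<in>V. box B z0 \<longrightarrow> box B z1 \<longrightarrow>
      \<bar>field z1 v - field z0 v\<bar> \<le> L * (\<Sum>w\<in>V. \<bar>z1 w - z0 w\<bar>)"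
    using field_lipschitz by blast
  have "\<forall>\<^sub>F t in at_top. \<forall>w\<in>V. \<bar>z t w - zbar w\<bar> < 1"
    using finite_V tendstoD[OF assms(1), of _ 1] by (intro eventually_ball_finite) (auto simp: dist_real_def)
  then have "\<forall>\<^sub>F t in at_top. norm (field (z t) v - field zbar v) \<le> L * (\<Sum>w\<in>V. \<bar>z t w - zbar w\<bar>)"
  proof eventually_elim
    case (elim t)
    have "box B (z t)" "box B zbar" using elim zbar_le by (force simp: box_def)+
    then show ?case using lip assms(2) by auto
  qed
  moreover have "((\<lambda>t. L * (\<Sum>w\<in>V. \<bar>z t w - zbar w\<bar>)) \<longlongrightarrow> L * (\<Sum>w\<in>V. \<bar>zbar w - zbar w\<bar>)) at_top"
    by (intro tendsto_intros assms(1))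
  then have "((\<lambda>t. L * (\<Sum>w\<in>V. \<bar>z t w - zbar w\<bar>)) \<longlongrightarrow> 0) at_top" by simp
  ultimately have "((\<lambda>t. field (z t) v - field zbar v) \<longlongrightarrow> 0) at_top"
    by (rule Lim_null_comparison)
  then show ?thesis by (simp add: LIM_zero_iff)
qed

text \<open>If the field did not vanish at the limit, then from some time on it would have a fixed
  sign and size above \<open>e\<close>. The solution would move by more than \<open>e\<close> in a
  unit of time although it stays within \<open>e / 4\<close> of its limit.\<close>

lemma limit_is_equilibrium:
  assumes sol: "ode_solution V field {0..} z0 z"
    and lim: "\<And>w. w \<in> V \<Longrightarrow> ((\<lambda>t. z t w) \<longlongrightarrow> zbar w) at_top" and v: "v \<in> V"
  shows "defect zbar v = 0"
proof (rule ccontr)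
  assume "defect zbar v \<noteq> 0"
  then have ne: "field zbar v \<noteq> 0" by (simp add: field_eq_0_iff)
  define \<sigma> where "\<sigma> = sgn (field zbar v)"
  define e where "e = \<bar>field zbar v\<bar> / 2"
  have e: "0 < e" "e < \<sigma> * field zbar v" using ne abs_sgn[of "field zbar v"] by (auto simp: e_def \<sigma>_def mult.commute simp del: mult_sgn_abs)
  have "((\<lambda>t. \<sigma> * field (z t) v) \<longlongrightarrow> \<sigma> * field zbar v) at_top"
    by (intro tendsto_intros field_continuous lim v)
  then have "\<forall>\<^sub>F t in at_top. e < \<sigma> * field (z t) v" using e by (intro order_tendstoD)
  moreover have "((\<lambda>t. \<sigma> * z t v) \<longlongrightarrow> \<sigma> * zbar v) at_top" by (intro tendsto_intros lim v)
  then have "\<forall>\<^sub>F t in at_top. dist (\<sigma> * z t v) (\<sigma> * zbar v) < e / 4" using e by (intro tendstoD) auto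
  ultimately have "\<forall>\<^sub>F t in at_top. e < \<sigma> * field (z t) v \<and> dist (\<sigma> * z t v) (\<sigma> * zbar v) < e / 4"
    by (rule eventually_conj)
  then obtain T0 where T0: "\<And>t. T0 \<le> t \<Longrightarrow> e < \<sigma> * field (z t) v \<and> dist (\<sigma> * z t v) (\<sigma> * zbar v) < e / 4"
    by (auto simp: eventually_at_top_linorder)
  \<comment> \<open>From time 1 on, \<open>t\<close> is interior to \<open>{0..}\<close>, and
    one-sided derivatives are no issue.\<close>
  define T where "T = max 1 T0"
  have der: "((\<lambda>s. \<sigma> * z s v) has_real_derivative \<sigma> * field (z t) v) (at t)" if "T \<le> t" for t
  proof -
    have "((\<lambda>s. z s v) has_real_derivative field (z t) v) (at t within {0..})"
      using sol v that by (auto simp: ode_solution_def T_def)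
    moreover have "at t within {0..} = at t" using that by (intro at_within_interior) (auto simp: T_def)
    ultimately show ?thesis by (auto intro!: derivative_eq_intros)
  qed
  obtain t where t: "T < t" "t < T + 1" "\<sigma> * z (T + 1) v - \<sigma> * z T v = (T + 1 - T) * (\<sigma> * field (z t) v)"
    using MVT2[of T "T + 1" "\<lambda>s. \<sigma> * z s v" "\<lambda>t. \<sigma> * field (z t) v"] der by auto
  then have "e < \<sigma> * z (T + 1) v - \<sigma> * z T v" using T0[of t] by (auto simp: T_def)
  moreover have "dist (\<sigma> * z (T + 1) v) (\<sigma> * zbar v) < e / 4" "dist (\<sigma> * z T v) (\<sigma> * zbar v) < e / 4"
    using T0[of T] T0[of "T + 1"] by (auto simp: T_def)
  ultimately show False using e(1) unfolding dist_real_def by linarith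
qed

end

subsection \<open>The flow in radial coordinates\<close>

text \<open>\<open>rad\<close> and \<open>coord\<close> pass between \<open>z\<close> and the
  radius, and \<open>chi\<close> expresses \<open>z\<close> through \<open>u\<close>. The map
  \<open>chi\<close> is needed because a flow solution only supplies the derivative of
  \<open>u (r s v)\<close>; differentiability of \<open>coord (r s v)\<close> follows by writing it
  as \<open>chi (u (r s v))\<close>.\<close>

locale packing_coordinates = packing_flow tau area speed V F c angle \<kappa> Rbar i0
  for tau :: "real \<Rightarrow> real \<Rightarrow> real \<Rightarrow> real" and area speed :: "real \<Rightarrow> real"
    and V :: "'v set" and F :: "'v set set" and c :: "'v set \<Rightarrow> real"
    and angle :: "('v \<Rightarrow> real) \<Rightarrow> 'v \<Rightarrow> 'v set \<Rightarrow> real" and \<kappa> Rbar :: "'v \<Rightarrow> real" and i0 :: 'v +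
  fixes u rad coord chi :: "real \<Rightarrow> real" and R :: "('v \<Rightarrow> real) \<Rightarrow> 'v \<Rightarrow> real"
  assumes rad_pos: "0 < rad x"
    and rad_coord: "0 < \<rho> \<Longrightarrow> rad (coord \<rho>) = \<rho>"
    and coord_rad: "coord (rad x) = x"
    and coord_continuous: "0 < \<rho> \<Longrightarrow> isCont coord \<rho>"
    and rad_lipschitz: "\<forall>\<^sub>F K in at_top. \<forall>x0\<in>{-B..B}. \<forall>x1\<in>{-B..B}. x0 \<le> x1 \<longrightarrow>
      (x1 - x0) / K \<le> rad x1 - rad x0 \<and> rad x1 - rad x0 \<le> K * (x1 - x0)"
    and u_rad_derivative: "((\<lambda>x. u (rad x)) has_real_derivative 1 / speed x) (at x)"
    and chi_u: "0 < \<rho> \<Longrightarrow> chi (u \<rho>) = coord \<rho>"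
    and chi_derivative: "0 < \<rho> \<Longrightarrow> (chi has_real_derivative speed (coord \<rho>)) (at (u \<rho>))"
    and curvature: "circle_packing_metric V r \<Longrightarrow> v \<in> V \<Longrightarrow>
      Rbar v - R r v = defect (\<lambda>w. coord (r w)) v / area (coord (r v))"
begin

lemma field_eq_curvature:
  "circle_packing_metric V r \<Longrightarrow> v \<in> V \<Longrightarrow> field (\<lambda>w. coord (r w)) v = speed (coord (r v)) * (Rbar v - R r v)"
  by (simp add: field_def curvature)

lemma equilibrium_iff:
  "circle_packing_metric V r \<Longrightarrow> v \<in> V \<Longrightarrow> R r v = Rbar v \<longleftrightarrow> defect (\<lambda>w. coord (r w)) v = 0"
  using curvature[of r v] area_pos[of "coord (r v)"] by (auto simp: field_simps)

lemma flow_solution_coord: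
  assumes "flow_solution V u R Rbar J r0 r"
  shows "ode_solution V field J (\<lambda>v. coord (r0 v)) (\<lambda>t v. coord (r t v))"
  unfolding ode_solution_def
proof (intro conjI ballI)
  show "coord (r 0 v) = coord (r0 v)" if "v \<in> V" for v
    using assms that by (simp add: flow_solution_def)
  fix t v assume tv: "t \<in> J" "v \<in> V"
  have cpm: "circle_packing_metric V (r t)" if "t \<in> J" for t
    using assms that by (simp add: flow_solution_def)
  then have pos: "0 < r s v" if "s \<in> J" for s using that tv by (auto simp: circle_packing_metric_def)
  have "((\<lambda>s. u (r s v)) has_real_derivative Rbar v - R (r t) v) (at t within J)"
    using assms tv by (simp add: flow_solution_def)
  then have "((\<lambda>s. chi (u (r s v))) has_real_derivative speed (coord (r t v)) * (Rbar v - R (r t) v)) (at t within J)"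
    by (rule DERIV_chain2[where f = chi and g = "\<lambda>s. u (r s v)", OF chi_derivative[OF pos[OF tv(1)]]])
  then have "((\<lambda>s. chi (u (r s v))) has_real_derivative field (\<lambda>w. coord (r t w)) v) (at t within J)"
    using field_eq_curvature[OF cpm] tv by simp
  then show "((\<lambda>s. coord (r s v)) has_real_derivative field (\<lambda>v. coord (r t v)) v) (at t within J)"
    by (rule has_field_derivative_transform_within[OF _ zero_less_one]) (use tv pos chi_u in auto)
qed

lemma flow_solution_rad:
  assumes "circle_packing_metric V r0" "ode_solution V field J (\<lambda>v. coord (r0 v)) z"
  shows "flow_solution V u R Rbar J r0 (\<lambda>t v. rad (z t v))"
  unfolding flow_solution_def
proof (intro conjI ballI)
  show "rad (z 0 v) = r0 v" if "v \<in> V" for v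
    using assms that by (simp add: ode_solution_def circle_packing_metric_def rad_coord)
  show cpm: "circle_packing_metric V (\<lambda>v. rad (z t v))" for t
    by (simp add: circle_packing_metric_def rad_pos)
  fix t v assume tv: "t \<in> J" "v \<in> V"
  have "((\<lambda>s. z s v) has_real_derivative field (z t) v) (at t within J)"
    using assms tv by (simp add: ode_solution_def)
  then have "((\<lambda>s. u (rad (z s v))) has_real_derivative 1 / speed (z t v) * field (z t) v) (at t within J)"
    by (rule DERIV_chain2[where f = "\<lambda>x. u (rad x)" and g = "\<lambda>s. z s v", OF u_rad_derivative])
  moreover have "field (z t) v = speed (z t v) * (Rbar v - R (\<lambda>v. rad (z t v)) v)"
    using field_eq_curvature[OF cpm tv(2), of t] by (simp add: coord_rad)
  ultimately show "((\<lambda>s. u (rad (z s v))) has_real_derivative Rbar v - R (\<lambda>v. rad (z t v)) v) (at t within J)"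
    using speed_ge[of "z t v"] by simp
qed

lemma equilibrium_attracts:
  assumes bar: "circle_packing_metric V rbar" "\<forall>v\<in>V. R rbar v = Rbar v"
  shows "flow_converges_exponentially V u R Rbar rbar"
  unfolding flow_converges_exponentially_def
proof (intro allI impI)
  fix r0 assume r0: "circle_packing_metric V r0"
  define zbar where "zbar v = coord (rbar v)" for v
  have eq: "defect zbar v = 0" if "v \<in> V" for v
    using equilibrium_iff[OF bar(1) that] bar(2) that by (simp add: zbar_def[abs_def])
  obtain Z M \<delta> where \<delta>: "0 < \<delta>" and Z: "ode_solution V field {0..} (\<lambda>v. coord (r0 v)) Z"
    and ext: "\<forall>T z. ode_solution V field {0..<T} (\<lambda>v. coord (r0 v)) z \<longrightarrow> (\<forall>t\<in>{0..<T}. \<forall>v\<in>V. Z t v = z t v)"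
    and conv: "\<forall>z. ode_solution V field {0..} (\<lambda>v. coord (r0 v)) z \<longrightarrow>
      (\<forall>t\<ge>0. \<forall>v\<in>V. \<bar>z t v - zbar v\<bar> \<le> M * exp (- \<delta> * t))"
    using flow_to_equilibrium[OF eq, of "\<lambda>v. coord (r0 v)"] by blast
  have sol: "flow_solution V u R Rbar {0..} r0 (\<lambda>t v. rad (Z t v))" by (rule flow_solution_rad[OF r0 Z])
  have extend: "\<forall>t\<in>{0..<T}. \<forall>v\<in>V. rad (Z t v) = r t v" if r: "flow_solution V u R Rbar {0..<T} r0 r" for T r
  proof (intro ballI)
    fix t v assume tv: "t \<in> {0..<T}" "v \<in> V"
    have "Z t v = coord (r t v)" using ext flow_solution_coord[OF r] tv by blast
    moreover have "0 < r t v" using r tv by (auto simp: flow_solution_def circle_packing_metric_def)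
    ultimately show "rad (Z t v) = r t v" by (simp add: rad_coord)
  qed
  have exponential: "converges_exponentially V r rbar" if r: "flow_solution V u R Rbar {0..} r0 r" for r
  proof -
    \<comment> \<open>The trajectory never leaves this box, because
      \<open>exp (- \<delta> * t) \<le> 1\<close>. On it \<open>rad\<close> is Lipschitz, which
      turns decay in \<open>z\<close> into decay of the radii.\<close>
    define B where "B = \<bar>M\<bar> + (\<Sum>v\<in>V. \<bar>zbar v\<bar>)"
    obtain K where K: "1 \<le> K" and lip: "\<forall>x0\<in>{-B..B}. \<forall>x1\<in>{-B..B}. x0 \<le> x1 \<longrightarrow>
        (x1 - x0) / K \<le> rad x1 - rad x0 \<and> rad x1 - rad x0 \<le> K * (x1 - x0)"
      using eventually_happens'[OF _ eventually_conj[OF eventually_ge_at_top[of 1] rad_lipschitz[of B]]] by auto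
    have lip': "\<bar>rad x - rad y\<bar> \<le> K * \<bar>x - y\<bar>" if "x \<in> {-B..B}" "y \<in> {-B..B}" for x y
    proof -
      have "0 \<le> (x - y) / K" if "y \<le> x" using that K by auto
      moreover have "0 \<le> (y - x) / K" if "x \<le> y" using that K by auto
      ultimately show ?thesis using lip[rule_format, OF that] lip[rule_format, OF that(2,1)] by (cases "x \<le> y") auto
    qed
    have "\<bar>r t v - rbar v\<bar> \<le> K * M * exp (- \<delta> * t)" if t: "0 \<le> t" and v: "v \<in> V" for t v
    proof -
      have le: "\<bar>coord (r t v) - zbar v\<bar> \<le> M * exp (- \<delta> * t)" using conv flow_solution_coord[OF r] t v by blast
      also have "\<dots> \<le> \<bar>M\<bar> * 1" using t \<delta> by (intro mult_mono) auto
      finally have "\<bar>coord (r t v) - zbar v\<bar> \<le> \<bar>M\<bar>" by simp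
      moreover have "\<bar>zbar v\<bar> \<le> (\<Sum>v\<in>V. \<bar>zbar v\<bar>)" using finite_V v by (intro member_le_sum) auto
      ultimately have mem: "coord (r t v) \<in> {-B..B}" "zbar v \<in> {-B..B}" unfolding B_def by auto
      have "0 < r t v" "0 < rbar v"
        using r bar t v by (auto simp: flow_solution_def circle_packing_metric_def)
      then have "\<bar>r t v - rbar v\<bar> = \<bar>rad (coord (r t v)) - rad (zbar v)\<bar>" by (simp add: rad_coord zbar_def)
      also have "\<dots> \<le> K * \<bar>coord (r t v) - zbar v\<bar>" by (rule lip'[OF mem])
      also have "\<dots> \<le> K * (M * exp (- \<delta> * t))" using K le by (intro mult_left_mono) auto
      finally show ?thesis by (simp add: mult_ac)
    qed
    then show ?thesis unfolding converges_exponentially_def using \<delta> by blast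
  qed
  show "(\<exists>r. flow_solution V u R Rbar {0..} r0 r) \<and>
    (\<forall>T>0. \<forall>r. flow_solution V u R Rbar {0..<T} r0 r \<longrightarrow>
      (\<exists>r'. flow_solution V u R Rbar {0..} r0 r' \<and> (\<forall>t\<in>{0..<T}. \<forall>v\<in>V. r' t v = r t v))) \<and>
    (\<forall>r. flow_solution V u R Rbar {0..} r0 r \<longrightarrow> converges_exponentially V r rbar)"
    using sol extend exponential by blast
qed

lemma converges_exponentially_tendsto:
  assumes "converges_exponentially V r rbar" "v \<in> V"
  shows "((\<lambda>t. r t v) \<longlongrightarrow> rbar v) at_top"
proof -
  obtain C e where e: "0 < e" and le: "\<forall>t\<ge>0. \<forall>v\<in>V. \<bar>r t v - rbar v\<bar> \<le> C * exp (- e * t)"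
    using assms unfolding converges_exponentially_def by blast
  have "filterlim (\<lambda>t. - e * t) at_bot at_top"
    by (rule filterlim_tendsto_neg_mult_at_bot[OF tendsto_const _ filterlim_ident]) (use e in auto)
  then have "((\<lambda>t. C * exp (- e * t)) \<longlongrightarrow> C * 0) at_top"
    by (intro tendsto_intros filterlim_compose[OF exp_at_bot])
  have "((\<lambda>t. r t v - rbar v) \<longlongrightarrow> 0) at_top"
  proof (rule Lim_null_comparison[where g = "\<lambda>t. C * exp (- e * t)"])
    show "\<forall>\<^sub>F t in at_top. norm (r t v - rbar v) \<le> C * exp (- e * t)"
      using eventually_ge_at_top[of 0] by eventually_elim (use le assms(2) in simp)
  qed (use \<open>((\<lambda>t. C * exp (- e * t)) \<longlongrightarrow> C * 0) at_top\<close> in simp)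
  then show ?thesis by (simp add: LIM_zero_iff)
qed

lemma attractor_is_equilibrium:
  assumes bar: "circle_packing_metric V rbar" and flow: "flow_converges_exponentially V u R Rbar rbar"
    and v: "v \<in> V"
  shows "R rbar v = Rbar v"
proof -
  \<comment> \<open>Any initial metric would do; \<open>rbar\<close> is one at hand.\<close>
  obtain r where r: "flow_solution V u R Rbar {0..} rbar r" and conv: "converges_exponentially V r rbar"
    using flow bar unfolding flow_converges_exponentially_def by blast
  have "((\<lambda>t. coord (r t w)) \<longlongrightarrow> coord (rbar w)) at_top" if "w \<in> V" for w
    by (rule isCont_tendsto_compose[OF coord_continuous converges_exponentially_tendsto[OF conv that]])
      (use bar that in \<open>auto simp: circle_packing_metric_def\<close>)
  then have "defect (\<lambda>w. coord (rbar w)) v = 0"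
    using limit_is_equilibrium[OF flow_solution_coord[OF r], of "\<lambda>w. coord (rbar w)"] v by blast
  then show ?thesis using equilibrium_iff[OF bar v] by simp
qed

lemma equilibrium_unique:
  assumes bar: "circle_packing_metric V rbar" "\<forall>v\<in>V. R rbar v = Rbar v"
    and r: "circle_packing_metric V r" "\<forall>v\<in>V. R r v = Rbar v" and v: "v \<in> V"
  shows "r v = rbar v"
proof -
  have "flow_solution V u R Rbar {0..} r (\<lambda>t. r)"
    unfolding flow_solution_def using r by simp
  then have "converges_exponentially V (\<lambda>t. r) rbar"
    using equilibrium_attracts[OF bar] r(1) unfolding flow_converges_exponentially_def by blast
  then have "((\<lambda>t::real. r v) \<longlongrightarrow> rbar v) at_top" using v by (rule converges_exponentially_tendsto)
  then show ?thesis by (simp add: tendsto_const_iff)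
qed

theorem unique_and_attracting:
  "(\<forall>rbar. circle_packing_metric V rbar \<and> (\<forall>v\<in>V. R rbar v = Rbar v) \<longrightarrow>
      (\<forall>r. circle_packing_metric V r \<and> (\<forall>v\<in>V. R r v = Rbar v) \<longrightarrow> (\<forall>v\<in>V. r v = rbar v))) \<and>
   (\<forall>rbar. circle_packing_metric V rbar \<longrightarrow>
      ((\<forall>v\<in>V. R rbar v = Rbar v) \<longleftrightarrow> flow_converges_exponentially V u R Rbar rbar))"
proof (intro conjI allI impI ballI iffI)
  fix rbar r v
  assume "circle_packing_metric V rbar \<and> (\<forall>v\<in>V. R rbar v = Rbar v)"
    "circle_packing_metric V r \<and> (\<forall>v\<in>V. R r v = Rbar v)" "v \<in> V"
  then show "r v = rbar v" using equilibrium_unique[of rbar r v] by blast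
qed (rule equilibrium_attracts attractor_is_equilibrium; assumption)+

end

subsection \<open>Euclidean and hyperbolic background geometry\<close>

lemma divide_cancel_factors:
  fixes a b x y z :: real
  assumes "0 < a" "0 < b"
  shows "a * b * x / ((a * y) * (b * z)) = x / (y * z)"
  using assms by (cases "y = 0 \<or> z = 0") (auto simp: field_simps)

text \<open>Completing the square, the squared length of \<open>{i, j}\<close> is
  \<open>(r i + p * r j)\<^sup>2 + (1 - p\<^sup>2) * (r j)\<^sup>2\<close>, which is
  \<open>(r j)\<^sup>2 * (T\<^sup>2 + (1 - p\<^sup>2))\<close>. Likewise the numerator of the cosine
  law has the factor \<open>r j * r k\<close>, and these factors cancel.\<close>

lemma euc_angle_eq_cone_angle:
  assumes "distinct [i, j, k]" and r: "0 < r i" "0 < r j" "0 < r k"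
    and c: "cos (\<Phi> {i, j}) \<in> {0..1}" "cos (\<Phi> {i, k}) \<in> {0..1}" "cos (\<Phi> {j, k}) \<in> {0..1}"
  shows "euc_angle \<Phi> r i {i, j, k} = cone_angle (cos (\<Phi> {i, j})) (cos (\<Phi> {i, k})) (cos (\<Phi> {j, k}))
    (r i / r j + cos (\<Phi> {i, j})) (r i / r k + cos (\<Phi> {i, k}))"
proof -
  define p q s where "p = cos (\<Phi> {i, j})" and "q = cos (\<Phi> {i, k})" and "s = cos (\<Phi> {j, k})"
  define T T' where "T = r i / r j + p" and "T' = r i / r k + q"
  have sq: "(euc_length \<Phi> r {v, w})\<^sup>2 = (r v)\<^sup>2 + (r w)\<^sup>2 + 2 * r v * r w * cos (\<Phi> {v, w})"
    if "v \<noteq> w" "0 < r v" "0 < r w" "cos (\<Phi> {v, w}) \<in> {0..1}" for v w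
    using that by (simp add: euc_length_edge)
  have len: "euc_length \<Phi> r {i, j} = r j * sqrt (T\<^sup>2 + (1 - p\<^sup>2))" "euc_length \<Phi> r {i, k} = r k * sqrt (T'\<^sup>2 + (1 - q\<^sup>2))"
  proof -
    have "sqrt ((r i)\<^sup>2 + (r w)\<^sup>2 + 2 * r i * r w * e) = r w * sqrt ((r i / r w + e)\<^sup>2 + (1 - e\<^sup>2))"
      if "0 < r w" for w e
    proof -
      have "(r i)\<^sup>2 + (r w)\<^sup>2 + 2 * r i * r w * e = (r w)\<^sup>2 * ((r i / r w + e)\<^sup>2 + (1 - e\<^sup>2))"
        using that by (simp add: field_simps power2_eq_square)
      then show ?thesis using that by (simp add: real_sqrt_mult)
    qed
    then show "euc_length \<Phi> r {i, j} = r j * sqrt (T\<^sup>2 + (1 - p\<^sup>2))" "euc_length \<Phi> r {i, k} = r k * sqrt (T'\<^sup>2 + (1 - q\<^sup>2))"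
      using assms by (simp_all add: euc_length_edge T_def T'_def p_def q_def)
  qed
  have num: "(euc_length \<Phi> r {i, j})\<^sup>2 + (euc_length \<Phi> r {i, k})\<^sup>2 - (euc_length \<Phi> r {j, k})\<^sup>2 =
      2 * (r j * r k) * (T * T' - (s + p * q))"
  proof -
    have T: "r j * T = r i + p * r j" "r k * T' = r i + q * r k"
      using r by (simp_all add: T_def T'_def field_simps)
    have "(euc_length \<Phi> r {i, j})\<^sup>2 + (euc_length \<Phi> r {i, k})\<^sup>2 - (euc_length \<Phi> r {j, k})\<^sup>2 =
        2 * ((r i + p * r j) * (r i + q * r k)) - 2 * (r j * r k) * (s + p * q)"
      using sq[of i j] sq[of i k] sq[of j k] assms
      by (simp add: p_def q_def s_def power2_eq_square algebra_simps)
    also have "\<dots> = 2 * (r j * r k) * (T * T' - (s + p * q))"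
      unfolding T[symmetric] by (simp add: algebra_simps)
    finally show ?thesis .
  qed
  define W W' where "W = sqrt (T\<^sup>2 + (1 - p\<^sup>2))" and "W' = sqrt (T'\<^sup>2 + (1 - q\<^sup>2))"
  have "euc_angle \<Phi> r i {i, j, k} = arccos (2 * (r j * r k) * (T * T' - (s + p * q)) / (2 * (r j * W) * (r k * W')))"
    using assms(1) num len by (simp add: euc_angle_face Let_def W_def W'_def)
  also have "2 * (r j * r k) * (T * T' - (s + p * q)) / (2 * (r j * W) * (r k * W')) = (T * T' - (s + p * q)) / (W * W')"
  proof -
    have "2 * (r j * r k) * (T * T' - (s + p * q)) / (2 * (r j * W) * (r k * W')) =
        r j * r k * (T * T' - (s + p * q)) / ((r j * W) * (r k * W'))" by simp
    also have "\<dots> = (T * T' - (s + p * q)) / (W * W')" by (rule divide_cancel_factors) (use r in auto)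
    finally show ?thesis .
  qed
  finally show ?thesis
    by (simp add: cone_angle_def W_def W'_def T_def T'_def p_def q_def s_def)
qed

text \<open>The same pattern with \<open>sinh (r j)\<close> and \<open>sinh (r k)\<close> as the
  factors that cancel. The completed square is now that of \<open>sinh\<close> of the edge length,
  with \<open>sinh (r i) * cosh (r j) + p * cosh (r i) * sinh (r j)\<close> in place of
  \<open>r i + p * r j\<close>.\<close>

lemma hyp_angle_eq_cone_angle:
  assumes "distinct [i, j, k]" and r: "0 < r i" "0 < r j" "0 < r k"
    and c: "cos (\<Phi> {i, j}) \<in> {0..1}" "cos (\<Phi> {i, k}) \<in> {0..1}" "cos (\<Phi> {j, k}) \<in> {0..1}"
  shows "hyp_angle \<Phi> r i {i, j, k} = cone_angle (cos (\<Phi> {i, j})) (cos (\<Phi> {i, k})) (cos (\<Phi> {j, k}))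
    (sinh (r i) * cosh (r j) / sinh (r j) + cos (\<Phi> {i, j}) * cosh (r i))
    (sinh (r i) * cosh (r k) / sinh (r k) + cos (\<Phi> {i, k}) * cosh (r i))"
proof -
  define p q s where "p = cos (\<Phi> {i, j})" and "q = cos (\<Phi> {i, k})" and "s = cos (\<Phi> {j, k})"
  define T T' where "T = sinh (r i) * cosh (r j) / sinh (r j) + p * cosh (r i)"
    and "T' = sinh (r i) * cosh (r k) / sinh (r k) + q * cosh (r i)"
  have ge1: "1 \<le> cosh a * cosh b + sinh a * sinh b * e" if "0 < a" "0 < b" "e \<in> {0..1}" for a b e :: real
  proof -
    have "1 * 1 \<le> cosh a * cosh b" by (intro mult_mono cosh_real_ge_1) auto
    moreover have "0 \<le> sinh a * sinh b * e" using that by simp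
    ultimately show ?thesis by simp
  qed
  have cosh_len: "cosh (hyp_length \<Phi> r {v, w}) = cosh (r v) * cosh (r w) + sinh (r v) * sinh (r w) * cos (\<Phi> {v, w})"
    if "v \<noteq> w" "0 < r v" "0 < r w" "cos (\<Phi> {v, w}) \<in> {0..1}" for v w
    using that ge1 by (simp add: hyp_length_edge)
  have sq: "cosh x ^ 2 = sinh x ^ 2 + 1" for x :: real by (rule cosh_square_eq)
  have sinh_len: "sinh (hyp_length \<Phi> r {i, w}) =
      sinh (r w) * sqrt ((sinh (r i) * cosh (r w) / sinh (r w) + cos (\<Phi> {i, w}) * cosh (r i))\<^sup>2 + (1 - (cos (\<Phi> {i, w}))\<^sup>2))"
    if "i \<noteq> w" "0 < r w" "cos (\<Phi> {i, w}) \<in> {0..1}" for w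
  proof -
    let ?e = "cos (\<Phi> {i, w})"
    have S: "0 < sinh (r w)" using that by simp
    have "(cosh (r i) * cosh (r w) + sinh (r i) * sinh (r w) * ?e)\<^sup>2 - 1 =
        (sinh (r i) * cosh (r w) + ?e * cosh (r i) * sinh (r w))\<^sup>2 + (sinh (r w))\<^sup>2 * (1 - ?e\<^sup>2)"
      using sq[of "r i"] sq[of "r w"] by algebra
    also have "\<dots> = (sinh (r w))\<^sup>2 * ((sinh (r i) * cosh (r w) / sinh (r w) + ?e * cosh (r i))\<^sup>2 + (1 - ?e\<^sup>2))"
      using S by (simp add: field_simps power2_eq_square)
    finally show ?thesis
      using that r S ge1[of "r i" "r w" ?e] by (simp add: hyp_length_edge sinh_arcosh_real real_sqrt_mult)
  qed
  define W W' where "W = sqrt (T\<^sup>2 + (1 - p\<^sup>2))" and "W' = sqrt (T'\<^sup>2 + (1 - q\<^sup>2))"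
  have S: "0 < sinh (r j)" "0 < sinh (r k)" using r by auto
  have TT: "sinh (r j) * T = sinh (r i) * cosh (r j) + p * cosh (r i) * sinh (r j)"
    "sinh (r k) * T' = sinh (r i) * cosh (r k) + q * cosh (r i) * sinh (r k)"
    using S by (simp_all add: T_def T'_def field_simps)
  have num: "cosh (hyp_length \<Phi> r {i, j}) * cosh (hyp_length \<Phi> r {i, k}) - cosh (hyp_length \<Phi> r {j, k}) =
      sinh (r j) * sinh (r k) * (T * T' - (s + p * q))"
  proof -
    have "cosh (hyp_length \<Phi> r {i, j}) * cosh (hyp_length \<Phi> r {i, k}) - cosh (hyp_length \<Phi> r {j, k}) =
        (cosh (r i) * cosh (r j) + sinh (r i) * sinh (r j) * p) * (cosh (r i) * cosh (r k) + sinh (r i) * sinh (r k) * q)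
        - (cosh (r j) * cosh (r k) + sinh (r j) * sinh (r k) * s)"
      using assms by (simp add: cosh_len p_def q_def s_def)
    also have "\<dots> = (sinh (r i) * cosh (r j) + p * cosh (r i) * sinh (r j)) * (sinh (r i) * cosh (r k) + q * cosh (r i) * sinh (r k))
        - sinh (r j) * sinh (r k) * (s + p * q)"
      using sq[of "r i"] by algebra
    also have "\<dots> = sinh (r j) * sinh (r k) * (T * T' - (s + p * q))"
      unfolding TT[symmetric] by (simp add: algebra_simps)
    finally show ?thesis .
  qed
  have "hyp_angle \<Phi> r i {i, j, k} = arccos (sinh (r j) * sinh (r k) * (T * T' - (s + p * q)) / ((sinh (r j) * W) * (sinh (r k) * W')))"
    using assms num sinh_len[of j] sinh_len[of k]
    by (simp add: hyp_angle_face Let_def W_def W'_def T_def T'_def p_def q_def)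
  also have "sinh (r j) * sinh (r k) * (T * T' - (s + p * q)) / ((sinh (r j) * W) * (sinh (r k) * W')) = (T * T' - (s + p * q)) / (W * W')"
    by (rule divide_cancel_factors[OF S])
  finally show ?thesis
    by (simp add: cone_angle_def W_def W'_def T_def T'_def p_def q_def s_def)
qed

lemma exp_bilipschitz:
  "\<forall>\<^sub>F K in at_top. \<forall>x0\<in>{-B..B}. \<forall>x1\<in>{-B..B :: real}. x0 \<le> x1 \<longrightarrow>
    (x1 - x0) / K \<le> exp x1 - exp x0 \<and> exp x1 - exp x0 \<le> K * (x1 - x0)"
  by (rule deriv_bilipschitz1[where f' = exp]) (auto intro!: continuous_intros derivative_eq_intros)

text \<open>With \<open>z = ln r\<close> the exponential of \<open>y\<close> is the ratio of the two
  radii. Scale invariance of Euclidean angles shows in \<open>tau\<close> being independent of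
  \<open>x\<close>. The area is strictly increasing because \<open>\<alpha>\<close> is
  positive.\<close>

lemma euc_packing_geometry:
  assumes "0 < \<alpha>"
  shows "packing_geometry (\<lambda>p x y. exp y + p) (\<lambda>x. pi * exp (\<alpha> * x)) (\<lambda>x. 1)"
proof
  fix p x y B :: real
  show "p < exp y + p" by simp
  show "\<forall>\<^sub>F K in at_top. \<forall>y\<in>{-B..B}. \<forall>x0\<in>{-B..B}. \<forall>x1\<in>{-B..B}. x0 \<le> x1 \<longrightarrow>
      0 \<le> exp y + p - (exp y + p) \<and> exp y + p - (exp y + p) \<le> K * (x1 - x0)"
    using eventually_ge_at_top[of 0] by eventually_elim auto
  show "\<forall>\<^sub>F K in at_top. \<forall>x\<in>{-B..B}. \<forall>y0\<in>{-B..B}. \<forall>y1\<in>{-B..B}. y0 \<le> y1 \<longrightarrow>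
      (y1 - y0) / K \<le> exp y1 + p - (exp y0 + p) \<and> exp y1 + p - (exp y0 + p) \<le> K * (y1 - y0)"
    using exp_bilipschitz[of B] by eventually_elim auto
  show "0 < pi * exp (\<alpha> * x)" by simp
  show "\<forall>\<^sub>F K in at_top. \<forall>x0\<in>{-B..B}. \<forall>x1\<in>{-B..B}. x0 \<le> x1 \<longrightarrow>
      (x1 - x0) / K \<le> pi * exp (\<alpha> * x1) - pi * exp (\<alpha> * x0) \<and>
      pi * exp (\<alpha> * x1) - pi * exp (\<alpha> * x0) \<le> K * (x1 - x0)"
    by (rule deriv_bilipschitz1[where f' = "\<lambda>x. pi * (exp (\<alpha> * x) * \<alpha>)"])
      (use assms in \<open>auto intro!: continuous_intros derivative_eq_intros\<close>)
  show "\<forall>\<^sub>F K in at_top. \<forall>x0\<in>{-B..B}. \<forall>x1\<in>{-B..B}. x0 \<le> x1 \<longrightarrow> \<bar>1 - 1\<bar> \<le> K * (x1 - x0)"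
    using eventually_ge_at_top[of 0] by eventually_elim auto
qed simp

lemma arsinh_exp_derivative:
  "((\<lambda>x. arsinh (exp x)) has_real_derivative exp x / sqrt (1 + exp (2 * x))) (at x)"
  using DERIV_chain2[OF arsinh_real_has_field_derivative DERIV_exp[of x]]
  by (simp add: add.commute flip: exp_double)

lemma arsinh_exp_pos: "0 < arsinh (exp x :: real)"
  by simp

lemma cosh_arsinh_exp: "cosh (arsinh (exp x)) = sqrt (1 + exp (2 * x :: real))"
  by (simp add: cosh_arsinh_real add.commute power2_eq_square flip: exp_add)

text \<open>Here \<open>r = arsinh (exp x)\<close>, so
  \<open>cosh r = sqrt (1 + exp (2 * x))\<close>. This is also the speed:
  \<open>dz / dr = coth r\<close> and \<open>du / dr = 1 / sinh r\<close>, hence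
  \<open>dz / du = cosh r\<close>.\<close>

lemma hyp_packing_geometry:
  assumes "0 < \<alpha>"
  shows "packing_geometry (\<lambda>p x y. sqrt (exp (2 * x) + exp (2 * y)) + p * sqrt (1 + exp (2 * x)))
    (\<lambda>x. 4 * pi * sinh (arsinh (exp x) / 2) powr \<alpha>) (\<lambda>x. sqrt (1 + exp (2 * x)))"
proof
  fix p x y B :: real
  have pos: "0 < exp (2 * x) + exp (2 * y)" "0 < 1 + exp (2 * x)" for x y :: real
    by (auto intro: add_pos_pos)
  have speed_ge: "1 \<le> sqrt (1 + exp (2 * x))" for x :: real by simp
  then show "1 \<le> sqrt (1 + exp (2 * x))" .
  have "((\<lambda>x. sqrt (1 + exp (2 * x))) has_real_derivative exp (2 * x) / sqrt (1 + exp (2 * x))) (at x)" for x :: real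
    using pos(2)[of x] by (auto intro!: derivative_eq_intros simp: field_simps)
  note dspeed = this
  show "0 \<le> p \<Longrightarrow> p < sqrt (exp (2 * x) + exp (2 * y)) + p * sqrt (1 + exp (2 * x))"
    using pos(1)[of x y] mult_left_mono[OF speed_ge[of x], of p] by (simp add: add_pos_nonneg add_strict_increasing)
  show "\<forall>\<^sub>F K in at_top. \<forall>y\<in>{-B..B}. \<forall>x0\<in>{-B..B}. \<forall>x1\<in>{-B..B}. x0 \<le> x1 \<longrightarrow>
      0 \<le> sqrt (exp (2 * x1) + exp (2 * y)) + p * sqrt (1 + exp (2 * x1)) - (sqrt (exp (2 * x0) + exp (2 * y)) + p * sqrt (1 + exp (2 * x0))) \<and>
      sqrt (exp (2 * x1) + exp (2 * y)) + p * sqrt (1 + exp (2 * x1)) - (sqrt (exp (2 * x0) + exp (2 * y)) + p * sqrt (1 + exp (2 * x0))) \<le> K * (x1 - x0)"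
    if p: "0 \<le> p"
  proof -
    have "\<forall>\<^sub>F K in at_top. \<forall>y\<in>{-B..B}. \<forall>x0\<in>{-B..B}. \<forall>x1\<in>{-B..B}. x0 \<le> x1 \<longrightarrow>
      (x1 - x0) / K \<le> sqrt (exp (2 * x1) + exp (2 * y)) + p * sqrt (1 + exp (2 * x1)) - (sqrt (exp (2 * x0) + exp (2 * y)) + p * sqrt (1 + exp (2 * x0))) \<and>
      sqrt (exp (2 * x1) + exp (2 * y)) + p * sqrt (1 + exp (2 * x1)) - (sqrt (exp (2 * x0) + exp (2 * y)) + p * sqrt (1 + exp (2 * x0))) \<le> K * (x1 - x0)"
    proof (rule deriv_bilipschitz[where f' = "\<lambda>y x. exp (2 * x) / sqrt (exp (2 * x) + exp (2 * y)) + p * (exp (2 * x) / sqrt (1 + exp (2 * x)))"])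
      show "continuous_on ({-B..B} \<times> {-B..B}) (\<lambda>(y, x). exp (2 * x) / sqrt (exp (2 * x) + exp (2 * y)) + p * (exp (2 * x) / sqrt (1 + exp (2 * x))))"
        unfolding case_prod_unfold using pos by (auto intro!: continuous_intros simp: less_imp_neq[symmetric])
      fix y x :: real
      have "((\<lambda>x. sqrt (exp (2 * x) + exp (2 * y))) has_real_derivative exp (2 * x) / sqrt (exp (2 * x) + exp (2 * y))) (at x)"
        using pos(1)[of x y] by (auto intro!: derivative_eq_intros simp: field_simps)
      then show "((\<lambda>x. sqrt (exp (2 * x) + exp (2 * y)) + p * sqrt (1 + exp (2 * x))) has_real_derivative
          exp (2 * x) / sqrt (exp (2 * x) + exp (2 * y)) + p * (exp (2 * x) / sqrt (1 + exp (2 * x)))) (at x)"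
        by (intro DERIV_add DERIV_cmult dspeed)
      show "0 < exp (2 * x) / sqrt (exp (2 * x) + exp (2 * y)) + p * (exp (2 * x) / sqrt (1 + exp (2 * x)))"
        using pos p by (intro add_pos_nonneg) auto
    qed
    with eventually_gt_at_top[of 0] show ?thesis
    proof eventually_elim
      case (elim K)
      have "0 \<le> (x1 - x0) / K" if "x0 \<le> x1" for x0 x1 using that elim(1) by simp
      then show ?case using elim(2) order_trans by blast
    qed
  qed
  show "\<forall>\<^sub>F K in at_top. \<forall>x\<in>{-B..B}. \<forall>y0\<in>{-B..B}. \<forall>y1\<in>{-B..B}. y0 \<le> y1 \<longrightarrow>
      (y1 - y0) / K \<le> sqrt (exp (2 * x) + exp (2 * y1)) + p * sqrt (1 + exp (2 * x)) - (sqrt (exp (2 * x) + exp (2 * y0)) + p * sqrt (1 + exp (2 * x))) \<and>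
      sqrt (exp (2 * x) + exp (2 * y1)) + p * sqrt (1 + exp (2 * x)) - (sqrt (exp (2 * x) + exp (2 * y0)) + p * sqrt (1 + exp (2 * x))) \<le> K * (y1 - y0)"
  proof (rule deriv_bilipschitz[where f' = "\<lambda>x y. exp (2 * y) / sqrt (exp (2 * x) + exp (2 * y))"])
    show "continuous_on ({-B..B} \<times> {-B..B}) (\<lambda>(x, y). exp (2 * y) / sqrt (exp (2 * x) + exp (2 * y)))"
      unfolding case_prod_unfold using pos by (auto intro!: continuous_intros simp: less_imp_neq[symmetric])
    fix x y :: real
    show "((\<lambda>y. sqrt (exp (2 * x) + exp (2 * y)) + p * sqrt (1 + exp (2 * x))) has_real_derivative
        exp (2 * y) / sqrt (exp (2 * x) + exp (2 * y))) (at y)"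
      using pos(1)[of x y] by (auto intro!: derivative_eq_intros simp: field_simps)
    show "0 < exp (2 * y) / sqrt (exp (2 * x) + exp (2 * y))" using pos by auto
  qed
  have sinh_pos: "0 < sinh (arsinh (exp x) / 2)" for x :: real by simp
  then show "0 < 4 * pi * sinh (arsinh (exp x) / 2) powr \<alpha>" by simp
  show "\<forall>\<^sub>F K in at_top. \<forall>x0\<in>{-B..B}. \<forall>x1\<in>{-B..B}. x0 \<le> x1 \<longrightarrow>
      (x1 - x0) / K \<le> 4 * pi * sinh (arsinh (exp x1) / 2) powr \<alpha> - 4 * pi * sinh (arsinh (exp x0) / 2) powr \<alpha> \<and>
      4 * pi * sinh (arsinh (exp x1) / 2) powr \<alpha> - 4 * pi * sinh (arsinh (exp x0) / 2) powr \<alpha> \<le> K * (x1 - x0)"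
  proof (rule deriv_bilipschitz1[where f' = "\<lambda>x. 4 * pi * (\<alpha> * sinh (arsinh (exp x) / 2) powr (\<alpha> - 1) *
        (cosh (arsinh (exp x) / 2) * (exp x / sqrt (1 + exp (2 * x)) / 2)))"])
    show "continuous_on {-B..B} (\<lambda>x. 4 * pi * (\<alpha> * sinh (arsinh (exp x) / 2) powr (\<alpha> - 1) *
        (cosh (arsinh (exp x) / 2) * (exp x / sqrt (1 + exp (2 * x)) / 2))))"
    proof -
      have "continuous_on {-B..B} (\<lambda>x. arsinh (exp x) :: real)"
        by (intro continuous_at_imp_continuous_on ballI DERIV_isCont[OF arsinh_exp_derivative])
      then show ?thesis using sinh_pos pos(2) by (auto intro!: continuous_intros simp: less_imp_neq[symmetric])
    qed
    fix x :: real
    have "((\<lambda>x. sinh (arsinh (exp x) / 2)) has_real_derivative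
        cosh (arsinh (exp x) / 2) * (exp x / sqrt (1 + exp (2 * x)) / 2)) (at x)"
      by (rule DERIV_chain2[where f = sinh and g = "\<lambda>x. arsinh (exp x) / 2"])
        (auto intro!: derivative_eq_intros arsinh_exp_derivative)
    then show "((\<lambda>x. 4 * pi * sinh (arsinh (exp x) / 2) powr \<alpha>) has_real_derivative
        4 * pi * (\<alpha> * sinh (arsinh (exp x) / 2) powr (\<alpha> - 1) *
        (cosh (arsinh (exp x) / 2) * (exp x / sqrt (1 + exp (2 * x)) / 2)))) (at x)"
      using sinh_pos[of x] by (intro DERIV_cmult has_real_derivative_powr[THEN DERIV_chain2])
    show "0 < 4 * pi * (\<alpha> * sinh (arsinh (exp x) / 2) powr (\<alpha> - 1) *
        (cosh (arsinh (exp x) / 2) * (exp x / sqrt (1 + exp (2 * x)) / 2)))"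
      using assms sinh_pos[of x] pos(2)[of x] by (auto intro!: mult_pos_pos cosh_real_pos)
  qed
  have "\<forall>\<^sub>F K in at_top. \<forall>x0\<in>{-B..B}. \<forall>x1\<in>{-B..B}. x0 \<le> x1 \<longrightarrow>
      (x1 - x0) / K \<le> sqrt (1 + exp (2 * x1)) - sqrt (1 + exp (2 * x0)) \<and>
      sqrt (1 + exp (2 * x1)) - sqrt (1 + exp (2 * x0)) \<le> K * (x1 - x0)"
    by (rule deriv_bilipschitz1[OF _ dspeed])
      (use pos(2) in \<open>auto intro!: continuous_intros simp: less_imp_neq[symmetric]\<close>)
  then show "\<forall>\<^sub>F K in at_top. \<forall>x0\<in>{-B..B}. \<forall>x1\<in>{-B..B}. x0 \<le> x1 \<longrightarrow>
      \<bar>sqrt (1 + exp (2 * x1)) - sqrt (1 + exp (2 * x0))\<bar> \<le> K * (x1 - x0)"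
    by eventually_elim (auto simp: abs_le_iff)
qed

section \<open>Combinatorial consequences of the triangulation and the branch condition\<close>

text \<open>Each face lies inside the edge component \<open>C\<close> of \<open>v\<close> or is
  disjoint from it. The total barycentric weight on \<open>C\<close> is therefore a continuous
  function on the connected realization with values 0 and 1 only; both would occur if
  \<open>w\<close> were outside \<open>C\<close>.\<close>

lemma triangulation_connected:
  fixes V :: "'v set"
  assumes M: "closed_connected_surface M" and T: "surface_triangulation M V E F"
    and v: "v \<in> V" and w: "w \<in> V"
  shows "(v, w) \<in> {(x, y). \<exists>f\<in>F. x \<in> f \<and> y \<in> f}\<^sup>*"
proof (rule ccontr)
  define adj where "adj = {(x, y). \<exists>f\<in>F. x \<in> f \<and> y \<in> f}"
  define C where "C = {x\<in>V. (v, x) \<in> adj\<^sup>*}"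
  define g where "g x = (\<Sum>y\<in>C. x y)" for x :: "'v \<Rightarrow> real"
  assume "\<not> ?thesis"
  then have wC: "w \<notin> C" by (simp add: C_def adj_def)
  have vC: "v \<in> C" using v by (simp add: C_def)
  have V: "finite V" "V = \<Union>F" using T by (auto simp: surface_triangulation_def)
  have finC: "finite C" by (rule finite_subset[OF _ V(1)]) (auto simp: C_def)
  have face: "f \<subseteq> C \<or> f \<inter> C = {}" if "f \<in> F" for f
  proof -
    have "y \<in> C" if "x \<in> f" "x \<in> C" "y \<in> f" for x y
    proof -
      have "(x, y) \<in> adj" using that \<open>f \<in> F\<close> by (auto simp: adj_def)
      then show ?thesis using that \<open>f \<in> F\<close> V by (fastforce simp: C_def intro: rtrancl_into_rtrancl)
    qed
    then show ?thesis by blast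
  qed
  have dichotomy: "g x = 0 \<or> g x = 1" if x: "x \<in> realization F" for x
  proof -
    obtain f where f: "f \<in> F" "\<forall>y. y \<notin> f \<longrightarrow> x y = 0" "(\<Sum>y\<in>f. x y) = 1"
      using x unfolding realization_def by blast
    show ?thesis
    proof (cases "f \<subseteq> C")
      case True
      then have "g x = (\<Sum>y\<in>f. x y)" unfolding g_def using finC f by (intro sum.mono_neutral_right) auto
      then show ?thesis using f by simp
    next
      case False
      then have "f \<inter> C = {}" using face[OF f(1)] by blast
      then have "g x = 0" unfolding g_def using f(2) by (intro sum.neutral) blast
      then show ?thesis by simp
    qed
  qed
  have vertex: "vertex_point x \<in> realization F" if x: "x \<in> V" for x
  proof -
    obtain f where f: "f \<in> F" "x \<in> f" using x V(2) by blast
    have "finite f" using f V by (meson Union_upper finite_subset)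
    then have "(\<Sum>y\<in>f. vertex_point x y) = 1" using f by (simp add: vertex_point_def)
    then show ?thesis using f unfolding realization_def by (auto simp: vertex_point_def intro!: bexI[of _ f])
  qed
  have "M homeomorphic_space top_of_set (realization F)" using T by (simp add: surface_triangulation_def)
  moreover have "connected_space M" using M by (simp add: closed_connected_surface_def)
  ultimately have "connected_space (top_of_set (realization F))"
    using homeomorphic_connected_space[of M "top_of_set (realization F)"] by blast
  then have "connectedin euclidean (realization F)" by (simp add: connectedin_def)
  then have "connected (realization F)" by simp
  moreover have "continuous_on (realization F) g"
    unfolding g_def by (intro continuous_on_sum continuous_on_subset[OF continuous_on_product_coordinates]) auto
  ultimately have conn: "connected (g ` realization F)" by (rule connected_continuous_image[rotated])
  have "g (vertex_point x) = (if x \<in> C then 1 else 0)" for x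
    unfolding g_def vertex_point_def using finC by (rule sum.delta)
  then have "0 \<in> g ` realization F" "1 \<in> g ` realization F"
    using vC wC imageI[OF vertex[OF v], of g] imageI[OF vertex[OF w], of g] by simp_all
  then have "{0..1} \<subseteq> g ` realization F" by (rule connected_contains_Icc[OF conn])
  then have "1 / 2 \<in> g ` realization F" by auto
  then show False using dichotomy by force
qed

text \<open>The boundary of a face is a simple closed path with three edges. The order that it
  encloses is a natural number, so the branch inequality yields \<open>3 * pi\<close> minus the
  three weights exceeding \<open>2 * pi\<close>.\<close>

lemma branch_structure_face:
  assumes T: "surface_triangulation M V E F" and B: "branch_structure V E F \<Phi> \<beta>"
    and f: "{i, j, k} \<in> F" "distinct [i, j, k]"
  shows "\<Phi> {i, j} + \<Phi> {j, k} + \<Phi> {i, k} < pi"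
proof -
  let ?p = "[i, j, k]"
  have E: "E = {e. card e = 2 \<and> (\<exists>f\<in>F. e \<subseteq> f)}" using T by (simp add: surface_triangulation_def)
  have edges: "{i, j} \<in> E" "{j, k} \<in> E" "{k, i} \<in> E" 
    unfolding E using f by (auto intro!: bexI[of _ "{i, j, k}"])
  have "{?p ! m, ?p ! (Suc m mod length ?p)} \<in> E" if "m < length ?p" for m
  proof -
    have "m < 3" using that by simp
    then have "m = 0 \<or> m = 1 \<or> m = 2" by linarith
    then show ?thesis using edges by (elim disjE) simp_all
  qed
  then have "simple_closed_path E ?p"
    unfolding simple_closed_path_def using f(2) by simp
  then have "(\<Sum>m<length ?p. pi - \<Phi> {?p ! m, ?p ! (Suc m mod length ?p)})
      > 2 * (real (enclosed_order V F \<beta> ?p) + 1) * pi"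
    using B unfolding branch_structure_def by blast
  moreover have "(\<Sum>m<length ?p. pi - \<Phi> {?p ! m, ?p ! (Suc m mod length ?p)}) =
      (pi - \<Phi> {i, j}) + (pi - \<Phi> {j, k}) + (pi - \<Phi> {i, k})"
  proof -
    have "{..<length ?p} = {0, 1, 2}" by auto
    moreover have "{k, i} = {i, k}" by blast
    ultimately show ?thesis by simp
  qed
  moreover have "2 * 1 * pi \<le> 2 * (real (enclosed_order V F \<beta> ?p) + 1) * pi"
    by (rule mult_right_mono) simp_all
  ultimately show ?thesis by linarith
qed

lemma euc_length_cong: "(\<And>w. w \<in> e \<Longrightarrow> r w = r' w) \<Longrightarrow> euc_length \<Phi> r e = euc_length \<Phi> r' e"
  unfolding euc_length_def by (simp cong: sum.cong prod.cong)

text \<open>Going from \<open>r\<close> to \<open>z\<close> and back recovers the radii only on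
  \<open>V\<close>, where they are positive. Angles must therefore be seen to depend on the radii at
  the vertices of the face alone.\<close>

lemma euc_angle_cong:
  assumes "v \<in> f" "\<And>w. w \<in> f \<Longrightarrow> r w = r' w"
  shows "euc_angle \<Phi> r v f = euc_angle \<Phi> r' v f"
proof -
  have len: "euc_length \<Phi> r e = euc_length \<Phi> r' e" if "e \<subseteq> f" for e
    using assms(2) that by (intro euc_length_cong) blast
  have "euc_length \<Phi> r {v, w} = euc_length \<Phi> r' {v, w}" if "w \<in> f - {v}" for w
    using assms(1) that by (intro len) blast
  then show ?thesis unfolding euc_angle_def len[OF Diff_subset]
    by (metis (no_types, lifting) prod.cong sum.cong)
qed

lemma hyp_length_cong: "(\<And>w. w \<in> e \<Longrightarrow> r w = r' w) \<Longrightarrow> hyp_length \<Phi> r e = hyp_length \<Phi> r' e"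
  unfolding hyp_length_def by (simp cong: prod.cong)

lemma hyp_angle_cong:
  assumes "v \<in> f" "\<And>w. w \<in> f \<Longrightarrow> r w = r' w"
  shows "hyp_angle \<Phi> r v f = hyp_angle \<Phi> r' v f"
proof -
  have len: "hyp_length \<Phi> r e = hyp_length \<Phi> r' e" if "e \<subseteq> f" for e
    using assms(2) that by (intro hyp_length_cong) blast
  have "hyp_length \<Phi> r {v, w} = hyp_length \<Phi> r' {v, w}" if "w \<in> f - {v}" for w
    using assms(1) that by (intro len) blast
  then show ?thesis unfolding hyp_angle_def len[OF Diff_subset]
    by (metis (no_types, lifting) prod.cong)
qed

text \<open>As \<open>exp (- u) = coth (\<rho> / 2)\<close>, radius and coordinate are tied by the
  symmetric relation \<open>sinh \<rho> * sinh (- u) = 1\<close>. It makes the passage from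
  \<open>u\<close> to \<open>ln (sinh \<rho>)\<close> explicit.\<close>

lemma hyp_coord_hyperbolic:
  assumes "0 < \<rho>"
  shows "sinh (- hyp_coord \<rho>) = 1 / sinh \<rho>" "cosh (- hyp_coord \<rho>) = cosh \<rho> / sinh \<rho>"
proof -
  define a b where "a = sinh (\<rho> / 2)" and "b = cosh (\<rho> / 2)"
  have ab: "0 < a" "0 < b" "b\<^sup>2 = a\<^sup>2 + 1" using assms by (auto simp: a_def b_def cosh_square_eq)
  have dbl: "sinh \<rho> = 2 * a * b" "cosh \<rho> = b\<^sup>2 + a\<^sup>2"
    using sinh_double[of "\<rho> / 2"] cosh_double[of "\<rho> / 2"] by (auto simp: a_def b_def)
  have u: "hyp_coord \<rho> = ln (a / b)" by (simp add: hyp_coord_def tanh_def a_def b_def)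
  have "sinh (- hyp_coord \<rho>) = (b / a - a / b) / 2"
    using ab by (simp add: u sinh_ln_real inverse_eq_divide field_simps)
  also have "\<dots> = (b\<^sup>2 - a\<^sup>2) / (2 * a * b)" using ab(1,2) by (simp add: field_simps power2_eq_square)
  finally show "sinh (- hyp_coord \<rho>) = 1 / sinh \<rho>" using ab by (simp add: dbl)
  have "cosh (- hyp_coord \<rho>) = (b / a + a / b) / 2"
    using ab by (simp add: u cosh_ln_real inverse_eq_divide field_simps)
  also have "\<dots> = (b\<^sup>2 + a\<^sup>2) / (2 * a * b)" using ab(1,2) by (simp add: field_simps power2_eq_square)
  finally show "cosh (- hyp_coord \<rho>) = cosh \<rho> / sinh \<rho>" by (simp add: dbl)
qed

lemma hyp_coord_derivative:
  assumes "0 < \<rho>"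
  shows "(hyp_coord has_real_derivative 1 / sinh \<rho>) (at \<rho>)"
proof -
  define a b where "a = sinh (\<rho> / 2)" and "b = cosh (\<rho> / 2)"
  have ab: "0 < a" "0 < b" "b\<^sup>2 = a\<^sup>2 + 1" using assms by (auto simp: a_def b_def cosh_square_eq)
  have "((\<lambda>x. tanh (x / 2)) has_real_derivative (1 - (tanh (\<rho> / 2))\<^sup>2) * (1 / 2)) (at \<rho>)"
    using ab(2) by (auto intro!: derivative_eq_intros simp: b_def)
  then have "(hyp_coord has_real_derivative 1 / tanh (\<rho> / 2) * ((1 - (tanh (\<rho> / 2))\<^sup>2) * (1 / 2))) (at \<rho>)"
    unfolding hyp_coord_def[abs_def]
    by (rule DERIV_chain2[where f = ln and g = "\<lambda>x. tanh (x / 2)", rotated])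
      (use assms in \<open>auto intro!: derivative_eq_intros\<close>)
  moreover have "1 / tanh (\<rho> / 2) * ((1 - (tanh (\<rho> / 2))\<^sup>2) * (1 / 2)) = 1 / sinh \<rho>"
  proof -
    have "1 - (a / b)\<^sup>2 = (b\<^sup>2 - a\<^sup>2) / b\<^sup>2" using ab(2) by (simp add: power_divide diff_divide_distrib)
    then have "1 - (a / b)\<^sup>2 = 1 / b\<^sup>2" using ab(3) by simp
    then have "1 / (a / b) * ((1 - (a / b)\<^sup>2) * (1 / 2)) = 1 / (a / b) * (1 / b\<^sup>2 * (1 / 2))"
      by (simp only:)
    also have "\<dots> = 1 / (2 * a * b)" using ab(1,2) by (simp add: field_simps power2_eq_square)
    finally show ?thesis using sinh_double[of "\<rho> / 2"] by (simp add: tanh_def a_def b_def)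
  qed
  ultimately show ?thesis by simp
qed

lemma sqrt_one_plus_exp_ln_sinh:
  assumes "0 < \<rho>"
  shows "sqrt (1 + exp (2 * ln (sinh \<rho>))) = cosh \<rho>"
proof -
  have "1 + exp (2 * ln (sinh \<rho>)) = (cosh \<rho>)\<^sup>2" using assms by (simp add: exp_double cosh_square_eq)
  then show ?thesis by simp
qed

section \<open>The theorem, by interpretation in both geometries\<close>

theorem theorem6p2:
  fixes M :: "'m topology"
    and V :: "'v set" and E F :: "'v set set"
    and \<Phi> :: "'v set \<Rightarrow> real" and \<beta> :: "'v \<Rightarrow> nat"
    and \<alpha> :: real and Rbar :: "'v \<Rightarrow> real"
  assumes "closed_connected_surface M"
    and "surface_triangulation M V E F"
    and "\<Phi> \<in> E \<rightarrow> {0..pi / 2}"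
    and "branch_structure V E F \<Phi> \<beta>"
    and "\<alpha> \<ge> 0"
    and "\<forall>v\<in>V. Rbar v \<le> 0"
    and "\<exists>v\<in>V. \<alpha> * Rbar v \<noteq> 0"
  shows
    "(\<forall>rE. circle_packing_metric V rE \<and>
           (\<forall>v\<in>V. euc_branched_curvature F \<Phi> \<beta> \<alpha> rE v = Rbar v) \<longrightarrow>
        (\<forall>r. circle_packing_metric V r \<and>
             (\<forall>v\<in>V. euc_branched_curvature F \<Phi> \<beta> \<alpha> r v = Rbar v) \<longrightarrow>
           (\<forall>v\<in>V. r v = rE v))) \<and>
     (\<forall>rH. circle_packing_metric V rH \<and>
           (\<forall>v\<in>V. hyp_branched_curvature F \<Phi> \<beta> \<alpha> rH v = Rbar v) \<longrightarrow>
        (\<forall>r. circle_packing_metric V r \<and>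
             (\<forall>v\<in>V. hyp_branched_curvature F \<Phi> \<beta> \<alpha> r v = Rbar v) \<longrightarrow>
           (\<forall>v\<in>V. r v = rH v))) \<and>
     (\<forall>rE. circle_packing_metric V rE \<longrightarrow>
        ((\<forall>v\<in>V. euc_branched_curvature F \<Phi> \<beta> \<alpha> rE v = Rbar v) \<longleftrightarrow>
         flow_converges_exponentially V euc_coord
           (euc_branched_curvature F \<Phi> \<beta> \<alpha>) Rbar rE)) \<and>
     (\<forall>rH. circle_packing_metric V rH \<longrightarrow>
        ((\<forall>v\<in>V. hyp_branched_curvature F \<Phi> \<beta> \<alpha> rH v = Rbar v) \<longleftrightarrow>
         flow_converges_exponentially V hyp_coord
           (hyp_branched_curvature F \<Phi> \<beta> \<alpha>) Rbar rH))"
proof -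
  obtain i0 where i0: "i0 \<in> V" "\<alpha> * Rbar i0 \<noteq> 0" using assms(7) by blast
  \<comment> \<open>A nonzero product provides both strict inequalities: a growing area and a vertex
    where the target is negative.\<close>
  then have \<alpha>: "0 < \<alpha>" and R0: "Rbar i0 < 0" using assms(5,6) by (auto simp: less_le)
  have V: "finite V" "V = \<Union>F" and E: "E = {e. card e = 2 \<and> (\<exists>f\<in>F. e \<subseteq> f)}"
    and face: "\<And>f. f \<in> F \<Longrightarrow> f \<subseteq> V \<and> card f = 3"
    using assms(2) by (auto simp: surface_triangulation_def)
  have \<Phi>: "\<Phi> e \<in> {0..pi / 2}" if "f \<in> F" "e \<subseteq> f" "card e = 2" for f e
    using assms(3) that by (auto simp: E Pi_iff)
  have c: "cos (\<Phi> e) \<in> {0..1}" if "f \<in> F" "e \<subseteq> f" "card e = 2" for f e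
    using \<Phi>[OF that] by (auto intro: cos_ge_zero)
  have edges: "cos (\<Phi> {i, j}) \<in> {0..1}" "cos (\<Phi> {i, k}) \<in> {0..1}" "cos (\<Phi> {j, k}) \<in> {0..1}"
    if "{i, j, k} \<in> F" "distinct [i, j, k]" for i j k
    using that by (auto intro!: c[OF that(1), of "{i, j}"] c[OF that(1), of "{i, k}"] c[OF that(1), of "{j, k}"]
        simp del: atLeastAtMost_iff)
  \<comment> \<open>Failure would mean cosine 1 on \<open>{i, j}\<close> and cosine 0 on the other
    two edges. Two right angles already bring the sum of the three weights up to \<open>pi\<close>,
    against the branch condition on the face.\<close>
  have nondeg: "cos (\<Phi> {i, j}) < 1 \<or> 0 < cos (\<Phi> {j, k}) + cos (\<Phi> {i, j}) * cos (\<Phi> {i, k})"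
    if f: "{i, j, k} \<in> F" "distinct [i, j, k]" for i j k
  proof (rule ccontr)
    assume neg: "\<not> ?thesis"
    then have one: "cos (\<Phi> {i, j}) = 1" using edges(1)[OF f] by (simp add: order_antisym)
    have "0 \<le> cos (\<Phi> {i, k})" "0 \<le> cos (\<Phi> {j, k})" using edges(2,3)[OF f] by auto
    then have eq: "cos (\<Phi> {i, k}) = 0" "cos (\<Phi> {j, k}) = 0" using neg one by auto
    have rng: "\<Phi> {i, j} \<in> {0..pi / 2}" "\<Phi> {i, k} \<in> {0..pi / 2}" "\<Phi> {j, k} \<in> {0..pi / 2}"
      using f(2) by (auto intro!: \<Phi>[OF f(1), of "{i, j}"] \<Phi>[OF f(1), of "{i, k}"] \<Phi>[OF f(1), of "{j, k}"]
        simp del: atLeastAtMost_iff)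
    have "x = pi / 2" if "x \<in> {0..pi / 2}" "cos x = 0" for x
      using cos_gt_zero_pi[of x] that by (cases "x < pi / 2") auto
    then have "\<Phi> {i, k} = pi / 2" "\<Phi> {j, k} = pi / 2" using rng eq by auto
    then show False using branch_structure_face[OF assms(2,4) f] rng by auto
  qed
  have conn: "(i0, v) \<in> {(v, w). \<exists>f\<in>F. v \<in> f \<and> w \<in> f}\<^sup>*" if "v \<in> V" for v
    by (rule triangulation_connected[OF assms(1,2) i0(1) that])
  have Rbar: "Rbar v \<le> 0" if "v \<in> V" for v using assms(6) that by blast
  have in_V: "w \<in> V" if "f \<in> F" "w \<in> f" for f w using V that by auto

  interpret EG: packing_geometry "\<lambda>p x y. exp y + p" "\<lambda>x. pi * exp (\<alpha> * x)" "\<lambda>x. 1"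
    by (rule euc_packing_geometry[OF \<alpha>])
  \<comment> \<open>The branch orders shift the constant part \<open>\<kappa>\<close> of the
    curvature, so they leave all comparisons of defects unchanged.\<close>
  interpret EF: packing_flow "\<lambda>p x y. exp y + p" "\<lambda>x. pi * exp (\<alpha> * x)" "\<lambda>x. 1" V F "\<lambda>e. cos (\<Phi> e)"
    "\<lambda>z. euc_angle \<Phi> (\<lambda>w. exp (z w))" "\<lambda>v. 2 * pi + 2 * pi * real (\<beta> v)" Rbar i0
  proof
    show "euc_angle \<Phi> (\<lambda>w. exp (z w)) i {i, j, k} = cone_angle (cos (\<Phi> {i, j})) (cos (\<Phi> {i, k})) (cos (\<Phi> {j, k}))
        (exp (z i - z j) + cos (\<Phi> {i, j})) (exp (z i - z k) + cos (\<Phi> {i, k}))"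
      if "{i, j, k} \<in> F" "distinct [i, j, k]" for z i j k
      using euc_angle_eq_cone_angle[OF that(2), of "\<lambda>w. exp (z w)" \<Phi>] edges[OF that] by (simp add: exp_diff)
  qed (fact V(1) face c nondeg conn Rbar i0 R0)+
  \<comment> \<open>In the Euclidean case \<open>z\<close> is the flow coordinate itself:
    \<open>chi\<close> is the identity and the speed is 1.\<close>
  interpret E: packing_coordinates "\<lambda>p x y. exp y + p" "\<lambda>x. pi * exp (\<alpha> * x)" "\<lambda>x. 1" V F "\<lambda>e. cos (\<Phi> e)"
    "\<lambda>z. euc_angle \<Phi> (\<lambda>w. exp (z w))" "\<lambda>v. 2 * pi + 2 * pi * real (\<beta> v)" Rbar i0
    euc_coord exp ln "\<lambda>x. x" "euc_branched_curvature F \<Phi> \<beta> \<alpha>"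
  proof
    fix r v assume r: "circle_packing_metric V r" and v: "v \<in> V"
    have "euc_angle \<Phi> (\<lambda>w. exp (ln (r w))) v f = euc_angle \<Phi> r v f" if "f \<in> F" "v \<in> f" for f
      using r in_V[OF that(1)] by (intro euc_angle_cong that(2)) (auto simp: circle_packing_metric_def)
    then have "(\<Sum>f\<in>{f\<in>F. v \<in> f}. euc_angle \<Phi> (\<lambda>w. exp (ln (r w))) v f) = (\<Sum>f\<in>{f\<in>F. v \<in> f}. euc_angle \<Phi> r v f)"
      by (intro sum.cong) auto
    moreover have "r v powr \<alpha> = exp (\<alpha> * ln (r v))" using r v by (auto simp: powr_def circle_packing_metric_def)
    ultimately show "Rbar v - euc_branched_curvature F \<Phi> \<beta> \<alpha> r v = EF.defect (\<lambda>w. ln (r w)) v / (pi * exp (\<alpha> * ln (r v)))"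
      unfolding EF.defect_def by (simp add: euc_branched_curvature_def euc_curvature_def euc_area_def field_simps)
  next
    fix \<rho> x :: real assume "0 < \<rho>"
    then show "isCont ln \<rho>" using DERIV_isCont DERIV_ln by blast
  qed (auto simp: euc_coord_def intro!: exp_bilipschitz derivative_eq_intros)

  interpret HG: packing_geometry "\<lambda>p x y. sqrt (exp (2 * x) + exp (2 * y)) + p * sqrt (1 + exp (2 * x))"
    "\<lambda>x. 4 * pi * sinh (arsinh (exp x) / 2) powr \<alpha>" "\<lambda>x. sqrt (1 + exp (2 * x))"
    by (rule hyp_packing_geometry[OF \<alpha>])
  interpret HF: packing_flow "\<lambda>p x y. sqrt (exp (2 * x) + exp (2 * y)) + p * sqrt (1 + exp (2 * x))"
    "\<lambda>x. 4 * pi * sinh (arsinh (exp x) / 2) powr \<alpha>" "\<lambda>x. sqrt (1 + exp (2 * x))" V F "\<lambda>e. cos (\<Phi> e)"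
    "\<lambda>z. hyp_angle \<Phi> (\<lambda>w. arsinh (exp (z w)))" "\<lambda>v. 2 * pi + 2 * pi * real (\<beta> v)" Rbar i0
  proof
    \<comment> \<open>This is \<open>sinh r\<^sub>i * coth r\<^sub>j\<close> for
      \<open>x = ln (sinh r\<^sub>i)\<close> and \<open>y = ln (sinh r\<^sub>j)\<close>.\<close>
    have T: "exp x * sqrt (1 + exp (2 * y)) / exp y = sqrt (exp (2 * x) + exp (2 * (x - y)))" for x y :: real
    proof -
      have "exp (2 * x) + exp (2 * (x - y)) = (exp x / exp y)\<^sup>2 * (1 + exp (2 * y))"
        unfolding exp_double exp_diff by (simp add: power_divide field_simps)
      then show ?thesis by (simp add: real_sqrt_mult)
    qed
    show "hyp_angle \<Phi> (\<lambda>w. arsinh (exp (z w))) i {i, j, k} = cone_angle (cos (\<Phi> {i, j})) (cos (\<Phi> {i, k})) (cos (\<Phi> {j, k}))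
        (sqrt (exp (2 * z i) + exp (2 * (z i - z j))) + cos (\<Phi> {i, j}) * sqrt (1 + exp (2 * z i)))
        (sqrt (exp (2 * z i) + exp (2 * (z i - z k))) + cos (\<Phi> {i, k}) * sqrt (1 + exp (2 * z i)))"
      if "{i, j, k} \<in> F" "distinct [i, j, k]" for z i j k
      using hyp_angle_eq_cone_angle[OF that(2) arsinh_exp_pos arsinh_exp_pos arsinh_exp_pos edges[OF that]]
      by (simp only: sinh_arsinh_real cosh_arsinh_exp T)
  qed (fact V(1) face c nondeg conn Rbar i0 R0)+
  \<comment> \<open>From \<open>sinh \<rho> * sinh (- u) = 1\<close> one gets
    \<open>ln (sinh \<rho>) = - ln (sinh (- u))\<close>, which is the choice of \<open>chi\<close>.
    Its derivative \<open>coth (- u)\<close> equals \<open>cosh \<rho>\<close>, the speed.\<close>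
  interpret H: packing_coordinates "\<lambda>p x y. sqrt (exp (2 * x) + exp (2 * y)) + p * sqrt (1 + exp (2 * x))"
    "\<lambda>x. 4 * pi * sinh (arsinh (exp x) / 2) powr \<alpha>" "\<lambda>x. sqrt (1 + exp (2 * x))" V F "\<lambda>e. cos (\<Phi> e)"
    "\<lambda>z. hyp_angle \<Phi> (\<lambda>w. arsinh (exp (z w)))" "\<lambda>v. 2 * pi + 2 * pi * real (\<beta> v)" Rbar i0
    hyp_coord "\<lambda>x. arsinh (exp x)" "\<lambda>\<rho>. ln (sinh \<rho>)" "\<lambda>x. - ln (sinh (- x))" "hyp_branched_curvature F \<Phi> \<beta> \<alpha>"
  proof
    fix r v assume r: "circle_packing_metric V r" and v: "v \<in> V"
    have inv: "arsinh (exp (ln (sinh (r w)))) = r w" if "w \<in> V" for w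
      using r that by (simp add: circle_packing_metric_def arsinh_sinh_real)
    have "hyp_angle \<Phi> (\<lambda>w. arsinh (exp (ln (sinh (r w))))) v f = hyp_angle \<Phi> r v f" if "f \<in> F" "v \<in> f" for f
      by (intro hyp_angle_cong that(2) inv in_V[OF that(1)])
    then have sum: "(\<Sum>f\<in>{f\<in>F. v \<in> f}. hyp_angle \<Phi> (\<lambda>w. arsinh (exp (ln (sinh (r w))))) v f) = (\<Sum>f\<in>{f\<in>F. v \<in> f}. hyp_angle \<Phi> r v f)"
      by (intro sum.cong) auto
    have "0 < r v" using r v by (simp add: circle_packing_metric_def)
    then have "0 < sinh (r v / 2) powr \<alpha>" by simp
    then show "Rbar v - hyp_branched_curvature F \<Phi> \<beta> \<alpha> r v = HF.defect (\<lambda>w. ln (sinh (r w))) v /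
        (4 * pi * sinh (arsinh (exp (ln (sinh (r v)))) / 2) powr \<alpha>)"
      unfolding HF.defect_def sum inv[OF v]
      by (simp add: hyp_branched_curvature_def hyp_curvature_def hyp_area_def field_simps)
  next
    fix \<rho> x :: real
    show "((\<lambda>x. hyp_coord (arsinh (exp x))) has_real_derivative 1 / sqrt (1 + exp (2 * x))) (at x)"
      using DERIV_chain2[OF hyp_coord_derivative[OF arsinh_exp_pos] arsinh_exp_derivative[of x]] by simp
    assume \<rho>: "0 < \<rho>"
    have "0 < sinh \<rho>" using \<rho> by simp
    then show "isCont (\<lambda>\<rho>. ln (sinh \<rho>)) \<rho>" by (intro continuous_intros) auto
    show "- ln (sinh (- hyp_coord \<rho>)) = ln (sinh \<rho>)"
      unfolding hyp_coord_hyperbolic[OF \<rho>] using \<open>0 < sinh \<rho>\<close> by (simp add: ln_div)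
    have s: "0 < sinh (- hyp_coord \<rho>)" unfolding hyp_coord_hyperbolic[OF \<rho>] using \<open>0 < sinh \<rho>\<close> by simp
    have "((\<lambda>x. - ln (sinh (- x))) has_real_derivative cosh (- hyp_coord \<rho>) / sinh (- hyp_coord \<rho>)) (at (hyp_coord \<rho>))"
      using s by (auto intro!: derivative_eq_intros)
    then show "((\<lambda>x. - ln (sinh (- x))) has_real_derivative sqrt (1 + exp (2 * ln (sinh \<rho>)))) (at (hyp_coord \<rho>))"
      unfolding sqrt_one_plus_exp_ln_sinh[OF \<rho>] hyp_coord_hyperbolic[OF \<rho>] using \<open>0 < sinh \<rho>\<close> by simp
    show "arsinh (exp (ln (sinh \<rho>))) = \<rho>" using \<open>0 < sinh \<rho>\<close> by (simp add: arsinh_sinh_real)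
  next
    fix B :: real
    show "\<forall>\<^sub>F K in at_top. \<forall>x0\<in>{-B..B}. \<forall>x1\<in>{-B..B}. x0 \<le> x1 \<longrightarrow>
      (x1 - x0) / K \<le> arsinh (exp x1) - arsinh (exp x0) \<and> arsinh (exp x1) - arsinh (exp x0) \<le> K * (x1 - x0)"
    proof (rule deriv_bilipschitz1[OF _ arsinh_exp_derivative])
      have "0 < 1 + exp (2 * x)" for x :: real by (intro add_pos_pos) auto
      then show "continuous_on {-B..B} (\<lambda>x. exp x / sqrt (1 + exp (2 * x)))" "0 < exp x / sqrt (1 + exp (2 * x))" for x :: real
        by (auto intro!: continuous_intros simp: less_imp_neq[symmetric])
    qed
  qed simp_all

  show ?thesis using E.unique_and_attracting H.unique_and_attracting by blast
qed

end
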